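(* Fix $l\in(0,1/2)$ and $0<\eta<1$, and let $\mathcal H_N(\eta):=\{x\in V_N^l:\Phi_x\ge 2\sqrt g\,\eta\log N\}$. Then $$\lim_{N\to\infty}\frac{\log|\mathcal H_N(\eta)|}{\log N}=2(1-\eta^2)\quad\text{in probability.}$$ Moreover, for every $\delta>0$ there is a constant $c>0$ such that for all $N$ large enough $$\mathbf P\big(|\mathcal H_N(\eta)|\le N^{2(1-\eta^2)-\delta}\big)\le\exp[-c(\log N)^2].$$
   Context: For an integer $N\ge1$ let $V_N=\{1,\dots,N\}^2\subset\mathbb Z^2$, let $\partial V_N$ be the set of points of $V_N$ having a nearest neighbour outside $V_N$, and $\mathrm{int}(V_N)=V_N\setminus\partial V_N$. The two-dimensional discrete Gaussian free field (GFF) on $V_N$ is the centered Gaussian family $\Phi=(\Phi_x)_{x\in V_N}$ (under a probability $\mathbf P$) with $\Phi_x=0$ for $x\in\partial V_N$ and covariance $\mathrm{Cov}(\Phi_x,\Phi_y)=G_N(x,y)=\mathbb E_x\big(\sum_{i=0}^{\tau_{\partial V_N}}\mathbf 1_{\{\eta_i=y\}}\big)$ for $x,y\in\mathrm{int}(V_N)$, where $(\eta_i)_{i\ge0}$ is simple random walk on $\mathbb Z^2$ started at $x$ and $\tau_{\partial V_N}=\inf\{i\ge0:\eta_i\in\partial V_N\}$. Let $g=2/\pi$ and $\log$ the natural logarithm. For $l\in(0,1/2)$, $V_N^l:=\{x\in V_N:\mathrm{dist}(x,V_N^c)\ge lN\}$. *)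

theory Defs
  imports "HOL-Probability.Probability"
begin

type_synonym pt = "int \<times> int"

definition box :: "nat \<Rightarrow> pt set" where
  "box N = {1..int N} \<times> {1..int N}"

definition nbrs :: "pt \<Rightarrow> pt set" where
  "nbrs x = {(fst x + 1, snd x), (fst x - 1, snd x), (fst x, snd x + 1), (fst x, snd x - 1)}"

definition bdry :: "nat \<Rightarrow> pt set" where
  "bdry N = {x \<in> box N. \<exists>z \<in> nbrs x. z \<notin> box N}"

definition intr :: "nat \<Rightarrow> pt set" where
  "intr N = box N - bdry N"

definition ptdist :: "pt \<Rightarrow> pt \<Rightarrow> real" where
  "ptdist x z = sqrt ((real_of_int (fst x - fst z))\<^sup>2 + (real_of_int (snd x - snd z))\<^sup>2)"

definition box_l :: "nat \<Rightarrow> real \<Rightarrow> pt set" where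
  "box_l N l = {x \<in> box N. \<forall>z. z \<notin> box N \<longrightarrow> ptdist x z \<ge> l * real N}"

text \<open>killed_kernel N n x y = P_x(eta_0, ..., eta_n all in int(V_N) and eta_n = y)
  for simple random walk eta started at x in int(V_N).\<close>
fun killed_kernel :: "nat \<Rightarrow> nat \<Rightarrow> pt \<Rightarrow> pt \<Rightarrow> real" where
  "killed_kernel N 0 x y = (if x = y then 1 else 0)"
| "killed_kernel N (Suc n) x y =
     (\<Sum>z \<in> nbrs x \<inter> intr N. killed_kernel N n z y / 4)"

text \<open>Green function: expected number of visits to y before (and at) hitting the boundary,
  for x, y in int(V_N).\<close>
definition green :: "nat \<Rightarrow> pt \<Rightarrow> pt \<Rightarrow> real" where
  "green N x y = (\<Sum>n. killed_kernel N n x y)"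

text \<open>Phi is a discrete GFF on V_N under M: zero on the boundary, and (Phi_x)_{x in int V_N}
  a centred Gaussian family with covariance green N (every nondegenerate linear combination
  is centred normal with the corresponding variance).\<close>
definition is_GFF :: "'a measure \<Rightarrow> nat \<Rightarrow> (pt \<Rightarrow> 'a \<Rightarrow> real) \<Rightarrow> bool" where
  "is_GFF M N Phi \<longleftrightarrow> prob_space M
     \<and> (\<forall>x. Phi x \<in> borel_measurable M)
     \<and> (\<forall>x \<in> bdry N. \<forall>\<omega> \<in> space M. Phi x \<omega> = 0)
     \<and> (\<forall>a :: pt \<Rightarrow> real.
          let v = (\<Sum>x \<in> intr N. \<Sum>y \<in> intr N. a x * a y * green N x y) in
          v > 0 \<longrightarrow> distributed M lborel (\<lambda>\<omega>. \<Sum>x \<in> intr N. a x * Phi x \<omega>)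
                                   (normal_density 0 (sqrt v)))"

definition thick :: "nat \<Rightarrow> real \<Rightarrow> real \<Rightarrow> (pt \<Rightarrow> 'a \<Rightarrow> real) \<Rightarrow> 'a \<Rightarrow> pt set" where
  "thick N l \<eta> Phi \<omega> = {x \<in> box_l N l. Phi x \<omega> \<ge> 2 * sqrt (2 / pi) * \<eta> * ln (real N)}"

end

theory Submission
  imports Defs "HOL-Real_Asymp.Real_Asymp"
begin

text \<open>
  The upper bound on the number of high points is a first moment estimate. For the lower bound the
  bulk of the box is tiled by a tree of nested sub-boxes of side \<open>N powr (1 - k / J)\<close>, with \<open>J\<close> large
  but fixed. Evaluating at the centre of a sub-box the difference of the harmonic extensions into the
  sub-box and into its parent gives increments that are independent for different parents and have
  variance \<open>(2 / pi) * ln N / J + O(1)\<close>; up to errors of bounded variance, the field at a leaf is the sum of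
  the increments on its path. The leaves whose increments are all at least \<open>1 / J\<close> of the target
  form a branching process, and first moments alone show that it has the right size with probability
  bounded below, because the first generation below a level one box only asks for nonnegative increments.
  The level one boxes are lined up so that the average of their root increments over any fixed
  positive proportion of them has bounded variance. As the set of successful level one boxes is
  independent of the root increments, the probability that all root increments in it are below
  \<open>- \<epsilon> * ln N\<close> is at most \<open>exp (- c * (ln N)^2)\<close>.
  The constant \<open>2 / pi\<close> comes from \<open>f x = ln (|x|^2 + 1) / 2\<close>: its discrete Laplacian is nonnegative,
  of order \<open>|x| powr -4\<close>, and by a flux computation has total mass \<open>pi / 2\<close>.
\<close>

section \<open>The Dirichlet form and the Green function of a finite domain\<close>

text \<open>The field is given only through the laws of single linear combinations, so every
  Gaussian statement is read off from energies: the sum of \<open>lap u x * Phi x\<close> has the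
  Dirichlet form of \<open>u\<close> as its variance, orthogonality gives independence through
  characteristic functions, and the Markov property becomes the fact that Green functions of nested
  domains pair to the smaller one. The obstacle in the tree is that increments of boxes with the
  same parent are correlated in an uncontrolled way. A second moment count would have to estimate
  these correlations. A recursion for Laplace transforms does not see them: k -> u^k is convex, and
  its chord over [0, b] leaves only the expected number of surviving children. A generation costs
  about N^(-2 \<eta>^2 / J) in probability against about N^(2 / J) children, so the population grows
  exactly when \<eta> < 1. A positive threshold directly below the level one boxes would make their
  success probability a negative power of N, and no fixed proportion of them could be expected to
  succeed.\<close>

lemma sum_nbrs: "(\<Sum>z\<in>nbrs x. f z) = f (fst x + 1, snd x) + f (fst x - 1, snd x) + f (fst x, snd x + 1) + (f (fst x, snd x - 1) :: 'b :: comm_monoid_add)"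
  by (simp add: nbrs_def add.assoc)

lemma finite_nbrs [simp]: "finite (nbrs x)"
  by (simp add: nbrs_def)

lemma card_nbrs [simp]: "card (nbrs x) = 4"
  by (simp add: nbrs_def)

lemma nbrs_sym: "y \<in> nbrs x \<longleftrightarrow> x \<in> nbrs y"
  by (cases x; cases y) (auto simp: nbrs_def)

text \<open>The sign makes this the positive operator I - P, with P the transition operator of the
  walk, so that the Green function is its inverse and energies are nonnegative.\<close>

definition lap :: "(pt \<Rightarrow> real) \<Rightarrow> pt \<Rightarrow> real" where
  "lap u x = u x - (\<Sum>z\<in>nbrs x. u z) / 4"

lemma lap_add: "lap (\<lambda>x. u x + v x) = (\<lambda>x. lap u x + lap v x)"
  by (auto simp: lap_def sum.distrib field_simps)

lemma lap_cmult: "lap (\<lambda>x. c * u x) = (\<lambda>x. c * lap u x)"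
  by (auto simp: lap_def sum_distrib_left[symmetric] field_simps)

lemma lap_diff: "lap (\<lambda>x. u x - v x) = (\<lambda>x. lap u x - lap v x)"
  by (auto simp: lap_def sum_subtractf field_simps)

lemma lap_sum: "lap (\<lambda>x. \<Sum>i\<in>I. u i x) = (\<lambda>x. \<Sum>i\<in>I. lap (u i) x)"
proof
  fix x
  have "(\<Sum>z\<in>nbrs x. \<Sum>i\<in>I. u i z) = (\<Sum>i\<in>I. \<Sum>z\<in>nbrs x. u i z)"
    by (rule sum.swap)
  thus "lap (\<lambda>x. \<Sum>i\<in>I. u i x) x = (\<Sum>i\<in>I. lap (u i) x)"
    by (simp add: lap_def sum_subtractf sum_divide_distrib)
qed

section \<open>Finitely supported functions and the energy form\<close>

definition supp_in :: "pt set \<Rightarrow> (pt \<Rightarrow> real) \<Rightarrow> bool" where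
  "supp_in D u \<longleftrightarrow> (\<forall>x. x \<notin> D \<longrightarrow> u x = 0)"

lemma supp_inD: "supp_in D u \<Longrightarrow> x \<notin> D \<Longrightarrow> u x = 0"
  by (simp add: supp_in_def del: split_paired_All)

lemma supp_in_mono: "supp_in B u \<Longrightarrow> B \<subseteq> D \<Longrightarrow> supp_in D u"
  by (auto simp: supp_in_def)

lemma supp_in_intros [intro]:
  "supp_in D (\<lambda>_. 0)"
  "supp_in D u \<Longrightarrow> supp_in D v \<Longrightarrow> supp_in D (\<lambda>x. u x + v x)"
  "supp_in D u \<Longrightarrow> supp_in D v \<Longrightarrow> supp_in D (\<lambda>x. u x - v x)"
  "supp_in D u \<Longrightarrow> supp_in D (\<lambda>x. c * u x)"
  "(\<And>i. i \<in> I \<Longrightarrow> supp_in D (w i)) \<Longrightarrow> supp_in D (\<lambda>x. \<Sum>i\<in>I. w i x)"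
  by (auto simp: supp_in_def)

text \<open>The double sum over \<open>D\<close> on the right has a symmetric adjacency condition;
  symmetry and positivity of the energy both come from exchanging its two variables.\<close>

lemma sum_nbrs_swap:
  assumes "finite D" "supp_in D u"
  shows "(\<Sum>x\<in>D. v x * (\<Sum>z\<in>nbrs x. u z)) = (\<Sum>x\<in>D. \<Sum>z\<in>D. if z \<in> nbrs x then v x * u z else 0)"
proof (rule sum.cong[OF refl])
  fix x
  have "(\<Sum>z\<in>nbrs x. u z) = (\<Sum>z\<in>D. if z \<in> nbrs x then u z else 0)"
    using assms by (intro sum.mono_neutral_cong) (auto dest: supp_inD)
  thus "v x * (\<Sum>z\<in>nbrs x. u z) = (\<Sum>z\<in>D. if z \<in> nbrs x then v x * u z else 0)"
    by (auto simp: sum_distrib_left intro!: sum.cong)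
qed

text \<open>The Dirichlet form after summation by parts. As soon as \<open>u\<close> vanishes off
  \<open>D\<close> this is the sum over the whole lattice, so functions living on different
  sub-boxes can all be paired inside one fixed \<open>D\<close>.\<close>

definition En :: "pt set \<Rightarrow> (pt \<Rightarrow> real) \<Rightarrow> (pt \<Rightarrow> real) \<Rightarrow> real" where
  "En D u v = (\<Sum>x\<in>D. u x * lap v x)"

lemma En_commute:
  assumes "finite D" "supp_in D u" "supp_in D v"
  shows "En D u v = En D v u"
proof -
  have "(\<Sum>x\<in>D. u x * (\<Sum>z\<in>nbrs x. v z)) = (\<Sum>x\<in>D. \<Sum>z\<in>D. if z \<in> nbrs x then u x * v z else 0)"
    by (rule sum_nbrs_swap) fact+
  also have "\<dots> = (\<Sum>x\<in>D. \<Sum>z\<in>D. if z \<in> nbrs x then v x * u z else 0)"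
    by (subst sum.swap) (auto intro!: sum.cong simp: nbrs_sym)
  also have "\<dots> = (\<Sum>x\<in>D. v x * (\<Sum>z\<in>nbrs x. u z))"
    by (rule sum_nbrs_swap[symmetric]) fact+
  finally show ?thesis
    by (simp add: En_def lap_def right_diff_distrib sum_subtractf sum_divide_distrib[symmetric] mult.commute)
qed

lemma En_add_left: "En D (\<lambda>x. u x + v x) w = En D u w + En D v w"
  and En_add_right: "En D w (\<lambda>x. u x + v x) = En D w u + En D w v"
  and En_diff_left: "En D (\<lambda>x. u x - v x) w = En D u w - En D v w"
  and En_diff_right: "En D w (\<lambda>x. u x - v x) = En D w u - En D w v"
  and En_cmult_left: "En D (\<lambda>x. c * u x) w = c * En D u w"
  and En_cmult_right: "En D w (\<lambda>x. c * u x) = c * En D w u"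
  by (auto simp: En_def lap_add lap_diff lap_cmult algebra_simps sum.distrib sum_subtractf sum_distrib_left)

lemma En_sum_left: "En D (\<lambda>x. \<Sum>i\<in>I. u i x) w = (\<Sum>i\<in>I. En D (u i) w)"
  and En_sum_right: "En D w (\<lambda>x. \<Sum>i\<in>I. u i x) = (\<Sum>i\<in>I. En D w (u i))"
  by (auto simp: En_def lap_sum sum_distrib_left sum_distrib_right intro: sum.swap)

text \<open>On each edge 2 u(x) u(z) is at most u(x)^2 + u(z)^2, and a point has at most four
  neighbours in \<open>D\<close>, so the neighbour part never exceeds the diagonal part.\<close>

lemma En_nonneg:
  assumes "finite D" "supp_in D u"
  shows "En D u u \<ge> 0"
proof -
  have "(\<Sum>x\<in>D. u x * (\<Sum>z\<in>nbrs x. u z)) = (\<Sum>x\<in>D. \<Sum>z\<in>D. if z \<in> nbrs x then u x * u z else 0)"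
    by (rule sum_nbrs_swap) fact+
  also have "\<dots> \<le> (\<Sum>x\<in>D. \<Sum>z\<in>D. if z \<in> nbrs x then (u x)\<^sup>2 / 2 + (u z)\<^sup>2 / 2 else 0)"
  proof (intro sum_mono)
    fix x z
    have "2 * (u x * u z) \<le> (u x)\<^sup>2 + (u z)\<^sup>2" using sum_squares_bound[of "u x" "u z"] by simp
    thus "(if z \<in> nbrs x then u x * u z else 0) \<le> (if z \<in> nbrs x then (u x)\<^sup>2 / 2 + (u z)\<^sup>2 / 2 else 0)"
      by auto
  qed
  also have "\<dots> = (\<Sum>x\<in>D. \<Sum>z\<in>D. if z \<in> nbrs x then (u x)\<^sup>2 / 2 else 0) + (\<Sum>x\<in>D. \<Sum>z\<in>D. if z \<in> nbrs x then (u z)\<^sup>2 / 2 else 0)"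
    unfolding sum.distrib[symmetric] by (intro sum.cong refl) auto
  also have "(\<Sum>x\<in>D. \<Sum>z\<in>D. if z \<in> nbrs x then (u z)\<^sup>2 / 2 else 0) = (\<Sum>x\<in>D. \<Sum>z\<in>D. if z \<in> nbrs x then (u x)\<^sup>2 / 2 else 0)"
    by (subst sum.swap) (auto intro!: sum.cong simp: nbrs_sym)
  also have "(\<Sum>x\<in>D. \<Sum>z\<in>D. if z \<in> nbrs x then (u x)\<^sup>2 / 2 else 0) \<le> (\<Sum>x\<in>D. 2 * (u x)\<^sup>2)"
  proof (intro sum_mono)
    fix x
    have "(\<Sum>z\<in>D. if z \<in> nbrs x then (u x)\<^sup>2 / 2 else 0) = (\<Sum>z\<in>D \<inter> nbrs x. (u x)\<^sup>2 / 2)"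
      using assms(1) by (simp only: sum.inter_restrict)
    also have "\<dots> \<le> (\<Sum>z\<in>nbrs x. (u x)\<^sup>2 / 2)"
      by (rule sum_mono2) auto
    finally show "(\<Sum>z\<in>D. if z \<in> nbrs x then (u x)\<^sup>2 / 2 else 0) \<le> 2 * (u x)\<^sup>2" by simp
  qed
  finally have "(\<Sum>x\<in>D. u x * (\<Sum>z\<in>nbrs x. u z)) \<le> 4 * (\<Sum>x\<in>D. (u x)\<^sup>2)"
    by (simp add: sum_distrib_left[symmetric])
  moreover have "En D u u = (\<Sum>x\<in>D. (u x)\<^sup>2) - (\<Sum>x\<in>D. u x * (\<Sum>z\<in>nbrs x. u z)) / 4"
    by (simp add: En_def lap_def right_diff_distrib sum_subtractf sum_divide_distrib[symmetric] power2_eq_square)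
  ultimately show ?thesis by simp
qed

section \<open>The Green function of a finite set from killed transition probabilities\<close>

fun kk :: "pt set \<Rightarrow> nat \<Rightarrow> pt \<Rightarrow> pt \<Rightarrow> real" where
  "kk D 0 x y = (if x = y then 1 else 0)"
| "kk D (Suc n) x y = (\<Sum>z \<in> nbrs x \<inter> D. kk D n z y / 4)"

text \<open>Arbitrary domains are allowed because the Green function of \<open>intr N\<close> is
  compared with those of sub-boxes. The explicit zero outside \<open>D\<close> is what makes
  \<open>gr D x\<close> a function supported in \<open>D\<close>: \<open>kk D 0 x x\<close> is 1 for
  every \<open>x\<close>, inside or not.\<close>

definition gr :: "pt set \<Rightarrow> pt \<Rightarrow> pt \<Rightarrow> real" where
  "gr D x y = (if x \<in> D \<and> y \<in> D then (\<Sum>n. kk D n x y) else 0)"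

lemma killed_kernel_eq: "killed_kernel N n x y = kk (intr N) n x y"
  by (induction n arbitrary: x) auto

lemma gr_eq_green: "x \<in> intr N \<Longrightarrow> y \<in> intr N \<Longrightarrow> green N x y = gr (intr N) x y"
  by (simp add: green_def gr_def killed_kernel_eq)

lemma kk_nonneg [simp]: "kk D n x y \<ge> 0"
  by (induction n arbitrary: x) (auto intro!: sum_nonneg)

text \<open>Decomposition at the last step instead of the first one; together the two recursions
  give the symmetry of the kernel.\<close>

lemma kk_Suc2:
  assumes "x \<in> D" "y \<in> D"
  shows "kk D (Suc n) x y = (\<Sum>z \<in> nbrs y \<inter> D. kk D n x z / 4)"
  using assms
proof (induction n arbitrary: x)
  case 0
  have "(\<Sum>z\<in>nbrs x \<inter> D. (if z = y then 1 else 0) / 4) = (if y \<in> nbrs x then 1/4 else (0::real))"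
    using 0 by (subst sum.cong[OF refl, where h = "\<lambda>z. if y = z then 1/4 else 0"]) (auto simp: sum.delta)
  moreover have "(\<Sum>z\<in>nbrs y \<inter> D. (if x = z then 1 else 0) / 4) = (if x \<in> nbrs y then 1/4 else (0::real))"
    using 0 by (subst sum.cong[OF refl, where h = "\<lambda>z. if x = z then 1/4 else 0"]) (auto simp: sum.delta)
  ultimately show ?case by (simp add: nbrs_sym)
next
  case (Suc n)
  have "kk D (Suc (Suc n)) x y = (\<Sum>w \<in> nbrs x \<inter> D. kk D (Suc n) w y / 4)" by simp
  also have "\<dots> = (\<Sum>w \<in> nbrs x \<inter> D. (\<Sum>z \<in> nbrs y \<inter> D. kk D n w z / 4) / 4)"
    using Suc by (intro sum.cong refl) (auto simp del: kk.simps)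
  also have "\<dots> = (\<Sum>z \<in> nbrs y \<inter> D. \<Sum>w \<in> nbrs x \<inter> D. kk D n w z / 4 / 4)"
    by (subst sum.swap) (simp add: sum_divide_distrib)
  also have "\<dots> = (\<Sum>z \<in> nbrs y \<inter> D. kk D (Suc n) x z / 4)"
    by (simp add: sum_divide_distrib)
  finally show ?case .
qed

lemma kk_sym: "x \<in> D \<Longrightarrow> y \<in> D \<Longrightarrow> kk D n x y = kk D n y x"
proof (induction n arbitrary: x)
  case (Suc n)
  have "kk D (Suc n) x y = (\<Sum>z \<in> nbrs x \<inter> D. kk D n z y / 4)" by simp
  also have "\<dots> = (\<Sum>z \<in> nbrs x \<inter> D. kk D n y z / 4)"
    using Suc by (intro sum.cong) auto
  also have "\<dots> = kk D (Suc n) y x"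
    using Suc by (subst kk_Suc2) auto
  finally show ?case .
qed auto

text \<open>The function z -> K + 1 - |z|^2 has \<open>lap\<close> equal to 1, because averaging
  |z|^2 over neighbours adds 1, and it is nonnegative on \<open>D\<close> and its neighbours. It
  therefore dominates the expected number of visits up to any finite time.\<close>

lemma kk_partial_sum_bound:
  assumes K: "\<And>z. z \<in> D \<union> (\<Union>w\<in>D. nbrs w) \<Longrightarrow> (fst z)\<^sup>2 + (snd z)\<^sup>2 \<le> K"
    and x: "x \<in> D"
  shows "(\<Sum>n<m. kk D n x y) \<le> real_of_int (K + 1 - (fst x)\<^sup>2 - (snd x)\<^sup>2)"
  using x
proof (induction m arbitrary: x)
  case 0
  have "K + 1 - (fst x)\<^sup>2 - (snd x)\<^sup>2 \<ge> 0" using K[of x] 0 by simp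
  thus ?case by (simp only: lessThan_0 sum.empty of_int_0_le_iff)
next
  case (Suc m)
  let ?f = "\<lambda>x::pt. real_of_int (K + 1 - (fst x)\<^sup>2 - (snd x)\<^sup>2)"
  have "(\<Sum>n<Suc m. kk D n x y) = kk D 0 x y + (\<Sum>n<m. kk D (Suc n) x y)"
    by (rule sum.lessThan_Suc_shift)
  also have "(\<Sum>n<m. kk D (Suc n) x y) = (\<Sum>z\<in>nbrs x \<inter> D. (\<Sum>n<m. kk D n z y) / 4)"
    by (simp add: sum_divide_distrib) (rule sum.swap)
  also have "\<dots> \<le> (\<Sum>z\<in>nbrs x \<inter> D. ?f z / 4)"
    using Suc by (intro sum_mono divide_right_mono) auto
  also have "\<dots> \<le> (\<Sum>z\<in>nbrs x. ?f z / 4)"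
  proof (rule sum_mono2)
    fix z assume z: "z \<in> nbrs x - nbrs x \<inter> D"
    have "K + 1 - (fst z)\<^sup>2 - (snd z)\<^sup>2 \<ge> 0" using K[of z] z Suc.prems by fastforce
    thus "?f z / 4 \<ge> 0" by (simp only: zero_le_divide_iff of_int_0_le_iff) simp
  qed auto
  also have "\<dots> = ?f x - 1"
    by (simp add: sum_nbrs power2_eq_square field_simps)
  finally show ?case by (cases "x = y") auto
qed

lemma kk_summable:
  assumes "finite D" "x \<in> D"
  shows "summable (\<lambda>n. kk D n x y)"
proof -
  define K where "K = Max ((\<lambda>z. (fst z)\<^sup>2 + (snd z)\<^sup>2) ` (D \<union> (\<Union>w\<in>D. nbrs w)))"
  have K: "(fst z)\<^sup>2 + (snd z)\<^sup>2 \<le> K" if "z \<in> D \<union> (\<Union>w\<in>D. nbrs w)" for z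
    unfolding K_def using that assms by (intro Max_ge finite_imageI) auto
  show ?thesis
  proof (rule bounded_imp_summable)
    show "(\<Sum>k\<le>n. kk D k x y) \<le> real_of_int (K + 1 - (fst x)\<^sup>2 - (snd x)\<^sup>2)" for n
      using kk_partial_sum_bound[OF K assms(2), where m = "Suc n"] by (simp add: lessThan_Suc_atMost)
  qed auto
qed

lemma gr_nonneg: "finite D \<Longrightarrow> gr D x y \<ge> 0"
  by (auto simp: gr_def intro!: suminf_nonneg kk_summable)

lemma gr_sym: "gr D x y = gr D y x"
  by (auto simp: gr_def intro!: suminf_cong kk_sym)

lemma gr_supp: "supp_in D (gr D x)" "supp_in D (\<lambda>x. gr D x y)"
  by (auto simp: gr_def supp_in_def)

lemma lap_gr1:
  assumes "finite D" "x \<in> D"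
  shows "lap (\<lambda>x. gr D x y) x = (if x = y then 1 else 0)"
proof (cases "y \<in> D")
  case False
  thus ?thesis using assms by (auto simp: lap_def gr_def)
next
  case True
  have "gr D x y = kk D 0 x y + (\<Sum>n. kk D (Suc n) x y)"
    using assms True suminf_split_head[OF kk_summable[OF assms], of y] by (simp add: gr_def del: kk.simps(2))
  also have "(\<Sum>n. kk D (Suc n) x y) = (\<Sum>n. \<Sum>z\<in>nbrs x \<inter> D. kk D n z y / 4)" by simp
  also have "\<dots> = (\<Sum>z\<in>nbrs x \<inter> D. \<Sum>n. kk D n z y / 4)"
    by (intro suminf_sum summable_divide kk_summable assms) auto
  also have "\<dots> = (\<Sum>z\<in>nbrs x \<inter> D. gr D z y / 4)"
    using True assms by (intro sum.cong refl) (auto simp: gr_def suminf_divide[OF kk_summable])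
  also have "\<dots> = (\<Sum>z\<in>nbrs x. gr D z y / 4)"
    by (intro sum.mono_neutral_left) (auto simp: gr_def)
  finally show ?thesis by (auto simp: lap_def sum_divide_distrib)
qed

lemma lap_gr:
  assumes "finite D" "y \<in> D"
  shows "lap (gr D x) y = (if x = y then 1 else 0)"
proof -
  have "gr D x = (\<lambda>y. gr D y x)" by (auto simp: gr_sym)
  thus ?thesis using lap_gr1[OF assms, of x] by auto
qed

text \<open>Reproducing property: a function supported in \<open>B\<close> tests
  \<open>lap (gr B x)\<close> only on \<open>B\<close>, where it is the point mass at
  \<open>x\<close>; the charge on the outer boundary of \<open>B\<close> is invisible to it. For
  \<open>x\<close> outside \<open>B\<close> both sides vanish.\<close>

lemma En_gr:
  assumes "finite D" "supp_in B u" "B \<subseteq> D"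
  shows "En D u (gr B x) = u x"
proof -
  have B: "finite B" using assms finite_subset by blast
  have "En D u (gr B x) = (\<Sum>y\<in>B. u y * lap (gr B x) y)"
    unfolding En_def using assms by (intro sum.mono_neutral_right) (auto simp: supp_in_def)
  also have "\<dots> = (\<Sum>y\<in>B. if x = y then u x else 0)"
    by (intro sum.cong refl) (auto simp: lap_gr[OF B])
  also have "\<dots> = u x" using B supp_inD[OF assms(2)] by auto
  finally show ?thesis .
qed

lemma gr_repr:
  assumes "finite D" "supp_in D u"
  shows "u x = (\<Sum>z\<in>D. gr D x z * lap u z)"
proof -
  have "En D (gr D x) u = u x"
    using En_gr[OF assms(1,2) order_refl, of x] En_commute[OF assms(1) gr_supp(1) assms(2)] by simp
  thus ?thesis by (simp add: En_def)
qed

text \<open>This is the Markov property in Hilbert space form: by it \<open>gr D x - gr B x\<close>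
  is orthogonal to every Green function of a set inside \<open>B\<close>. All variances and
  covariances below are computed from it.\<close>

lemma En_gr_gr_subset:
  assumes "finite D" "B \<subseteq> D" "B' \<subseteq> B"
  shows "En D (gr B' y) (gr B x) = gr B' y x" "En D (gr B x) (gr B' y) = gr B' y x"
proof -
  show 1: "En D (gr B' y) (gr B x) = gr B' y x"
    using assms by (intro En_gr) (auto intro: supp_in_mono gr_supp)
  have "supp_in D (gr B x)" "supp_in D (gr B' y)"
    using gr_supp(1)[of B x] gr_supp(1)[of B' y] assms by (meson supp_in_mono subset_trans)+
  thus "En D (gr B x) (gr B' y) = gr B' y x"
    using 1 En_commute[OF assms(1)] by simp
qed

text \<open>Disjoint supports alone do not give orthogonality, since \<open>lap\<close> couples
  neighbours; hence the condition that no edge joins the two sets.\<close>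

definition separated :: "pt set \<Rightarrow> pt set \<Rightarrow> bool" where
  "separated A B \<longleftrightarrow> A \<inter> B = {} \<and> (\<forall>a\<in>A. nbrs a \<inter> B = {})"

lemma En_separated:
  assumes "separated A B" "supp_in A u" "supp_in B v"
  shows "En D u v = 0"
  unfolding En_def
proof (rule sum.neutral, rule ballI)
  fix x
  show "u x * lap v x = 0"
  proof (cases "x \<in> A")
    case True
    hence "v z = 0" if "z \<in> insert x (nbrs x)" for z
      using that assms by (intro supp_inD[OF assms(3)]) (auto simp: separated_def)
    thus ?thesis by (simp add: lap_def)
  qed (simp add: supp_inD[OF assms(2)])
qed

text \<open>If the energy of \<open>u\<close> vanishes, the energy of \<open>gr D x + s * u\<close>
  is affine in \<open>s\<close> with slope \<open>2 * u x\<close>, and nonnegativity for all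
  \<open>s\<close> forces the slope to be zero.\<close>

lemma En_zero_imp:
  assumes "finite D" "supp_in D u" "En D u u = 0"
  shows "u x = 0"
proof (rule ccontr)
  assume ux: "u x \<noteq> 0"
  let ?g = "gr D x"
  \<comment> \<open>Chosen so that the affine function takes the value -1.\<close>
  define s where "s = - (gr D x x + 1) / (2 * u x)"
  have supp: "supp_in D (\<lambda>y. ?g y + s * u y)"
    by (intro supp_in_intros gr_supp assms)
  have "En D (\<lambda>y. ?g y + s * u y) (\<lambda>y. ?g y + s * u y)
      = En D ?g ?g + s * En D u ?g + s * En D ?g u + s * s * En D u u"
    by (simp add: En_add_left En_add_right En_cmult_left En_cmult_right algebra_simps)
  also have "En D ?g ?g = gr D x x" using En_gr_gr_subset[OF assms(1) order_refl order_refl] by simp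
  also have "En D u ?g = u x" using En_gr[OF assms(1,2) order_refl] by simp
  also have "En D ?g u = u x"
    using En_gr[OF assms(1,2) order_refl, of x] En_commute[OF assms(1) gr_supp(1) assms(2)] by simp
  also have "gr D x x + s * u x + s * u x + s * s * En D u u = -1"
    using ux assms by (simp add: s_def field_simps)
  finally show False using En_nonneg[OF assms(1) supp] by simp
qed

section \<open>Currents through level sets and the Lipschitz bound for Green functions\<close>

lemma sum_lap_eq_boundary_flux:
  assumes "finite A"
  shows "(\<Sum>a\<in>A. lap u a) = (\<Sum>a\<in>A. \<Sum>b\<in>nbrs a - A. (u a - u b) / 4)"
proof -
  have "lap u a = (\<Sum>b\<in>nbrs a. (u a - u b) / 4)" for a
    by (simp add: lap_def sum_subtractf diff_divide_distrib sum_divide_distrib)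
  also have "(\<Sum>b\<in>nbrs a. (u a - u b) / 4) = (\<Sum>b\<in>nbrs a - A. (u a - u b) / 4) + (\<Sum>b\<in>nbrs a \<inter> A. (u a - u b) / 4)" for a
    by (subst sum.union_disjoint[symmetric]) (auto intro!: sum.cong)
  finally have "(\<Sum>a\<in>A. lap u a) = (\<Sum>a\<in>A. \<Sum>b\<in>nbrs a - A. (u a - u b) / 4) + (\<Sum>a\<in>A. \<Sum>b\<in>nbrs a \<inter> A. (u a - u b) / 4)"
    by (simp add: sum.distrib)
  also have "(\<Sum>a\<in>A. \<Sum>b\<in>nbrs a \<inter> A. (u a - u b) / 4) = 0"
  proof -
    let ?S = "\<Sum>a\<in>A. \<Sum>b\<in>A. if b \<in> nbrs a then (u a - u b) / 4 else 0"
    have "(\<Sum>a\<in>A. \<Sum>b\<in>nbrs a \<inter> A. (u a - u b) / 4) = ?S"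
      using assms by (simp only: Int_commute[of "nbrs _" A] sum.inter_restrict)
    moreover have "?S = - ?S"
      by (subst sum.swap) (auto simp: sum_negf[symmetric] nbrs_sym minus_divide_left intro!: sum.cong)
    ultimately show ?thesis by simp
  qed
  finally show ?thesis by simp
qed

text \<open>Only a unit current leaves the superlevel set of \<open>gr D x\<close> at height \<open>gr D x z'\<close>, and it
  bounds the current through the edge from \<open>z\<close> to \<open>z'\<close>.\<close>

lemma gr_nbr_diff_aux:
  assumes "finite D" "z' \<in> nbrs z" "gr D x z > gr D x z'"
  shows "gr D x z - gr D x z' \<le> 4"
proof -
  let ?u = "gr D x"
  define A where "A = {w. ?u w > ?u z'}"
  have AD: "A \<subseteq> D" using gr_nonneg[OF assms(1), of x z'] by (auto simp: A_def gr_def split: if_splits)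
  hence A: "finite A" using assms finite_subset by blast
  have z: "z \<in> A" "z' \<in> nbrs z - A" using assms by (auto simp: A_def)
  have nn: "(?u a - ?u b) / 4 \<ge> 0" if "a \<in> A" "b \<in> nbrs a - A" for a b
    using that by (auto simp: A_def)
  have "(?u z - ?u z') / 4 \<le> (\<Sum>b\<in>nbrs z - A. (?u z - ?u b) / 4)"
    using nn z by (intro member_le_sum) auto
  also have "\<dots> \<le> (\<Sum>a\<in>A. \<Sum>b\<in>nbrs a - A. (?u a - ?u b) / 4)"
    using nn z A by (intro member_le_sum[of z A] sum_nonneg) auto
  also have "\<dots> = (\<Sum>a\<in>A. lap ?u a)" by (rule sum_lap_eq_boundary_flux[OF A, symmetric])
  also have "\<dots> = (\<Sum>a\<in>A. if x = a then 1 else 0)"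
    using AD by (intro sum.cong refl lap_gr assms) auto
  also have "\<dots> \<le> 1" using A by simp
  finally show ?thesis by simp
qed

lemma gr_nbr_diff: "finite D \<Longrightarrow> z' \<in> nbrs z \<Longrightarrow> \<bar>gr D x z - gr D x z'\<bar> \<le> 4"
  using gr_nbr_diff_aux[of D z' z x] gr_nbr_diff_aux[of D z z' x] nbrs_sym[of z' z]
  by (cases "gr D x z" "gr D x z'" rule: linorder_cases) auto

text \<open>Walk from \<open>z\<close> to \<open>y\<close> one coordinate at a time. The constant
  depends neither on the domain nor on \<open>x\<close>, which is what later allows a spread out
  charge around \<open>y\<close> to be replaced by a point charge at bounded cost.\<close>

lemma gr_diff_bound:
  assumes "finite D"
  shows "\<bar>gr D x z - gr D x y\<bar> \<le> 4 * (\<bar>real_of_int (fst z - fst y)\<bar> + \<bar>real_of_int (snd z - snd y)\<bar>)"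
proof -
  have step: "\<bar>gr D x (a, b) - gr D x (a', b)\<bar> \<le> 4" "\<bar>gr D x (b, a) - gr D x (b, a')\<bar> \<le> 4"
    if "\<bar>a - a'\<bar> = 1" for a a' b
    using that by (intro gr_nbr_diff[OF assms]; auto simp: nbrs_def)+
  have h: "\<bar>gr D x (a, b) - gr D x (a', b)\<bar> \<le> 4 * real n \<and> \<bar>gr D x (b, a) - gr D x (b, a')\<bar> \<le> 4 * real n"
    if "nat \<bar>a - a'\<bar> = n" for a a' b n
    using that
  proof (induction n arbitrary: a)
    case (Suc n)
    define a'' where "a'' = (if a < a' then a + 1 else a - 1)"
    have "nat \<bar>a'' - a'\<bar> = n" "\<bar>a - a''\<bar> = 1" using Suc.prems by (auto simp: a''_def)
    thus ?case using Suc.IH[of a''] step[of a a'' b] by (simp add: of_nat_Suc abs_le_iff)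
  qed auto
  show ?thesis
    using h[OF refl, where a = "fst z" and a' = "fst y" and b = "snd z"]
      h[OF refl, where a = "snd z" and a' = "snd y" and b = "fst y"]
    by (cases z; cases y) (simp add: of_nat_nat, linarith)
qed

section \<open>Logarithmic asymptotics of the Green function\<close>

text \<open>A regularised ln |x|. The added 1 keeps it finite at the origin and turns the product of
  the four neighbouring arguments into an explicit polynomial.\<close>

definition lf :: "pt \<Rightarrow> real" where
  "lf x = ln ((real_of_int (fst x))\<^sup>2 + (real_of_int (snd x))\<^sup>2 + 1) / 2"

lemma lf_nonneg: "lf x \<ge> 0"
  by (simp add: lf_def)

lemma lf_zero [simp]: "lf 0 = 0"
  by (simp add: lf_def)

lemma lap_lf_bounds:
  fixes x :: pt
  defines "s \<equiv> (real_of_int (fst x))\<^sup>2 + (real_of_int (snd x))\<^sup>2 + 1"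
  shows "lap lf x \<le> 0" "- lap lf x \<le> 2 / s\<^sup>2"
proof -
  define a b where "a = real_of_int (fst x)" and "b = real_of_int (snd x)"
  have s: "s = a\<^sup>2 + b\<^sup>2 + 1" "s \<ge> 1" by (auto simp: s_def a_def b_def)
  have pos: "(a + 1)\<^sup>2 + b\<^sup>2 + 1 > 0" "(a - 1)\<^sup>2 + b\<^sup>2 + 1 > 0" "a\<^sup>2 + (b + 1)\<^sup>2 + 1 > 0" "a\<^sup>2 + (b - 1)\<^sup>2 + 1 > 0"
    by (smt (verit) zero_le_power2)+
  define P where "P = ((a + 1)\<^sup>2 + b\<^sup>2 + 1) * ((a - 1)\<^sup>2 + b\<^sup>2 + 1) * (a\<^sup>2 + (b + 1)\<^sup>2 + 1) * (a\<^sup>2 + (b - 1)\<^sup>2 + 1)"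
  have P: "P = s ^ 4 + 2 * s\<^sup>2 + 8 * s + 5 + 16 * (a\<^sup>2 * b\<^sup>2)"
    by (simp add: P_def s(1)) algebra
  have lnP: "ln P = ln ((a + 1)\<^sup>2 + b\<^sup>2 + 1) + ln ((a - 1)\<^sup>2 + b\<^sup>2 + 1) + ln (a\<^sup>2 + (b + 1)\<^sup>2 + 1) + ln (a\<^sup>2 + (b - 1)\<^sup>2 + 1)"
    using pos by (simp add: P_def ln_mult_pos)
  have Ppos: "P > 0" using pos by (simp add: P_def)
  have "- lap lf x = ln P / 8 - ln s / 2"
    by (simp add: lap_def sum_nbrs lnP) (simp add: lf_def a_def b_def s_def)
  also have "\<dots> = (ln P - ln (s ^ 4)) / 8" using s by (simp add: ln_realpow)
  also have "\<dots> = ln (P / s ^ 4) / 8"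
    using s(2) Ppos by (simp add: ln_div)
  finally have eq: "- lap lf x = ln (P / s ^ 4) / 8" .
  have "P \<ge> s ^ 4" using s by (simp add: P)
  hence "ln (P / s ^ 4) \<ge> 0" using s(2) by (intro ln_ge_zero) simp
  thus "lap lf x \<le> 0" using eq by simp
  have "4 * (a\<^sup>2 * b\<^sup>2) \<le> (s - 1)\<^sup>2"
    using sum_squares_bound[of "a\<^sup>2" "b\<^sup>2"] by (simp add: s power2_eq_square algebra_simps)
  hence "P \<le> s ^ 4 + 6 * s\<^sup>2 + 9" by (simp add: P power2_diff)
  also have "\<dots> \<le> s ^ 4 + 15 * s\<^sup>2" using s one_le_power[of s 2] by simp
  finally have "P / s ^ 4 \<le> 1 + 15 / s\<^sup>2"
    using s(2) by (simp add: pos_divide_le_eq distrib_right power4_eq_xxxx power2_eq_square)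
  moreover have "ln (P / s ^ 4) \<le> P / s ^ 4 - 1" using s(2) Ppos by (intro ln_le_minus_one) simp
  ultimately have "ln (P / s ^ 4) \<le> 15 / s\<^sup>2" by simp
  also have "15 / s\<^sup>2 \<le> 16 / s\<^sup>2" by (intro divide_right_mono) auto
  finally show "- lap lf x \<le> 2 / s\<^sup>2" unfolding eq by simp
qed

text \<open>The strict inequalities matter twice: \<open>Qb c 1\<close> is the single point
  \<open>c\<close>, which is the form of the leaves of the tree, and two boxes whose centres differ
  by 2 R in one coordinate have a line of lattice points between them, so no edge joins
  them.\<close>

definition Qb :: "pt \<Rightarrow> nat \<Rightarrow> pt set" where
  "Qb c R = {fst c - int R <..< fst c + int R} \<times> {snd c - int R <..< snd c + int R}"

lemma finite_Qb [simp]: "finite (Qb c R)"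
  by (simp add: Qb_def)

lemma in_Qb: "x \<in> Qb c R \<longleftrightarrow> \<bar>fst x - fst c\<bar> < int R \<and> \<bar>snd x - snd c\<bar> < int R"
  by (cases x) (auto simp: Qb_def)

section \<open>Flux of \<open>lf\<close> through the sides of a square\<close>

lemma sum_second_difference:
  fixes g :: "int \<Rightarrow> real"
  assumes "R \<ge> 1"
  shows "(\<Sum>i\<in>{- int R <..< int R}. g (i + 1) + g (i - 1) - 2 * g i)
    = g (int R) - g (int R - 1) + g (- int R) - g (1 - int R)"
  using assms
proof (induction R rule: dec_induct)
  case base
  have "{- int 1 <..< int 1} = {0}" by auto
  thus ?case by simp
next
  case (step R)
  have "{- int (Suc R) <..< int (Suc R)} = insert (int R) (insert (- int R) {- int R <..< int R})" by auto
  moreover have "int R \<noteq> - int R" using step by simp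
  ultimately have "(\<Sum>i\<in>{- int (Suc R) <..< int (Suc R)}. g (i + 1) + g (i - 1) - 2 * g i)
     = (g (int R + 1) + g (int R - 1) - 2 * g (int R)) + (g (- int R + 1) + g (- int R - 1) - 2 * g (- int R))
       + (\<Sum>i\<in>{- int R <..< int R}. g (i + 1) + g (i - 1) - 2 * g i)" by simp
  moreover have "int (Suc R) = int R + 1" "- int (Suc R) = - int R - 1" "1 - int (Suc R) = - int R"
    "int (Suc R) - 1 = int R" "- int R + 1 = 1 - int R" by simp_all
  ultimately show ?case using step.IH by (simp only:)
qed

text \<open>Second differences telescope in each coordinate. Evenness of \<open>lf\<close> and its
  symmetry under exchange of coordinates make the four sides of the square carry the same flux, so
  one side without the factor 1/4 is left.\<close>

lemma sum_lap_lf_Qb: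
  assumes "R \<ge> 1"
  shows "(\<Sum>x\<in>Qb 0 R. - lap lf x) = (\<Sum>j\<in>{- int R <..< int R}. lf (int R, j) - lf (int R - 1, j))"
proof -
  let ?I = "{- int R <..< int R}"
  have sw: "lf (i, j) = lf (j, i)" for i j by (simp add: lf_def add.commute)
  have ev: "lf (- i, j) = lf (i, j)" "lf (1 - i, j) = lf (i - 1, j)" for i j
    by (auto simp: lf_def power2_commute)
  have Q: "Qb 0 R = ?I \<times> ?I" by (simp add: Qb_def)
  have "- lap lf x = ((lf (fst x + 1, snd x) + lf (fst x - 1, snd x) - 2 * lf (fst x, snd x))
      + (lf (snd x + 1, fst x) + lf (snd x - 1, fst x) - 2 * lf (snd x, fst x))) / 4" for x
    unfolding lap_def sum_nbrs
    by (simp add: sw[of "fst x" "snd x + 1"] sw[of "fst x" "1 + snd x"] sw[of "fst x" "snd x - 1"] sw[of "snd x" "fst x"] field_simps)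
  hence "(\<Sum>x\<in>Qb 0 R. - lap lf x) = (\<Sum>i\<in>?I. \<Sum>j\<in>?I. ((lf (i + 1, j) + lf (i - 1, j) - 2 * lf (i, j))
      + (lf (j + 1, i) + lf (j - 1, i) - 2 * lf (j, i))) / 4)"
    unfolding Q sum.cartesian_product by (intro sum.cong refl) (simp split: prod.split)
  also have "\<dots> = ((\<Sum>i\<in>?I. \<Sum>j\<in>?I. lf (i + 1, j) + lf (i - 1, j) - 2 * lf (i, j))
      + (\<Sum>i\<in>?I. \<Sum>j\<in>?I. lf (j + 1, i) + lf (j - 1, i) - 2 * lf (j, i))) / 4"
    by (simp add: sum.distrib sum_divide_distrib[symmetric])
  also have "(\<Sum>i\<in>?I. \<Sum>j\<in>?I. lf (i + 1, j) + lf (i - 1, j) - 2 * lf (i, j))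
      = (\<Sum>i\<in>?I. \<Sum>j\<in>?I. lf (j + 1, i) + lf (j - 1, i) - 2 * lf (j, i))"
    by (rule sum.swap)
  finally have "(\<Sum>x\<in>Qb 0 R. - lap lf x) = (\<Sum>i\<in>?I. \<Sum>j\<in>?I. lf (j + 1, i) + lf (j - 1, i) - 2 * lf (j, i)) / 2"
    by simp
  moreover have "(\<Sum>j\<in>?I. lf (j + 1, i) + lf (j - 1, i) - 2 * lf (j, i)) = 2 * (lf (int R, i) - lf (int R - 1, i))" for i
    using sum_second_difference[OF assms, of "\<lambda>j. lf (j, i)"] by (simp add: ev)
  ultimately show ?thesis by (simp only: sum_distrib_left[symmetric])
qed

text \<open>Compares M / (M^2 + t^2) at integers with its integral over unit intervals, so that the
  flux sums telescope to arctan 1.\<close>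

lemma arctan_diff_bounds:
  fixes M :: real and j :: nat
  assumes "M > 0"
  shows "M / (M\<^sup>2 + (real (Suc j))\<^sup>2) \<le> arctan (real (Suc j) / M) - arctan (real j / M)"
    and "arctan (real (Suc j) / M) - arctan (real j / M) \<le> M / (M\<^sup>2 + (real j)\<^sup>2)"
proof -
  have "real j / M < real (Suc j) / M" using assms by (simp add: divide_strict_right_mono)
  then obtain z where z: "real j / M < z" "z < real (Suc j) / M"
    "arctan (real (Suc j) / M) - arctan (real j / M) = (real (Suc j) / M - real j / M) * inverse (1 + z\<^sup>2)"
    using MVT2[of "real j / M" "real (Suc j) / M" arctan "\<lambda>z. inverse (1 + z\<^sup>2)"] DERIV_arctan by blast
  have e: "arctan (real (Suc j) / M) - arctan (real j / M) = 1 / (M * (1 + z\<^sup>2))"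
    using assms by (subst z(3)) (simp add: field_simps)
  have z0: "z \<ge> 0" using z(1) assms by (meson divide_nonneg_pos less_eq_real_def of_nat_0_le_iff order_trans)
  have 1: "z\<^sup>2 \<le> (real (Suc j) / M)\<^sup>2" using z z0 by (intro power_mono) auto
  have 2: "(real j / M)\<^sup>2 \<le> z\<^sup>2" using z assms by (intro power_mono) auto
  have f: "M / (M\<^sup>2 + t\<^sup>2) = 1 / (M * (1 + (t / M)\<^sup>2))" for t
  proof -
    have "M\<^sup>2 + t\<^sup>2 = M * (M * (1 + (t / M)\<^sup>2))" using assms by (simp add: field_simps power2_eq_square)
    thus ?thesis using assms by simp
  qed
  have p: "1 + t\<^sup>2 > 0" for t :: real by (smt (verit) zero_le_power2)
  show "M / (M\<^sup>2 + (real (Suc j))\<^sup>2) \<le> arctan (real (Suc j) / M) - arctan (real j / M)"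
    unfolding f e using 1 assms p by (intro divide_left_mono mult_left_mono mult_pos_pos) auto
  show "arctan (real (Suc j) / M) - arctan (real j / M) \<le> M / (M\<^sup>2 + (real j)\<^sup>2)"
    unfolding f e using 2 assms p by (intro divide_left_mono mult_left_mono mult_pos_pos) auto
qed

lemma sum_even_int:
  fixes h :: "int \<Rightarrow> real"
  assumes "\<And>i. h (- i) = h i" "R \<ge> 1"
  shows "(\<Sum>j\<in>{- int R <..< int R}. h j) = 2 * (\<Sum>j<R. h (int j)) - h 0"
  using assms(2)
proof (induction R rule: dec_induct)
  case base
  have "{- int 1 <..< int 1} = {0}" by auto
  thus ?case by simp
next
  case (step R)
  have "{- int (Suc R) <..< int (Suc R)} = insert (int R) (insert (- int R) {- int R <..< int R})" by auto
  moreover have "int R \<noteq> - int R" using step by simp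
  ultimately show ?case using step assms(1) by simp
qed

text \<open>The flux through one side is close to the sum of R / (R^2 + j^2) over |j| < R, a Riemann
  sum of the integral of 1 / (1 + t^2) over [-1, 1], whose value is pi / 2.\<close>

lemma lf_flux_bound:
  assumes R: "R \<ge> 1"
  shows "\<bar>(\<Sum>x\<in>Qb 0 R. - lap lf x) - pi / 2\<bar> \<le> 6 / real R"
proof -
  define S where "S = (\<Sum>j\<in>{- int R <..< int R}. lf (int R, j) - lf (int R - 1, j))"
  define A where "A = (\<lambda>j. (real R)\<^sup>2 + (real_of_int j)\<^sup>2 + 1)"
  define B where "B = (\<lambda>j. (real R - 1)\<^sup>2 + (real_of_int j)\<^sup>2 + 1)"
  have AB: "A j > 0" "B j > 0" "A j - B j = 2 * real R - 1" for j
  proof -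
    show "A j > 0" "B j > 0" unfolding A_def B_def by (intro add_nonneg_pos add_nonneg_nonneg; simp)+
    show "A j - B j = 2 * real R - 1" by (simp add: A_def B_def power2_diff)
  qed
  have d: "lf (int R, j) - lf (int R - 1, j) = ln (A j / B j) / 2" for j
    using AB[of j] by (simp add: lf_def A_def B_def ln_div diff_divide_distrib)
  have up: "ln (A j / B j) / 2 \<le> (real R - 1/2) / B j" for j
  proof -
    have "ln (A j / B j) \<le> A j / B j - 1" using AB[of j] by (intro ln_le_minus_one) auto
    also have "\<dots> = (2 * real R - 1) / B j" using AB[of j] by (simp add: field_simps)
    finally show ?thesis by (simp add: diff_divide_distrib mult.commute)
  qed
  have low: "ln (A j / B j) / 2 \<ge> (real R - 1/2) / A j" for j
  proof -
    have "ln (B j / A j) \<le> B j / A j - 1" using AB[of j] by (intro ln_le_minus_one) auto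
    also have "\<dots> = - ((2 * real R - 1) / A j)" using AB(1)[of j] unfolding AB(3)[of j, symmetric] by (simp add: diff_divide_distrib)
    also have "ln (B j / A j) = - ln (A j / B j)" using AB[of j] by (simp add: ln_div)
    finally have "(2 * real R - 1) / A j \<le> ln (A j / B j)" by (simp only: neg_le_iff_le)
    hence "(2 * real R - 1) / A j / 2 \<le> ln (A j / B j) / 2" by (rule divide_right_mono) simp
    moreover have "(real R - 1/2) / A j = (2 * real R - 1) / A j / 2" by (simp add: diff_divide_distrib)
    ultimately show ?thesis by (simp only:)
  qed
  have lower: "S \<ge> pi / 2 - 6 / real R"
  proof -
    define T where "T = (\<Sum>j\<in>{- int R <..< int R}. real R / ((real R)\<^sup>2 + (real_of_int j)\<^sup>2))"
    have "T = 2 * (\<Sum>j<R. real R / ((real R)\<^sup>2 + (real j)\<^sup>2)) - 1 / real R"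
      unfolding T_def using R by (subst sum_even_int) (auto simp: power2_eq_square)
    moreover have "(\<Sum>j<R. real R / ((real R)\<^sup>2 + (real j)\<^sup>2)) \<ge> (\<Sum>j<R. arctan (real (Suc j) / real R) - arctan (real j / real R))"
      using arctan_diff_bounds(2)[of "real R"] R by (intro sum_mono) auto
    moreover have "(\<Sum>j<R. arctan (real (Suc j) / real R) - arctan (real j / real R)) = pi / 4"
      using R by (subst sum_lessThan_telescope) (auto simp: arctan_one)
    ultimately have T: "T \<ge> pi / 2 - 1 / real R" by simp
    \<comment> \<open>The factor lost between R / (R^2 + j^2) and (R - 1/2) / (R^2 + j^2 +
      1).\<close>
    define c where "c = (1 - 1 / (2 * real R)) * (1 - 1 / (real R)\<^sup>2)"
    have c: "c \<ge> 1 - 2 / real R" "c \<ge> 0"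
    proof -
      define r where "r = 1 / real R"
      have r: "0 \<le> r" "r \<le> 1" using R by (auto simp: r_def)
      have c: "c = (1 - r / 2) * (1 - r * r)" by (simp add: c_def r_def power2_eq_square)
      have rr: "r * r \<le> r" using mult_right_mono[OF r(2) r(1)] by simp
      have "r * (r * r) \<ge> 0" using r by simp
      moreover have "c = 1 - r / 2 - r * r + r * (r * r) / 2" by (simp add: c field_simps)
      ultimately have "c \<ge> 1 - 2 * r" using rr r by linarith
      thus "c \<ge> 1 - 2 / real R" by (simp add: r_def)
      show "c \<ge> 0" using r rr unfolding c by (intro mult_nonneg_nonneg) auto
    qed
    have "c * T \<le> (\<Sum>j\<in>{- int R <..< int R}. (real R - 1/2) / A j)"
      unfolding T_def sum_distrib_left
    proof (intro sum_mono)
      fix j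
      define m where "m = (real R)\<^sup>2 + (real_of_int j)\<^sup>2"
      have m: "m \<ge> (real R)\<^sup>2" "m > 0" "A j = m + 1" using R by (auto simp: m_def A_def add_pos_nonneg)
      have "1 - 1 / (real R)\<^sup>2 \<le> m / (m + 1)"
      proof -
        have "1 / (m + 1) \<le> 1 / (real R)\<^sup>2" using m R by (intro divide_left_mono) auto
        moreover have "m / (m + 1) = 1 - 1 / (m + 1)" using m by (simp add: field_simps)
        ultimately show ?thesis by simp
      qed
      hence "c * (real R / m) \<le> ((1 - 1 / (2 * real R)) * (m / (m + 1))) * (real R / m)"
        unfolding c_def using R m by (intro mult_right_mono mult_left_mono) (auto simp: field_simps)
      also have "\<dots> = ((1 - 1 / (2 * real R)) * real R) / A j" using m by simp
      also have "(1 - 1 / (2 * real R)) * real R = real R - 1/2" using R by (simp add: left_diff_distrib)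
      finally show "c * (real R / ((real R)\<^sup>2 + (real_of_int j)\<^sup>2)) \<le> (real R - 1/2) / A j" by (simp add: m_def)
    qed
    also have "\<dots> \<le> S" unfolding S_def d by (intro sum_mono low)
    finally have "S \<ge> c * T" .
    moreover have "c * T \<ge> c * (pi / 2 - 1 / real R)" using T c by (intro mult_left_mono) auto
    moreover have "c * (pi / 2 - 1 / real R) \<ge> (1 - 2 / real R) * (pi / 2 - 1 / real R)"
    proof (intro mult_right_mono c)
      have "1 / real R \<le> 1" using R by simp
      thus "0 \<le> pi / 2 - 1 / real R" using pi_gt3 by simp
    qed
    moreover have "(1 - 2 / real R) * (pi / 2 - 1 / real R) = pi / 2 - (pi + 1) / real R + 2 / (real R * real R)"
      using R by (simp add: field_simps)
    moreover have "(pi + 1) / real R \<le> 6 / real R" using pi_less_4 R by (intro divide_right_mono) auto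
    moreover have "2 / (real R * real R) \<ge> 0" by simp
    ultimately show ?thesis by linarith
  qed
  have upper: "S \<le> pi / 2 + 6 / real R"
  \<comment> \<open>The upper bound compares with the inner side at distance R - 1, which
    degenerates for R = 1.\<close>
  proof (cases "R = 1")
    case True
    have "{- int 1 <..< int 1} = {0}" by auto
    hence "S = ln 2 / 2" unfolding S_def True by (simp add: lf_def)
    thus ?thesis using True ln_2_less_1 pi_gt3 by simp
  next
    case False
    define M where "M = R - 1"
    have M: "M \<ge> 1" "R = Suc M" using False R by (auto simp: M_def)
    define T where "T = (\<Sum>j\<in>{- int R <..< int R}. real M / ((real M)\<^sup>2 + (real_of_int j)\<^sup>2))"
    have "T = 2 * (\<Sum>j<Suc M. real M / ((real M)\<^sup>2 + (real j)\<^sup>2)) - 1 / real M"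
      unfolding T_def using R by (subst sum_even_int) (auto simp: power2_eq_square M)
    also have "\<dots> = 1 / real M + 2 * (\<Sum>j<M. real M / ((real M)\<^sup>2 + (real (Suc j))\<^sup>2))"
      by (subst sum.lessThan_Suc_shift) (simp add: power2_eq_square)
    also have "(\<Sum>j<M. real M / ((real M)\<^sup>2 + (real (Suc j))\<^sup>2)) \<le> (\<Sum>j<M. arctan (real (Suc j) / real M) - arctan (real j / real M))"
      using arctan_diff_bounds(1)[of "real M"] M by (intro sum_mono) auto
    also have "(\<Sum>j<M. arctan (real (Suc j) / real M) - arctan (real j / real M)) = pi / 4"
      using M by (subst sum_lessThan_telescope) (auto simp: arctan_one)
    finally have T: "T \<le> 1 / real M + pi / 2" by simp
    have "S \<le> (\<Sum>j\<in>{- int R <..< int R}. (real R - 1/2) / B j)" unfolding S_def d by (intro sum_mono up)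
    also have "\<dots> \<le> (\<Sum>j\<in>{- int R <..< int R}. (1 + 1 / (2 * real M)) * (real M / ((real M)\<^sup>2 + (real_of_int j)\<^sup>2)))"
    proof (intro sum_mono)
      fix j
      have "(real R - 1/2) / B j \<le> (real M + 1/2) / ((real M)\<^sup>2 + (real_of_int j)\<^sup>2)"
        using M by (intro frac_le) (auto simp: B_def intro: add_pos_nonneg)
      also have "\<dots> = (1 + 1 / (2 * real M)) * (real M / ((real M)\<^sup>2 + (real_of_int j)\<^sup>2))"
      proof -
        have "real M + 1/2 = (1 + 1 / (2 * real M)) * real M" using M by (simp add: field_simps)
        thus ?thesis by simp
      qed
      finally show "(real R - 1/2) / B j \<le> (1 + 1 / (2 * real M)) * (real M / ((real M)\<^sup>2 + (real_of_int j)\<^sup>2))" .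
    qed
    also have "\<dots> = (1 + 1 / (2 * real M)) * T" by (simp add: T_def sum_distrib_left)
    also have "\<dots> \<le> (1 + 1 / (2 * real M)) * (1 / real M + pi / 2)" using T by (intro mult_left_mono) auto
    also have "\<dots> = pi / 2 + (1 + pi / 4) / real M + 1 / (2 * real M) / real M"
      using M by (simp add: field_simps)
    also have "1 / (2 * real M) / real M \<le> 1 / 2 / real M" using M by (intro divide_right_mono) (auto simp: field_simps)
    also have "pi / 2 + (1 + pi / 4) / real M + 1 / 2 / real M = pi / 2 + (3 / 2 + pi / 4) / real M"
      by (simp add: add_divide_distrib)
    also have "(3 / 2 + pi / 4) / real M \<le> 3 / real M" using pi_less_4 by (intro divide_right_mono) auto
    also have "3 / real M \<le> 6 / real R" using M by (simp add: field_simps)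
    finally show ?thesis by simp
  qed
  show ?thesis using lower upper sum_lap_lf_Qb[OF R] by (simp add: S_def abs_le_iff)
qed

section \<open>The charge density of \<open>lf\<close> and its first moment\<close>

lemma lap_translate: "lap (\<lambda>z. u (z - y)) z = lap u (z - y)"
  by (cases y; cases z) (simp add: lap_def sum_nbrs algebra_simps)

definition lq :: "pt \<Rightarrow> real" where "lq x = - lap lf x"

lemma lq_nonneg: "lq x \<ge> 0" and lq_bound: "lq x \<le> 2 / ((real_of_int (fst x))\<^sup>2 + (real_of_int (snd x))\<^sup>2 + 1)\<^sup>2"
  using lap_lf_bounds[of x] by (auto simp: lq_def)

lemma sum_lq_translate:
  assumes "R \<ge> 1"
  shows "\<bar>(\<Sum>z\<in>Qb y R. lq (z - y)) - pi / 2\<bar> \<le> 6 / real R"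
proof -
  have "(\<Sum>z\<in>Qb y R. lq (z - y)) = (\<Sum>x\<in>Qb 0 R. lq x)"
    by (rule sum.reindex_bij_witness[of _ "\<lambda>x. x + y" "\<lambda>z. z - y"]) (auto simp: in_Qb)
  thus ?thesis using lf_flux_bound[OF assms] by (simp add: lq_def)
qed

lemma lq_zero: "lq 0 = ln 2 / 2"
  by (simp add: lq_def lap_def sum_nbrs) (simp add: lf_def)

lemma sum_int_le:
  fixes h :: "nat \<Rightarrow> real"
  assumes "summable h" "\<And>n. h n \<ge> 0" "finite I"
  shows "(\<Sum>i\<in>I. h (nat \<bar>i\<bar>)) \<le> 2 * suminf h"
proof -
  have "I = {i\<in>I. i \<ge> 0} \<union> {i\<in>I. i < 0}" by auto
  hence "(\<Sum>i\<in>I. h (nat \<bar>i\<bar>)) = (\<Sum>i\<in>{i\<in>I. i \<ge> 0}. h (nat \<bar>i\<bar>)) + (\<Sum>i\<in>{i\<in>I. i < 0}. h (nat \<bar>i\<bar>))"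
    using assms(3) by (subst sum.union_disjoint[symmetric]) auto
  also have "(\<Sum>i\<in>{i\<in>I. i \<ge> 0}. h (nat \<bar>i\<bar>)) = sum h ((\<lambda>i. nat \<bar>i\<bar>) ` {i\<in>I. i \<ge> 0})"
    by (subst sum.reindex) (auto simp: inj_on_def)
  also have "(\<Sum>i\<in>{i\<in>I. i < 0}. h (nat \<bar>i\<bar>)) = sum h ((\<lambda>i. nat \<bar>i\<bar>) ` {i\<in>I. i < 0})"
    by (subst sum.reindex) (auto simp: inj_on_def)
  also have "sum h ((\<lambda>i. nat \<bar>i\<bar>) ` {i\<in>I. i \<ge> 0}) \<le> suminf h"
    using assms by (intro sum_le_suminf) auto
  also have "sum h ((\<lambda>i. nat \<bar>i\<bar>) ` {i\<in>I. i < 0}) \<le> suminf h"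
    using assms by (intro sum_le_suminf) auto
  finally show ?thesis by simp
qed

text \<open>With s = |x|^2 + 1 the density decays like s^(-2) and the weight grows like s^(1/2),
  which leaves s^(-3/2). As s is at least (1 + |x1|)(1 + |x2|) / 2, this is dominated by a product
  of two convergent one-dimensional series.\<close>

lemma sum_lq_moment_bounded: "\<exists>K\<ge>0. \<forall>A. finite A \<longrightarrow> (\<Sum>x\<in>A. (\<bar>real_of_int (fst x)\<bar> + \<bar>real_of_int (snd x)\<bar>) * lq x) \<le> K"
proof -
  define h where "h = (\<lambda>n::nat. (1 + real n) powr (-3/2))"
  have "summable (\<lambda>n. real n powr (-3/2))" by (subst summable_real_powr_iff) simp
  hence "summable (\<lambda>n. real (n + 1) powr (-3/2))" by (subst summable_iff_shift)
  hence h: "summable h" by (simp add: h_def add.commute)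
  have h0: "h n \<ge> 0" for n by (simp add: h_def)
  have pt: "(\<bar>real_of_int (fst x)\<bar> + \<bar>real_of_int (snd x)\<bar>) * lq x \<le> 64 * (h (nat \<bar>fst x\<bar>) * h (nat \<bar>snd x\<bar>))" for x
  proof -
    define a b where "a = 1 + \<bar>real_of_int (fst x)\<bar>" and "b = 1 + \<bar>real_of_int (snd x)\<bar>"
    define s where "s = (real_of_int (fst x))\<^sup>2 + (real_of_int (snd x))\<^sup>2 + 1"
    have ab: "a \<ge> 1" "b \<ge> 1" by (auto simp: a_def b_def)
    have s1: "s \<ge> 1" by (simp add: s_def)
    have sa: "a * b \<le> 2 * s"
    proof -
      have "a\<^sup>2 \<le> 2 * (1 + (real_of_int (fst x))\<^sup>2)" using sum_squares_bound[of 1 "\<bar>real_of_int (fst x)\<bar>"] by (simp add: a_def power2_eq_square algebra_simps)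
      moreover have "b\<^sup>2 \<le> 2 * (1 + (real_of_int (snd x))\<^sup>2)" using sum_squares_bound[of 1 "\<bar>real_of_int (snd x)\<bar>"] by (simp add: b_def power2_eq_square algebra_simps)
      moreover have "2 * (1 + X) + 2 * (1 + Y) \<le> 4 * (X + Y + 1)" if "X \<ge> 0" "Y \<ge> 0" for X Y :: real
        using that by simp
      ultimately have "a\<^sup>2 + b\<^sup>2 \<le> 4 * s" unfolding s_def by (meson add_mono order_trans zero_le_power2)
      thus ?thesis using sum_squares_bound[of a b] by simp
    qed
    have "(\<bar>real_of_int (fst x)\<bar> + \<bar>real_of_int (snd x)\<bar>)\<^sup>2 \<le> 2 * s"
      using sum_squares_bound[of "\<bar>real_of_int (fst x)\<bar>" "\<bar>real_of_int (snd x)\<bar>"] by (simp add: s_def power2_sum)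
    hence "\<bar>real_of_int (fst x)\<bar> + \<bar>real_of_int (snd x)\<bar> \<le> sqrt (2 * s)" by (rule real_le_rsqrt)
    also have "\<dots> \<le> 2 * s powr (1/2)" using s1 by (simp add: real_sqrt_mult powr_half_sqrt sqrt2_less_2 less_imp_le)
    finally have 1: "\<bar>real_of_int (fst x)\<bar> + \<bar>real_of_int (snd x)\<bar> \<le> 2 * s powr (1/2)" .
    have "(\<bar>real_of_int (fst x)\<bar> + \<bar>real_of_int (snd x)\<bar>) * lq x \<le> (2 * s powr (1/2)) * (2 / s\<^sup>2)"
      using lq_bound[of x] lq_nonneg[of x] 1 by (intro mult_mono) (auto simp: s_def)
    also have "\<dots> = 4 * s powr (-3/2)"
    proof -
      have "s powr (-3/2) * s\<^sup>2 = s powr (-3/2) * s powr 2" using s1 by (simp add: powr_numeral)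
      also have "\<dots> = s powr (1/2)" by (subst powr_add[symmetric]) simp
      finally show ?thesis using s1 by (simp add: divide_simps)
    qed
    finally have A1: "(\<bar>real_of_int (fst x)\<bar> + \<bar>real_of_int (snd x)\<bar>) * lq x \<le> 4 * s powr (-3/2)" .
    have "s powr (-3/2) \<le> (a * b / 2) powr (-3/2)"
    proof (rule powr_mono2')
      show "0 < a * b / 2" using ab by simp
      show "a * b / 2 \<le> s" using sa by simp
    qed simp
    also have "(a * b / 2) powr (-3/2) = (a * b) powr (-3/2) / 2 powr (-3/2)" by (rule powr_divide)
    also have "\<dots> = (a * b) powr (-3/2) * 2 powr (3/2)"
    proof -
      have "(2::real) powr (-3/2) * 2 powr (3/2) = 1" by (subst powr_add[symmetric]) simp
      hence "inverse ((2::real) powr (-3/2)) = 2 powr (3/2)" by (rule inverse_unique)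
      thus ?thesis by (simp only: divide_inverse)
    qed
    also have "(a * b) powr (-3/2) = a powr (-3/2) * b powr (-3/2)" by (rule powr_mult)
    also have "a powr (-3/2) * b powr (-3/2) * 2 powr (3/2) \<le> a powr (-3/2) * b powr (-3/2) * 2 powr 4"
      by (intro mult_left_mono powr_mono) simp_all
    also have "\<dots> = 16 * (a powr (-3/2) * b powr (-3/2))" by simp
    finally have "(\<bar>real_of_int (fst x)\<bar> + \<bar>real_of_int (snd x)\<bar>) * lq x \<le> 64 * (a powr (-3/2) * b powr (-3/2))"
      using A1 by linarith
    moreover have "real (nat \<bar>fst x\<bar>) = a - 1" "real (nat \<bar>snd x\<bar>) = b - 1" by (simp_all add: a_def b_def)
    ultimately show ?thesis by (simp add: h_def)
  qed
  have "(\<Sum>x\<in>A. (\<bar>real_of_int (fst x)\<bar> + \<bar>real_of_int (snd x)\<bar>) * lq x) \<le> 64 * ((2 * suminf h) * (2 * suminf h))"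
    if A: "finite A" for A
  proof -
    have "(\<Sum>x\<in>A. (\<bar>real_of_int (fst x)\<bar> + \<bar>real_of_int (snd x)\<bar>) * lq x) \<le> (\<Sum>x\<in>A. 64 * (h (nat \<bar>fst x\<bar>) * h (nat \<bar>snd x\<bar>)))"
      by (intro sum_mono pt)
    also have "\<dots> \<le> (\<Sum>x\<in>fst ` A \<times> snd ` A. 64 * (h (nat \<bar>fst x\<bar>) * h (nat \<bar>snd x\<bar>)))"
      by (rule sum_mono2) (simp_all add: A subset_fst_snd h0)
    also have "\<dots> = 64 * (\<Sum>x\<in>fst ` A \<times> snd ` A. h (nat \<bar>fst x\<bar>) * h (nat \<bar>snd x\<bar>))"
      by (rule sum_distrib_left[symmetric])
    also have "(\<Sum>x\<in>fst ` A \<times> snd ` A. h (nat \<bar>fst x\<bar>) * h (nat \<bar>snd x\<bar>)) = (\<Sum>i\<in>fst ` A. h (nat \<bar>i\<bar>)) * (\<Sum>i\<in>snd ` A. h (nat \<bar>i\<bar>))"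
      unfolding sum_product sum.cartesian_product by (rule sum.cong[OF refl]) (simp add: case_prod_beta)
    also have "\<dots> \<le> (2 * suminf h) * (2 * suminf h)"
    proof (rule mult_mono)
      show "(\<Sum>i\<in>fst ` A. h (nat \<bar>i\<bar>)) \<le> 2 * suminf h" "(\<Sum>i\<in>snd ` A. h (nat \<bar>i\<bar>)) \<le> 2 * suminf h"
        using h h0 A by (simp_all add: sum_int_le)
      show "0 \<le> 2 * suminf h" using suminf_nonneg[OF h h0] by simp
      show "0 \<le> (\<Sum>i\<in>snd ` A. h (nat \<bar>i\<bar>))" by (rule sum_nonneg) (rule h0)
    qed
    finally have "(\<Sum>x\<in>A. (\<bar>real_of_int (fst x)\<bar> + \<bar>real_of_int (snd x)\<bar>) * lq x) \<le> 64 * ((2 * suminf h) * (2 * suminf h))"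
      by simp
    thus ?thesis .
  qed
  thus ?thesis using suminf_nonneg[OF h h0] by (intro exI[of _ "64 * ((2 * suminf h) * (2 * suminf h))"]) auto
qed

text \<open>The Green representation of \<open>lf (z - y)\<close> in \<open>D\<close> says that the
  potential of the charge \<open>lq (z - y)\<close> at \<open>x\<close> is the mean boundary value,
  ln \<rho> + O(1), minus \<open>lf (x - y)\<close>. The Lipschitz bound and the first moment of
  \<open>lq\<close> replace this charge by a point charge at \<open>y\<close> of mass T, and T is pi
  / 2 up to O(1 / \<rho>). Here \<open>\<kappa>\<close> only says that \<open>D\<close> lies between
  two squares around \<open>y\<close> of size comparable to \<open>\<rho>\<close>; \<open>x\<close>
  may be anywhere in \<open>D\<close>.\<close>

lemma green_estimate:
  assumes \<kappa>: "\<kappa> > 0"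
  shows "\<exists>C. \<forall>D \<rho> x y. finite D \<and> \<rho> \<ge> 1 \<and> x \<in> D \<and> y \<in> D \<and>
     (\<forall>z. \<bar>real_of_int (fst z - fst y)\<bar> < \<kappa> * \<rho> \<and> \<bar>real_of_int (snd z - snd y)\<bar> < \<kappa> * \<rho> \<longrightarrow> z \<in> D) \<and>
     (\<forall>z\<in>D. \<bar>real_of_int (fst z - fst y)\<bar> \<le> \<rho> / \<kappa> \<and> \<bar>real_of_int (snd z - snd y)\<bar> \<le> \<rho> / \<kappa>) \<longrightarrow>
     \<bar>gr D x y - 2 / pi * (ln \<rho> - lf (x - y))\<bar> \<le> C"
proof -
  obtain K where K: "K \<ge> 0" "\<And>A. finite A \<Longrightarrow> (\<Sum>x\<in>A. (\<bar>real_of_int (fst x)\<bar> + \<bar>real_of_int (snd x)\<bar>) * lq x) \<le> K"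
    using sum_lq_moment_bounded by blast
  define C0 where "C0 = \<bar>ln \<kappa>\<bar> + ln (2 * (1 / \<kappa> + 1)\<^sup>2 + 1)"
  define C1 where "C1 = C0 + 4 * K"
  define C2 where "C2 = 6 / \<kappa> + 6 * \<kappa>"
  define T0 :: real where "T0 = ln 2 / 2"
  have T0: "T0 > 0" by (simp add: T0_def)
  have C0: "C0 \<ge> 0" using \<kappa> by (simp add: C0_def add_nonneg_nonneg)
  have C2: "C2 > 0" using \<kappa> by (simp add: C2_def add_pos_pos)
  show ?thesis
  proof (intro exI[of _ "2 / pi * (C1 + (1 + C1) * C2 / T0)"] allI impI, elim conjE)
    fix D :: "pt set" and \<rho> :: real and x y :: pt
    assume D: "finite D" and \<rho>: "\<rho> \<ge> 1" and x: "x \<in> D" and y: "y \<in> D"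
      and inn: "\<forall>z. \<bar>real_of_int (fst z - fst y)\<bar> < \<kappa> * \<rho> \<and> \<bar>real_of_int (snd z - snd y)\<bar> < \<kappa> * \<rho> \<longrightarrow> z \<in> D"
      and out: "\<forall>z\<in>D. \<bar>real_of_int (fst z - fst y)\<bar> \<le> \<rho> / \<kappa> \<and> \<bar>real_of_int (snd z - snd y)\<bar> \<le> \<rho> / \<kappa>"
    define F where "F = (\<lambda>z. lf (z - y))"
    define bd where "bd = (\<lambda>z. \<Sum>w\<in>nbrs z - D. F w / 4)"
    define bo where "bo = (\<lambda>z. \<Sum>w\<in>nbrs z - D. 1 / 4 :: real)"
    have Fq: "lap F z = - lq (z - y)" for z
      unfolding F_def by (subst lap_translate) (simp add: lq_def)
    have split: "(\<Sum>w\<in>nbrs z. g w) = (\<Sum>w\<in>nbrs z. if w \<in> D then g w else 0) + (\<Sum>w\<in>nbrs z - D. g w)" for g :: "pt \<Rightarrow> real" and z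
    proof -
      have "(\<Sum>w\<in>nbrs z. if w \<in> D then g w else 0) = (\<Sum>w\<in>nbrs z \<inter> D. g w)" by (simp add: sum.inter_restrict)
      moreover have "(\<Sum>w\<in>nbrs z. g w) = (\<Sum>w\<in>nbrs z \<inter> D. g w) + (\<Sum>w\<in>nbrs z - D. g w)"
        by (subst sum.union_disjoint[symmetric]) (auto intro!: sum.cong)
      ultimately show ?thesis by simp
    qed
    \<comment> \<open>Cutting \<open>g\<close> off outside \<open>D\<close> turns its values at
      outer neighbours into sources, with weight 1/4 per edge.\<close>
    have rep: "g x = (\<Sum>z\<in>D. gr D x z * (lap g z + (\<Sum>w\<in>nbrs z - D. g w / 4)))" for g
    proof -
      let ?u = "\<lambda>z. if z \<in> D then g z else 0"
      have "g x = ?u x" using x by simp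
      also have "\<dots> = (\<Sum>z\<in>D. gr D x z * lap ?u z)" by (rule gr_repr) (auto simp: supp_in_def D)
      also have "\<dots> = (\<Sum>z\<in>D. gr D x z * (lap g z + (\<Sum>w\<in>nbrs z - D. g w / 4)))"
      proof (intro sum.cong refl arg_cong2[where f = "(*)"])
        fix z assume "z \<in> D"
        thus "lap ?u z = lap g z + (\<Sum>w\<in>nbrs z - D. g w / 4)"
          using split[of g z] by (simp add: lap_def sum_divide_distrib[symmetric] add_divide_distrib)
      qed
      finally show ?thesis .
    qed
    \<comment> \<open>The total mass of the harmonic measure seen from \<open>x\<close> is 1, so a
      boundary average of values ln \<rho> + O(1) is again ln \<rho> + O(1).\<close>
    have one: "1 = (\<Sum>z\<in>D. gr D x z * bo z)"
      using rep[of "\<lambda>_. 1"] by (simp add: bo_def lap_def)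
    define W where "W = (\<Sum>z\<in>D. gr D x z * bd z)"
    have Fbd: "ln \<rho> - C0 \<le> F w \<and> F w \<le> ln \<rho> + C0" if z: "z \<in> D" "w \<in> nbrs z - D" for z w
    proof -
      define m where "m = (real_of_int (fst (w - y)))\<^sup>2 + (real_of_int (snd (w - y)))\<^sup>2"
      have F: "F w = ln (m + 1) / 2" by (simp add: F_def lf_def m_def)
      have "\<kappa> * \<rho> \<le> \<bar>real_of_int (fst (w - y))\<bar> \<or> \<kappa> * \<rho> \<le> \<bar>real_of_int (snd (w - y))\<bar>"
        using inn[rule_format, of w] z by (simp add: not_less[symmetric]) blast
      hence "(\<kappa> * \<rho>)\<^sup>2 \<le> m"
      proof
        assume "\<kappa> * \<rho> \<le> \<bar>real_of_int (fst (w - y))\<bar>"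
        hence "(\<kappa> * \<rho>)\<^sup>2 \<le> \<bar>real_of_int (fst (w - y))\<bar>\<^sup>2" using \<kappa> \<rho> by (intro power_mono) auto
        thus ?thesis by (simp add: m_def add_increasing2)
      next
        assume "\<kappa> * \<rho> \<le> \<bar>real_of_int (snd (w - y))\<bar>"
        hence "(\<kappa> * \<rho>)\<^sup>2 \<le> \<bar>real_of_int (snd (w - y))\<bar>\<^sup>2" using \<kappa> \<rho> by (intro power_mono) auto
        thus ?thesis by (simp add: m_def add_increasing)
      qed
      hence "ln ((\<kappa> * \<rho>)\<^sup>2) \<le> ln (m + 1)" using \<kappa> \<rho> by (subst ln_le_cancel_iff) (auto intro: add_nonneg_pos simp: m_def)
      moreover have "ln ((\<kappa> * \<rho>)\<^sup>2) = 2 * (ln \<kappa> + ln \<rho>)" using \<kappa> \<rho> by (simp add: ln_realpow ln_mult)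
      ultimately have l: "ln \<rho> - C0 \<le> F w"
        using \<kappa> unfolding F C0_def by (smt (verit) ln_ge_zero zero_le_power2 field_sum_of_halves)
      have "\<bar>real_of_int (fst (w - y))\<bar> \<le> \<rho> / \<kappa> + 1 \<and> \<bar>real_of_int (snd (w - y))\<bar> \<le> \<rho> / \<kappa> + 1"
        using out[rule_format, OF z(1)] z(2) by (auto simp: nbrs_def)
      moreover have "\<rho> / \<kappa> + 1 \<le> \<rho> * (1 / \<kappa> + 1)" using \<rho> by (simp add: algebra_simps)
      ultimately have b: "\<bar>real_of_int (fst (w - y))\<bar> \<le> \<rho> * (1 / \<kappa> + 1)" "\<bar>real_of_int (snd (w - y))\<bar> \<le> \<rho> * (1 / \<kappa> + 1)"
        by linarith+
      have "\<bar>real_of_int (fst (w - y))\<bar>\<^sup>2 \<le> (\<rho> * (1 / \<kappa> + 1))\<^sup>2" "\<bar>real_of_int (snd (w - y))\<bar>\<^sup>2 \<le> (\<rho> * (1 / \<kappa> + 1))\<^sup>2"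
        by (intro power_mono b abs_ge_zero)+
      hence "m + 1 \<le> 2 * (\<rho> * (1 / \<kappa> + 1))\<^sup>2 + 1" by (simp add: m_def)
      also have "\<dots> \<le> \<rho>\<^sup>2 * (2 * (1 / \<kappa> + 1)\<^sup>2 + 1)"
      proof -
        have "2 * (r * t)\<^sup>2 + 1 \<le> r\<^sup>2 * (2 * t\<^sup>2 + 1)" if "1 \<le> r\<^sup>2" for r t :: real
          using that by (simp add: power_mult_distrib algebra_simps)
        thus ?thesis using one_le_power[OF \<rho>, of 2] by blast
      qed
      finally have "ln (m + 1) \<le> ln (\<rho>\<^sup>2 * (2 * (1 / \<kappa> + 1)\<^sup>2 + 1))"
        by (subst ln_le_cancel_iff) (use \<rho> in \<open>auto simp: m_def intro!: add_nonneg_pos mult_pos_pos\<close>)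
      also have "\<dots> = 2 * ln \<rho> + ln (2 * (1 / \<kappa> + 1)\<^sup>2 + 1)"
        using \<rho> by (subst ln_mult_pos) (auto simp: ln_realpow intro!: add_nonneg_pos)
      finally have "F w \<le> ln \<rho> + ln (2 * (1 / \<kappa> + 1)\<^sup>2 + 1) / 2" unfolding F by simp
      also have "ln (2 * (1 / \<kappa> + 1)\<^sup>2 + 1) / 2 \<le> C0"
      proof -
        have "ln (2 * (1 / \<kappa> + 1)\<^sup>2 + 1) \<ge> 0" by (intro ln_ge_zero) simp
        thus ?thesis unfolding C0_def by simp
      qed
      finally show ?thesis using l by simp
    qed
    have Fbd': "(ln \<rho> - C0) * bo z \<le> bd z \<and> bd z \<le> (ln \<rho> + C0) * bo z" if z: "z \<in> D" for z
      unfolding bd_def bo_def sum_distrib_left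
    proof (intro conjI sum_mono)
      fix w assume "w \<in> nbrs z - D"
      thus "(ln \<rho> - C0) * (1 / 4) \<le> F w / 4" "F w / 4 \<le> (ln \<rho> + C0) * (1 / 4)"
        using Fbd[OF z, of w] by auto
    qed
    have "(\<Sum>z\<in>D. gr D x z * ((ln \<rho> - C0) * bo z)) \<le> W"
      unfolding W_def using Fbd' by (intro sum_mono mult_left_mono gr_nonneg D) blast
    moreover have "(\<Sum>z\<in>D. gr D x z * ((ln \<rho> - C0) * bo z)) = (ln \<rho> - C0) * (\<Sum>z\<in>D. gr D x z * bo z)"
      by (simp add: sum_distrib_left mult_ac)
    ultimately have Wl: "ln \<rho> - C0 \<le> W" using one by simp
    have "W \<le> (\<Sum>z\<in>D. gr D x z * ((ln \<rho> + C0) * bo z))"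
      unfolding W_def using Fbd' by (intro sum_mono mult_left_mono gr_nonneg D) blast
    moreover have "(\<Sum>z\<in>D. gr D x z * ((ln \<rho> + C0) * bo z)) = (ln \<rho> + C0) * (\<Sum>z\<in>D. gr D x z * bo z)"
      by (simp add: sum_distrib_left mult_ac)
    ultimately have Wu: "W \<le> ln \<rho> + C0" using one by simp
    have "F x = (\<Sum>z\<in>D. gr D x z * (bd z - lq (z - y)))"
      using rep[of F] by (simp add: Fq bd_def)
    hence FW: "(\<Sum>z\<in>D. gr D x z * lq (z - y)) = W - F x"
      by (simp add: W_def right_diff_distrib sum_subtractf)
    define T where "T = (\<Sum>z\<in>D. lq (z - y))"
    have "\<bar>(\<Sum>z\<in>D. gr D x z * lq (z - y)) - gr D x y * T\<bar> = \<bar>\<Sum>z\<in>D. (gr D x z - gr D x y) * lq (z - y)\<bar>"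
      by (simp add: T_def sum_distrib_left left_diff_distrib sum_subtractf)
    also have "\<dots> \<le> (\<Sum>z\<in>D. \<bar>(gr D x z - gr D x y) * lq (z - y)\<bar>)" by (rule sum_abs)
    also have "\<dots> \<le> (\<Sum>z\<in>D. 4 * ((\<bar>real_of_int (fst (z - y))\<bar> + \<bar>real_of_int (snd (z - y))\<bar>) * lq (z - y)))"
      unfolding abs_mult abs_of_nonneg[OF lq_nonneg] mult.assoc[symmetric]
      using gr_diff_bound[OF D, of x] by (intro sum_mono mult_right_mono lq_nonneg) auto
    also have "\<dots> = 4 * (\<Sum>z\<in>(\<lambda>z. z - y) ` D. (\<bar>real_of_int (fst z)\<bar> + \<bar>real_of_int (snd z)\<bar>) * lq z)"
      by (subst sum.reindex) (auto simp: sum_distrib_left)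
    also have "\<dots> \<le> 4 * K" using K(2) D by simp
    finally have E: "\<bar>gr D x y * T - (ln \<rho> - F x)\<bar> \<le> C1" using FW Wl Wu by (simp add: C1_def)
    have "T \<ge> (\<Sum>z\<in>{y}. lq (z - y))" unfolding T_def using y D lq_nonneg by (intro sum_mono2) auto
    hence T: "T \<ge> T0" by (simp add: lq_zero T0_def)
    define R where "R = nat \<lceil>\<kappa> * \<rho>\<rceil>"
    have intR: "int R = \<lceil>\<kappa> * \<rho>\<rceil>"
    proof -
      have "\<kappa> * \<rho> > 0" using \<kappa> \<rho> by simp
      hence "\<lceil>\<kappa> * \<rho>\<rceil> > 0" by (simp only: zero_less_ceiling)
      thus ?thesis by (simp add: R_def)
    qed
    have R: "R \<ge> 1" "real R \<ge> \<kappa> * \<rho>" using \<kappa> \<rho> by (auto simp: R_def Suc_le_eq)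
    have "Qb y R \<subseteq> D"
    proof
      fix z assume "z \<in> Qb y R"
      hence "\<bar>fst z - fst y\<bar> < \<lceil>\<kappa> * \<rho>\<rceil>" "\<bar>snd z - snd y\<bar> < \<lceil>\<kappa> * \<rho>\<rceil>" by (simp_all add: in_Qb intR)
      thus "z \<in> D" using inn[rule_format, of z] by (simp add: less_ceiling_iff)
    qed
    hence "T \<ge> (\<Sum>z\<in>Qb y R. lq (z - y))" unfolding T_def using D lq_nonneg by (intro sum_mono2) auto
    hence "T \<ge> pi / 2 - 6 / real R" using sum_lq_translate[OF R(1), of y] by simp
    moreover have "6 / real R \<le> 6 / (\<kappa> * \<rho>)" using R \<kappa> \<rho> by (intro divide_left_mono) auto
    moreover have "6 / (\<kappa> * \<rho>) = 6 / \<kappa> / \<rho>" by simp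
    moreover have "6 * \<kappa> / \<rho> \<ge> 0" using \<kappa> \<rho> by simp
    ultimately have Tl: "T \<ge> pi / 2 - C2 / \<rho>" unfolding C2_def add_divide_distrib by linarith
    define R' where "R' = nat \<lfloor>\<rho> / \<kappa>\<rfloor> + 1"
    have nn: "\<rho> / \<kappa> \<ge> 0" using \<rho> \<kappa> by simp
    have R': "R' \<ge> 1" "real R' \<ge> \<rho> / \<kappa>" using nn by (auto simp: R'_def) linarith
    have "D \<subseteq> Qb y R'"
    proof
      fix z assume "z \<in> D"
      hence "\<bar>real_of_int (fst z - fst y)\<bar> \<le> \<rho> / \<kappa>" "\<bar>real_of_int (snd z - snd y)\<bar> \<le> \<rho> / \<kappa>" using out by auto
      hence "\<bar>fst z - fst y\<bar> \<le> \<lfloor>\<rho> / \<kappa>\<rfloor>" "\<bar>snd z - snd y\<bar> \<le> \<lfloor>\<rho> / \<kappa>\<rfloor>" by (auto simp: le_floor_iff)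
      thus "z \<in> Qb y R'" using nn by (auto simp: in_Qb R'_def)
    qed
    hence "T \<le> (\<Sum>z\<in>Qb y R'. lq (z - y))" unfolding T_def using lq_nonneg by (intro sum_mono2) auto
    hence "T \<le> pi / 2 + 6 / real R'" using sum_lq_translate[OF R'(1), of y] by simp
    moreover have "6 / real R' \<le> 6 / (\<rho> / \<kappa>)" using R' \<kappa> \<rho> by (intro divide_left_mono) auto
    moreover have "6 / (\<rho> / \<kappa>) = 6 * \<kappa> / \<rho>" by simp
    moreover have "6 / \<kappa> / \<rho> \<ge> 0" using \<kappa> \<rho> by simp
    ultimately have Tu: "T \<le> pi / 2 + C2 / \<rho>" unfolding C2_def add_divide_distrib by linarith
    have g0: "gr D x y \<ge> 0" using gr_nonneg D by blast
    have Fx: "F x \<ge> 0" by (simp add: F_def lf_nonneg)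
    have C1: "C1 \<ge> 0" using C0 K by (simp add: C1_def)
    obtain G where G: "G = gr D x y" by simp
    obtain L where L: "L = ln \<rho> - F x" by simp
    have GT: "\<bar>G * T - L\<bar> \<le> C1" using E by (simp only: G L)
    \<comment> \<open>A priori bound G = O(\<rho>): the charge at \<open>y\<close> alone gives T at
      least T0 > 0, and ln \<rho> is at most \<rho>. Crude as it is, multiplied by |T - pi / 2| =
      O(1 / \<rho>) it leaves a bounded error.\<close>
    have "G * T0 \<le> G * T" using T g0 unfolding G by (rule mult_left_mono)
    also have "\<dots> \<le> L + C1" using GT by linarith
    also have "\<dots> \<le> \<rho> + C1 * \<rho>"
    proof (rule add_mono)
      show "L \<le> \<rho>" using \<rho> Fx ln_le_minus_one[of \<rho>] by (simp add: L)
      show "C1 \<le> C1 * \<rho>" using mult_left_mono[OF \<rho> C1] by simp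
    qed
    finally have "G * T0 \<le> (1 + C1) * \<rho>" by (simp only: distrib_right mult_1_left)
    hence gb: "G \<le> (1 + C1) * \<rho> / T0" by (simp only: pos_le_divide_eq[OF T0])
    have g0': "G \<ge> 0" using g0 by (simp only: G)
    have "\<bar>T - pi / 2\<bar> \<le> C2 / \<rho>" using Tl Tu by (simp only: abs_le_iff) linarith
    hence "\<bar>G * (T - pi / 2)\<bar> \<le> ((1 + C1) * \<rho> / T0) * (C2 / \<rho>)"
      unfolding abs_mult abs_of_nonneg[OF g0'] by (rule mult_mono[OF gb _ order_trans[OF g0' gb] abs_ge_zero])
    moreover have "((1 + C1) * \<rho> / T0) * (C2 / \<rho>) = (1 + C1) * C2 / T0"
    proof -
      have "(a * r / t) * (c / r) = a * c / t" if "r \<noteq> 0" for a r t c :: real using that by simp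
      moreover have "\<rho> \<noteq> 0" using \<rho> by linarith
      ultimately show ?thesis by blast
    qed
    ultimately have 1: "\<bar>G * (T - pi / 2)\<bar> \<le> (1 + C1) * C2 / T0" by (simp only:)
    have "G * (pi / 2) - L = (G * T - L) - G * (T - pi / 2)"
      by (simp only: right_diff_distrib[of G])
    hence "\<bar>G * (pi / 2) - L\<bar> \<le> \<bar>G * T - L\<bar> + \<bar>G * (T - pi / 2)\<bar>"
      by (simp only: abs_triangle_ineq4)
    also have "\<dots> \<le> C1 + (1 + C1) * C2 / T0" by (rule add_mono[OF GT 1])
    finally have "\<bar>gr D x y * (pi / 2) - (ln \<rho> - F x)\<bar> \<le> C1 + (1 + C1) * C2 / T0"
      by (simp only: G L)
    hence "2 / pi * \<bar>gr D x y * (pi / 2) - (ln \<rho> - F x)\<bar> \<le> 2 / pi * (C1 + (1 + C1) * C2 / T0)"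
      by (rule mult_left_mono) simp
    moreover have "2 / pi * \<bar>u * (pi / 2) - v\<bar> = \<bar>u - 2 / pi * v\<bar>" for u v :: real
    proof -
      have "2 / pi * \<bar>u * (pi / 2) - v\<bar> = \<bar>2 / pi * (u * (pi / 2) - v)\<bar>"
        unfolding abs_mult by (rule arg_cong2[where f = "(*)"]) simp_all
      also have "2 / pi * (u * (pi / 2) - v) = u - 2 / pi * v" by (simp add: right_diff_distrib)
      finally show ?thesis .
    qed
    ultimately show "\<bar>gr D x y - 2 / pi * (ln \<rho> - lf (x - y))\<bar> \<le> 2 / pi * (C1 + (1 + C1) * C2 / T0)"
      by (simp only: F_def)
  qed
qed

section \<open>Independence of uncorrelated families\<close>

lemma norm_iexp_real: "norm (iexp x) = 1"
  by (simp add: norm_exp_eq_Re)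

lemma borel_measurable_iexp [measurable]: "iexp \<in> borel_measurable borel"
  by (intro borel_measurable_continuous_onI continuous_intros)

lemma borel_measurable_cnj [measurable]: "cnj \<in> borel_measurable borel"
  by (intro borel_measurable_continuous_onI continuous_intros)

lemma Re_mult_eq: "complex_of_real (Re r) * e = (1/2) * (r * e + cnj r * e)"
  and Im_mult_eq: "complex_of_real (Im r) * e = (- \<i> / 2) * (r * e - cnj r * e)"
  by (auto simp: complex_eq_iff)

context prob_space
begin

lemma integrable_bounded:
  fixes f :: "'a \<Rightarrow> 'b :: {banach, second_countable_topology}"
  assumes "f \<in> borel_measurable M" "\<And>x. norm (f x) \<le> B"
  shows "integrable M f"
  using assms by (intro integrable_const_bound[where B = B]) auto

text \<open>A bounded signed weight is shifted and scaled to a probability density 1 + W / K. Under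
  this density and under the original measure \<open>X\<close> has the same characteristic function,
  hence the same law, and the difference of the two laws is the weighted integral.\<close>

lemma fourier_zero_real:
  fixes W X :: "'a \<Rightarrow> real"
  assumes [measurable]: "W \<in> borel_measurable M" "X \<in> borel_measurable M" "A \<in> sets borel"
    and W: "\<And>x. \<bar>W x\<bar> \<le> C"
    and zero: "\<And>s. (CLINT x|M. complex_of_real (W x) * iexp (s * X x)) = 0"
  shows "(LINT x|M. W x * indicator A (X x)) = 0"
proof -
  define K where "K = \<bar>C\<bar> + 1"
  have K: "K > 0" "\<And>x. W x + K \<ge> 0" "\<And>x. W x + K \<le> 2 * K"
    using W by (auto simp: K_def abs_le_iff) (smt (verit))+
  define w where "w = (\<lambda>x. (W x + K) / K)"
  have w: "w x \<ge> 0" "w x \<le> 2" for x using K by (auto simp: w_def field_simps)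
  have [measurable]: "w \<in> borel_measurable M" unfolding w_def by measurable
  have intW: "integrable M W" using W by (intro integrable_bounded[where B = C]) auto
  have "complex_of_real (LINT x|M. W x) = 0"
    using zero[of 0] by simp
  hence W0: "(LINT x|M. W x) = 0" by simp
  have intw: "integrable M w" using w by (intro integrable_bounded[where B = 2]) auto
  have w1: "(LINT x|M. w x) = 1"
    using K W0 intW prob_space by (simp add: w_def add_divide_distrib)
  define M' where "M' = density M (\<lambda>x. ennreal (w x))"
  have "emeasure M' (space M') = 1"
    using w intw w1 by (simp add: M'_def emeasure_density nn_integral_eq_integral cong: nn_integral_cong)
  hence M': "prob_space M'" by (rule prob_spaceI)
  have [measurable]: "X \<in> borel_measurable M'" by (simp add: M'_def)
  have "distr M' borel X = distr M borel X"
  proof (rule Levy_uniqueness)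
    show "real_distribution (distr M' borel X)" "real_distribution (distr M borel X)"
      by (auto intro!: prob_space.real_distribution_distr M' prob_space_axioms)
    show "char (distr M' borel X) = char (distr M borel X)"
    proof
      fix s
      have iX: "integrable M (\<lambda>x. iexp (s * X x))"
        by (intro integrable_bounded[where B = 1]) (auto simp: norm_iexp_real)
      have iWX: "integrable M (\<lambda>x. complex_of_real (W x) * iexp (s * X x))"
        using W by (intro integrable_bounded[where B = C]) (auto simp: norm_mult norm_iexp_real)
      have "char (distr M' borel X) s = (CLINT x|M. w x *\<^sub>R iexp (s * X x))"
        unfolding M'_def char_def using w by (simp add: integral_distr integral_density)
      also have "\<dots> = (CLINT x|M. (1 / complex_of_real K) * (complex_of_real (W x) * iexp (s * X x)) + iexp (s * X x))"
        using K by (intro Bochner_Integration.integral_cong) (auto simp: w_def scaleR_conv_of_real field_simps)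
      also have "\<dots> = (CLINT x|M. iexp (s * X x))"
        using iX iWX by (subst Bochner_Integration.integral_add) (auto simp: zero simp del: of_real_mult)
      also have "\<dots> = char (distr M borel X) s"
        by (simp add: char_def integral_distr)
      finally show "char (distr M' borel X) s = char (distr M borel X) s" .
    qed
  qed
  hence eq: "measure (distr M' borel X) A = measure (distr M borel X) A" by simp
  have iA: "integrable M (\<lambda>x. indicator A (X x) :: real)"
    by (intro integrable_bounded[where B = 1]) (auto simp: indicator_def)
  have iWA: "integrable M (\<lambda>x. W x * indicator A (X x))"
    using W by (intro integrable_bounded[where B = "\<bar>C\<bar>"]) (auto simp: indicator_def intro: order_trans[OF _ abs_ge_self])
  have d: "measure (distr N borel X) A = (LINT x|N. indicator A (X x) :: real)" if "prob_space N" "X \<in> borel_measurable N" for N :: "'a measure"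
  proof -
    interpret N: prob_space N by fact
    have "(LINT x|N. indicator A (X x) :: real) = (LINT y|distr N borel X. indicator A y)"
      using that by (subst integral_distr) auto
    thus ?thesis using that by simp
  qed
  have "(LINT x|M'. indicator A (X x)) = (LINT x|M. w x * indicator A (X x))"
    using w by (simp add: M'_def integral_density)
  also have "\<dots> = (LINT x|M. (1 / K) * (W x * indicator A (X x)) + indicator A (X x))"
    using K by (intro Bochner_Integration.integral_cong) (auto simp: w_def field_simps)
  also have "\<dots> = (1 / K) * (LINT x|M. W x * indicator A (X x)) + (LINT x|M. indicator A (X x))"
    using iA iWA by (subst Bochner_Integration.integral_add) auto
  finally show ?thesis
    using eq K d[OF M'] d[OF prob_space_axioms] by simp
qed

text \<open>The conjugate weight satisfies the same hypothesis, with \<open>s\<close> replaced by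
  its negative, so real and imaginary part can be treated separately.\<close>

lemma fourier_zero:
  fixes R :: "'a \<Rightarrow> complex" and X :: "'a \<Rightarrow> real"
  assumes [measurable]: "R \<in> borel_measurable M" "X \<in> borel_measurable M" "A \<in> sets borel"
    and R: "\<And>x. norm (R x) \<le> C"
    and zero: "\<And>s. (CLINT x|M. R x * iexp (s * X x)) = 0"
  shows "(CLINT x|M. R x * indicator A (X x)) = 0"
proof -
  have int: "integrable M (\<lambda>x. R x * iexp (s * X x))" for s
    using R by (intro integrable_bounded[where B = C]) (auto simp: norm_mult norm_iexp_real)
  have int': "integrable M (\<lambda>x. cnj (R x) * iexp (s * X x))" for s
    using R by (intro integrable_bounded[where B = C]) (auto simp: norm_mult norm_iexp_real)
  have zero': "(CLINT x|M. cnj (R x) * iexp (s * X x)) = 0" for s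
  proof -
    have "cnj (R x) * iexp (s * X x) = cnj (R x * iexp (- s * X x))" for x
      by (simp add: exp_cnj)
    hence "(CLINT x|M. cnj (R x) * iexp (s * X x)) = cnj (CLINT x|M. R x * iexp (- s * X x))"
      by (simp only: Bochner_Integration.integral_cnj)
    thus ?thesis using zero[of "-s"] by simp
  qed
  have re: "(LINT x|M. Re (R x) * indicator A (X x)) = 0"
  proof (rule fourier_zero_real[where C = C])
    fix s
    have "(CLINT x|M. complex_of_real (Re (R x)) * iexp (s * X x))
        = (CLINT x|M. (1/2) * (R x * iexp (s * X x) + cnj (R x) * iexp (s * X x)))"
      by (intro Bochner_Integration.integral_cong refl Re_mult_eq)
    also have "\<dots> = 0" by (simp add: Bochner_Integration.integral_add[OF int int'] zero zero' del: of_real_mult)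
    finally show "(CLINT x|M. complex_of_real (Re (R x)) * iexp (s * X x)) = 0" .
  qed (auto intro: order_trans[OF abs_Re_le_cmod R])
  have im: "(LINT x|M. Im (R x) * indicator A (X x)) = 0"
  proof (rule fourier_zero_real[where C = C])
    fix s
    have "(CLINT x|M. complex_of_real (Im (R x)) * iexp (s * X x))
        = (CLINT x|M. (- \<i> / 2) * (R x * iexp (s * X x) - cnj (R x) * iexp (s * X x)))"
      by (intro Bochner_Integration.integral_cong refl Im_mult_eq)
    also have "\<dots> = 0" by (simp add: Bochner_Integration.integral_diff[OF int int'] zero zero' del: of_real_mult)
    finally show "(CLINT x|M. complex_of_real (Im (R x)) * iexp (s * X x)) = 0" .
  qed (auto intro: order_trans[OF abs_Im_le_cmod R])
  have iR: "integrable M (\<lambda>x. R x * indicator A (X x))"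
    using R by (intro integrable_bounded[where B = "\<bar>C\<bar>"]) (auto simp: indicator_def intro: order_trans[OF _ abs_ge_self])
  have "Re (CLINT x|M. R x * indicator A (X x)) = (LINT x|M. Re (R x * indicator A (X x)))"
    by (rule integral_Re[OF iR, symmetric])
  also have "\<dots> = (LINT x|M. Re (R x) * indicator A (X x))"
    by (intro Bochner_Integration.integral_cong) (auto simp: indicator_def)
  finally have 1: "Re (CLINT x|M. R x * indicator A (X x)) = 0" using re by simp
  have "Im (CLINT x|M. R x * indicator A (X x)) = (LINT x|M. Im (R x * indicator A (X x)))"
    by (rule integral_Im[OF iR, symmetric])
  also have "\<dots> = (LINT x|M. Im (R x) * indicator A (X x))"
    by (intro Bochner_Integration.integral_cong) (auto simp: indicator_def)
  finally have 2: "Im (CLINT x|M. R x * indicator A (X x)) = 0" using im by simp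
  show ?thesis using 1 2 by (simp add: complex_eq_iff)
qed

text \<open>One coordinate at a time the exponential is exchanged for an indicator; the indicators
  obtained so far are absorbed into the bounded weight \<open>R\<close>.\<close>

lemma fourier_zero_multi:
  fixes R :: "'a \<Rightarrow> complex" and X :: "'i \<Rightarrow> 'a \<Rightarrow> real"
  assumes "finite I" "R \<in> borel_measurable M" "\<And>x. norm (R x) \<le> C"
    and "\<And>i. i \<in> I \<Longrightarrow> X i \<in> borel_measurable M"
    and "\<And>i. i \<in> I \<Longrightarrow> A i \<in> sets borel"
    and "\<And>t. (CLINT x|M. R x * iexp (\<Sum>i\<in>I. t i * X i x)) = 0"
  shows "(CLINT x|M. R x * (\<Prod>i\<in>I. indicator (A i) (X i x))) = 0"
  using assms
proof (induction I arbitrary: R rule: finite_induct)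
  case empty
  show ?case using empty.prems(5)[of undefined] by simp
next
  case (insert j I R)
  note [measurable] = insert.prems(1)
  have [measurable]: "X j \<in> borel_measurable M" "A j \<in> sets borel" "\<And>i. i \<in> I \<Longrightarrow> X i \<in> borel_measurable M"
    using insert.prems by auto
  have "(CLINT x|M. (R x * indicator (A j) (X j x)) * (\<Prod>i\<in>I. indicator (A i) (X i x))) = 0"
  proof (rule insert.IH)
    fix t :: "'i \<Rightarrow> real"
    have "(CLINT x|M. (R x * iexp (\<Sum>i\<in>I. t i * X i x)) * indicator (A j) (X j x)) = 0"
    proof (rule fourier_zero)
      fix s
      have "(\<Sum>i\<in>insert j I. (t(j := s)) i * X i x) = (\<Sum>i\<in>I. t i * X i x) + s * X j x" for x
        using insert.hyps by (subst sum.insert) (auto intro!: sum.cong)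
      hence eq: "R x * iexp (\<Sum>i\<in>insert j I. (t(j := s)) i * X i x) = (R x * iexp (\<Sum>i\<in>I. t i * X i x)) * iexp (s * X j x)" for x
        by (simp only: of_real_add distrib_left exp_add mult.assoc)
      show "(CLINT x|M. (R x * iexp (\<Sum>i\<in>I. t i * X i x)) * iexp (s * X j x)) = 0"
        using insert.prems(5)[of "t(j := s)"] unfolding eq .
      show "norm (R x * iexp (\<Sum>i\<in>I. t i * X i x)) \<le> C" for x
        using insert.prems(2) by (simp add: norm_mult norm_iexp_real del: of_real_sum)
    qed auto
    thus "(CLINT x|M. (R x * indicator (A j) (X j x)) * iexp (\<Sum>i\<in>I. t i * X i x)) = 0"
      by (simp add: mult_ac)
  next
    show "norm (R x * indicator (A j) (X j x)) \<le> C" for x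
      using insert.prems(2)[of x] order_trans[OF norm_ge_zero insert.prems(2)] by (auto simp: indicator_def)
  qed (use insert.prems in auto)
  thus ?case using insert.hyps by (simp add: mult.assoc)
qed

text \<open>Factorisation of the joint characteristic function gives independence of two finite
  families. The exponentials of \<open>X\<close> are first turned into an event with the centred
  exponential of \<open>Y\<close> as weight, then those of \<open>Y\<close> with the centred
  indicator of that event as weight; rectangles generate the product sigma-algebras.\<close>

lemma indep_var_PiM_of_char:
  fixes X :: "'i \<Rightarrow> 'a \<Rightarrow> real" and Y :: "'i \<Rightarrow> 'a \<Rightarrow> real"
  assumes fin: "finite I" "finite J"
    and X: "\<And>i. i \<in> I \<Longrightarrow> X i \<in> borel_measurable M"
    and Y: "\<And>j. j \<in> J \<Longrightarrow> Y j \<in> borel_measurable M"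
    and char: "\<And>t s. (CLINT x|M. iexp (\<Sum>i\<in>I. t i * X i x) * iexp (\<Sum>j\<in>J. s j * Y j x))
       = (CLINT x|M. iexp (\<Sum>i\<in>I. t i * X i x)) * (CLINT x|M. iexp (\<Sum>j\<in>J. s j * Y j x))"
  shows "indep_var (PiM I (\<lambda>_. borel)) (\<lambda>x. \<lambda>i\<in>I. X i x) (PiM J (\<lambda>_. borel)) (\<lambda>x. \<lambda>j\<in>J. Y j x)"
proof -
  note [measurable] = X Y
  define E where "E = (\<lambda>s. CLINT x|M. iexp (\<Sum>j\<in>J. s j * Y j x))"
  have iY: "integrable M (\<lambda>x. iexp (\<Sum>j\<in>J. s j * Y j x))" for s
    by (intro integrable_bounded[where B = 1]) (auto simp: norm_iexp_real simp del: of_real_sum)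
  have iX: "integrable M (\<lambda>x. iexp (\<Sum>i\<in>I. s i * X i x))" for s
    by (intro integrable_bounded[where B = 1]) (auto simp: norm_iexp_real simp del: of_real_sum)
  have iYX: "integrable M (\<lambda>x. iexp (\<Sum>i\<in>I. t i * X i x) * iexp (\<Sum>j\<in>J. s j * Y j x))" for t s
    by (intro integrable_bounded[where B = 1]) (auto simp: norm_mult norm_iexp_real simp del: of_real_sum)
  have nE: "norm (E s) \<le> 1" for s
  proof -
    have "norm (E s) \<le> (LINT x|M. norm (iexp (\<Sum>j\<in>J. s j * Y j x)))"
      unfolding E_def by (rule integral_norm_bound)
    thus ?thesis by (simp add: norm_iexp_real prob_space del: of_real_sum)
  qed
  have prod: "prob ({x \<in> space M. \<forall>i\<in>I. X i x \<in> A i} \<inter> {x \<in> space M. \<forall>j\<in>J. Y j x \<in> B j})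
     = prob {x \<in> space M. \<forall>i\<in>I. X i x \<in> A i} * prob {x \<in> space M. \<forall>j\<in>J. Y j x \<in> B j}"
    if AB: "\<And>i. i \<in> I \<Longrightarrow> A i \<in> sets borel" "\<And>j. j \<in> J \<Longrightarrow> B j \<in> sets borel" for A B
  proof -
    note [measurable] = AB
    define FA where "FA = {x \<in> space M. \<forall>i\<in>I. X i x \<in> A i}"
    define FB where "FB = {x \<in> space M. \<forall>j\<in>J. Y j x \<in> B j}"
    have [measurable]: "FA \<in> sets M" "FB \<in> sets M" unfolding FA_def FB_def using fin by measurable
    have pA: "(\<Prod>i\<in>I. indicator (A i) (X i x)) = (indicator FA x :: complex)" if "x \<in> space M" for x
    proof (cases "\<forall>i\<in>I. X i x \<in> A i")
      case True
      thus ?thesis using that by (simp add: FA_def)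
    next
      case False
      then obtain k where k: "k \<in> I" "X k x \<notin> A k" by blast
      hence "(\<Prod>i\<in>I. indicator (A i) (X i x)) = (0 :: complex)"
        using fin by (intro prod_zero bexI[of _ k]) simp_all
      thus ?thesis using False by (simp add: FA_def)
    qed
    have pB: "(\<Prod>j\<in>J. indicator (B j) (Y j x)) = (indicator FB x :: complex)" if "x \<in> space M" for x
    proof (cases "\<forall>j\<in>J. Y j x \<in> B j")
      case True
      thus ?thesis using that by (simp add: FB_def)
    next
      case False
      then obtain k where k: "k \<in> J" "Y k x \<notin> B k" by blast
      hence "(\<Prod>j\<in>J. indicator (B j) (Y j x)) = (0 :: complex)"
        using fin by (intro prod_zero bexI[of _ k]) simp_all
      thus ?thesis using False by (simp add: FB_def)
    qed
    have iA: "integrable M (\<lambda>x. indicator FA x * iexp (\<Sum>j\<in>J. s j * Y j x))" for s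
      by (intro integrable_bounded[where B = 1]) (auto simp: indicator_def norm_iexp_real simp del: of_real_sum)
    have iA': "integrable M (\<lambda>x. indicator FA x :: complex)"  "integrable M (\<lambda>x. indicator FB x :: complex)"
      by (intro integrable_bounded[where B = 1]; auto simp: indicator_def)+
    have iAB: "integrable M (\<lambda>x. indicator FA x * indicator FB x :: complex)"
      by (intro integrable_bounded[where B = 1]) (auto simp: indicator_def)
    have eA: "(CLINT x|M. indicator F x) = complex_of_real (prob F)" if [measurable]: "F \<in> sets M" for F
    proof -
      have "(CLINT x|M. indicator F x) = (CLINT x|M. complex_of_real (indicator F x))"
        by (intro Bochner_Integration.integral_cong) (auto simp: indicator_def)
      thus ?thesis by (simp add: integral_complex_of_real)
    qed
    \<comment> \<open>The intermediate statement: the event of the first family is already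
      uncorrelated with every exponential of the second.\<close>
    have 1: "(CLINT x|M. indicator FA x * iexp (\<Sum>j\<in>J. s j * Y j x)) = prob FA * E s" for s
    proof -
      have "(CLINT x|M. (iexp (\<Sum>j\<in>J. s j * Y j x) - E s) * (\<Prod>i\<in>I. indicator (A i) (X i x))) = 0"
      proof (rule fourier_zero_multi[where C = 2])
        show "norm (iexp (\<Sum>j\<in>J. s j * Y j x) - E s) \<le> 2" for x
          using norm_triangle_ineq4[of "iexp (\<Sum>j\<in>J. s j * Y j x)" "E s"] nE[of s]
          by (simp add: norm_iexp_real del: of_real_sum)
        fix t :: "'i \<Rightarrow> real"
        have "(CLINT x|M. (iexp (\<Sum>j\<in>J. s j * Y j x) - E s) * iexp (\<Sum>i\<in>I. t i * X i x))
           = (CLINT x|M. iexp (\<Sum>i\<in>I. t i * X i x) * iexp (\<Sum>j\<in>J. s j * Y j x) - E s * iexp (\<Sum>i\<in>I. t i * X i x))"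
          by (intro Bochner_Integration.integral_cong) (simp_all add: algebra_simps del: of_real_sum)
        also have "\<dots> = 0"
          using iYX iX by (subst Bochner_Integration.integral_diff) (auto simp: char E_def simp del: of_real_sum)
        finally show "(CLINT x|M. (iexp (\<Sum>j\<in>J. s j * Y j x) - E s) * iexp (\<Sum>i\<in>I. t i * X i x)) = 0" .
      qed (use fin AB X in auto)
      also have "(CLINT x|M. (iexp (\<Sum>j\<in>J. s j * Y j x) - E s) * (\<Prod>i\<in>I. indicator (A i) (X i x)))
        = (CLINT x|M. indicator FA x * iexp (\<Sum>j\<in>J. s j * Y j x) - E s * indicator FA x)"
        by (intro Bochner_Integration.integral_cong) (simp_all add: pA algebra_simps del: of_real_sum)
      also have "\<dots> = (CLINT x|M. indicator FA x * iexp (\<Sum>j\<in>J. s j * Y j x)) - E s * prob FA"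
        using iA iA' by (subst Bochner_Integration.integral_diff) (auto simp: eA simp del: of_real_sum)
      finally show ?thesis by (simp add: mult.commute)
    qed
    have "(CLINT x|M. (indicator FA x - complex_of_real (prob FA)) * (\<Prod>j\<in>J. indicator (B j) (Y j x))) = 0"
    proof (rule fourier_zero_multi[where C = 2])
      have "norm (indicator FA x :: complex) \<le> 1" for x by (simp add: indicator_def)
      moreover have "norm (complex_of_real (prob FA)) \<le> 1" by simp
      ultimately show "norm (indicator FA x - complex_of_real (prob FA)) \<le> 2" for x
        using norm_triangle_ineq4[of "indicator FA x" "complex_of_real (prob FA)"] by (smt (verit))
      fix s :: "'i \<Rightarrow> real"
      show "(CLINT x|M. (indicator FA x - complex_of_real (prob FA)) * iexp (\<Sum>j\<in>J. s j * Y j x)) = 0"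
        unfolding left_diff_distrib using iA iY
        by (subst Bochner_Integration.integral_diff) (auto simp: 1 E_def simp del: of_real_sum)
    qed (use fin AB Y in auto)
    also have "(CLINT x|M. (indicator FA x - complex_of_real (prob FA)) * (\<Prod>j\<in>J. indicator (B j) (Y j x)))
       = (CLINT x|M. indicator FA x * indicator FB x - complex_of_real (prob FA) * indicator FB x)"
      by (intro Bochner_Integration.integral_cong) (simp_all add: pB algebra_simps)
    also have "\<dots> = (CLINT x|M. indicator (FA \<inter> FB) x) - prob FA * prob FB"
      unfolding indicator_inter_arith using iAB iA' by (subst Bochner_Integration.integral_diff) (simp_all add: eA)
    also have "(CLINT x|M. indicator (FA \<inter> FB) x) = complex_of_real (prob (FA \<inter> FB))"
      by (rule eA) measurable
    finally have "complex_of_real (prob (FA \<inter> FB) - prob FA * prob FB) = 0" by simp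
    thus ?thesis unfolding FA_def FB_def of_real_eq_0_iff by simp
  qed
  have gen: "sigma_sets (space M) {f -` A \<inter> space M |A. A \<in> sets (PiM K (\<lambda>_. borel))}
      = sigma_sets (space M) {{x \<in> space M. \<forall>i\<in>K. Z i x \<in> A i} |A. \<forall>i\<in>K. A i \<in> sets borel}"
    (is "?L = ?R")
    if K: "finite K" and f: "f = (\<lambda>x. \<lambda>i\<in>K. Z i x)" and Z: "\<And>i. i \<in> K \<Longrightarrow> Z i \<in> borel_measurable M"
    for K :: "'i set" and f and Z :: "'i \<Rightarrow> 'a \<Rightarrow> real"
  proof -
    have alg: "prod_algebra K (\<lambda>_. borel :: real measure) = {Pi\<^sub>E K A |A. \<forall>i\<in>K. A i \<in> sets borel}"
      unfolding prod_algebra_eq_finite[OF K] by (simp add: Pi_iff)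
    have fs: "f \<in> space M \<rightarrow> (\<Pi>\<^sub>E i\<in>K. space borel)" using f by auto
    have s: "sets (PiM K (\<lambda>_. borel :: real measure)) = sigma_sets (\<Pi>\<^sub>E i\<in>K. space borel) {Pi\<^sub>E K A |A. \<forall>i\<in>K. A i \<in> sets borel}"
      unfolding sets_PiM alg ..
    have "{f -` A \<inter> space M |A. A \<in> sets (PiM K (\<lambda>_. borel))}
        = sigma_sets (space M) {f -` A \<inter> space M |A. A \<in> {Pi\<^sub>E K A |A. \<forall>i\<in>K. A i \<in> sets borel}}"
      unfolding s by (rule sigma_sets_vimage_commute[OF fs])
    also have "{f -` A \<inter> space M |A. A \<in> {Pi\<^sub>E K A |A. \<forall>i\<in>K. A i \<in> sets borel}} = {{x \<in> space M. \<forall>i\<in>K. Z i x \<in> A i} |A. \<forall>i\<in>K. A i \<in> sets borel}"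
      (is "?G = ?G'")
    proof -
      have "f -` (Pi\<^sub>E K A) \<inter> space M = {x \<in> space M. \<forall>i\<in>K. Z i x \<in> A i}" for A
        by (auto simp: f PiE_iff)
      thus ?thesis by (simp add: setcompr_eq_image image_image)
    qed
    finally have "?L = sigma_sets (space M) (sigma_sets (space M) ?G')" by simp
    also have "\<dots> = ?R" by (rule sigma_sets_sigma_sets_eq) auto
    finally show ?thesis .
  qed
  have stable: "Int_stable {{x \<in> space M. \<forall>i\<in>K. Z i x \<in> A i} |A. \<forall>i\<in>K. A i \<in> sets borel}"
    for K :: "'i set" and Z :: "'i \<Rightarrow> 'a \<Rightarrow> real"
  proof (rule Int_stableI)
    fix a b assume "a \<in> {{x \<in> space M. \<forall>i\<in>K. Z i x \<in> A i} |A. \<forall>i\<in>K. A i \<in> sets borel}"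
      "b \<in> {{x \<in> space M. \<forall>i\<in>K. Z i x \<in> A i} |A. \<forall>i\<in>K. A i \<in> sets borel}"
    then obtain A B where AB: "a = {x \<in> space M. \<forall>i\<in>K. Z i x \<in> A i}" "b = {x \<in> space M. \<forall>i\<in>K. Z i x \<in> B i}"
      "\<forall>i\<in>K. A i \<in> sets borel" "\<forall>i\<in>K. B i \<in> sets borel" by blast
    hence "a \<inter> b = {x \<in> space M. \<forall>i\<in>K. Z i x \<in> A i \<inter> B i}" "\<forall>i\<in>K. A i \<inter> B i \<in> sets borel" by auto
    thus "a \<inter> b \<in> {{x \<in> space M. \<forall>i\<in>K. Z i x \<in> A i} |A. \<forall>i\<in>K. A i \<in> sets borel}"
      by (intro CollectI exI[of _ "\<lambda>i. A i \<inter> B i"] conjI)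
  qed
  have "indep_set {{x \<in> space M. \<forall>i\<in>I. X i x \<in> A i} |A. \<forall>i\<in>I. A i \<in> sets borel}
      {{x \<in> space M. \<forall>i\<in>J. Y i x \<in> A i} |A. \<forall>i\<in>J. A i \<in> sets borel}"
  proof (rule indep_setI)
    show "{{x \<in> space M. \<forall>i\<in>I. X i x \<in> A i} |A. \<forall>i\<in>I. A i \<in> sets borel} \<subseteq> events"
    proof
      fix a assume "a \<in> {{x \<in> space M. \<forall>i\<in>I. X i x \<in> A i} |A. \<forall>i\<in>I. A i \<in> sets borel}"
      then obtain A where a: "a = {x \<in> space M. \<forall>i\<in>I. X i x \<in> A i}" and "\<forall>i\<in>I. A i \<in> sets borel" by blast
      hence [measurable]: "\<And>i. i \<in> I \<Longrightarrow> A i \<in> sets borel" by blast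
      show "a \<in> events" unfolding a using fin by measurable
    qed
    show "{{x \<in> space M. \<forall>i\<in>J. Y i x \<in> A i} |A. \<forall>i\<in>J. A i \<in> sets borel} \<subseteq> events"
    proof
      fix a assume "a \<in> {{x \<in> space M. \<forall>i\<in>J. Y i x \<in> A i} |A. \<forall>i\<in>J. A i \<in> sets borel}"
      then obtain A where a: "a = {x \<in> space M. \<forall>i\<in>J. Y i x \<in> A i}" and "\<forall>i\<in>J. A i \<in> sets borel" by blast
      hence [measurable]: "\<And>i. i \<in> J \<Longrightarrow> A i \<in> sets borel" by blast
      show "a \<in> events" unfolding a using fin by measurable
    qed
    fix a b
    assume "a \<in> {{x \<in> space M. \<forall>i\<in>I. X i x \<in> A i} |A. \<forall>i\<in>I. A i \<in> sets borel}"
      and "b \<in> {{x \<in> space M. \<forall>i\<in>J. Y i x \<in> A i} |A. \<forall>i\<in>J. A i \<in> sets borel}"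
    then obtain A B where AB: "a = {x \<in> space M. \<forall>i\<in>I. X i x \<in> A i}" "b = {x \<in> space M. \<forall>i\<in>J. Y i x \<in> B i}"
      "\<forall>i\<in>I. A i \<in> sets borel" "\<forall>i\<in>J. B i \<in> sets borel" by blast
    show "prob (a \<inter> b) = prob a * prob b" unfolding AB(1,2) using AB(3,4) by (intro prod) auto
  qed
  moreover have "(\<lambda>x. \<lambda>i\<in>I. X i x) \<in> measurable M (PiM I (\<lambda>_. borel))" "(\<lambda>x. \<lambda>j\<in>J. Y j x) \<in> measurable M (PiM J (\<lambda>_. borel))"
    by (auto intro!: measurable_restrict)
  moreover have "sigma_sets (space M) {(\<lambda>x. \<lambda>i\<in>I. X i x) -` A \<inter> space M |A. A \<in> sets (PiM I (\<lambda>_. borel))}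
      = sigma_sets (space M) {{x \<in> space M. \<forall>i\<in>I. X i x \<in> A i} |A. \<forall>i\<in>I. A i \<in> sets borel}"
    by (rule gen[OF fin(1) refl]) (rule X)
  moreover have "sigma_sets (space M) {(\<lambda>x. \<lambda>j\<in>J. Y j x) -` A \<inter> space M |A. A \<in> sets (PiM J (\<lambda>_. borel))}
      = sigma_sets (space M) {{x \<in> space M. \<forall>i\<in>J. Y i x \<in> A i} |A. \<forall>i\<in>J. A i \<in> sets borel}"
    by (rule gen[OF fin(2) refl]) (rule Y)
  ultimately show ?thesis
    unfolding indep_var_eq by (simp add: indep_set_sigma_sets stable)
qed

end

section \<open>Survival in a tree with independent increments\<close>

text \<open>A node is the list of steps from the root, extended at its end, so
  \<open>butlast\<close> is the parent. \<open>F\<close> gives the admissible steps and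
  \<open>\<theta>\<close> the threshold, both by depth of the parent; \<open>d\<close> counts the
  generations still to come.\<close>

fun surv :: "(nat \<Rightarrow> 'b set) \<Rightarrow> (nat \<Rightarrow> real) \<Rightarrow> nat \<Rightarrow> ('b list \<Rightarrow> real) \<Rightarrow> 'b list \<Rightarrow> 'b list set" where
  "surv F \<theta> 0 x v = {v}"
| "surv F \<theta> (Suc d) x v = (\<Union>a\<in>F (length v). if \<theta> (length v) \<le> x (v @ [a]) then surv F \<theta> d x (v @ [a]) else {})"

text \<open>The number of survivors has its own recursion because measurability and the Laplace
  transform estimates follow it; \<open>card_surv\<close> connects it with the set.\<close>

fun nsurv :: "(nat \<Rightarrow> 'b set) \<Rightarrow> (nat \<Rightarrow> real) \<Rightarrow> nat \<Rightarrow> ('b list \<Rightarrow> real) \<Rightarrow> 'b list \<Rightarrow> nat" where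
  "nsurv F \<theta> 0 x v = 1"
| "nsurv F \<theta> (Suc d) x v = (\<Sum>a\<in>F (length v). if \<theta> (length v) \<le> x (v @ [a]) then nsurv F \<theta> d x (v @ [a]) else 0)"

text \<open>The nodes whose labels \<open>nsurv\<close> reads. The starting node is not among them,
  and independence of a subtree from the increment at its root rests on this.\<close>

fun desc :: "(nat \<Rightarrow> 'b set) \<Rightarrow> nat \<Rightarrow> 'b list \<Rightarrow> 'b list set" where
  "desc F 0 v = {}"
| "desc F (Suc d) v = (\<Union>a\<in>F (length v). insert (v @ [a]) (desc F d (v @ [a])))"

definition valid :: "(nat \<Rightarrow> 'b set) \<Rightarrow> 'b list \<Rightarrow> bool" where
  "valid F v \<longleftrightarrow> (\<forall>i<length v. v ! i \<in> F i)"

lemma valid_snoc: "valid F (v @ [a]) \<longleftrightarrow> valid F v \<and> a \<in> F (length v)"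
  by (auto simp: valid_def nth_append less_Suc_eq)

lemma valid_Nil [simp]: "valid F []"
  by (simp add: valid_def)

lemma valid_append1: "valid F (v @ w) \<Longrightarrow> valid F v"
proof -
  assume "valid F (v @ w)"
  hence "(v @ w) ! i \<in> F i" if "i < length v" for i using that by (auto simp: valid_def)
  thus "valid F v" by (auto simp: valid_def nth_append)
qed

lemma surv_valid: "valid F v \<Longrightarrow> w \<in> surv F \<theta> d x v \<Longrightarrow> valid F w \<and> length w = length v + d \<and> (\<exists>u. w = v @ u)"
proof (induction d arbitrary: v)
  case (Suc d)
  then obtain a where a: "a \<in> F (length v)" "w \<in> surv F \<theta> d x (v @ [a])" by (auto split: if_splits)
  hence "valid F (v @ [a])" using Suc.prems by (simp add: valid_snoc)
  from Suc.IH[OF this a(2)] show ?case by auto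
qed auto

lemma desc_valid: "valid F v \<Longrightarrow> w \<in> desc F d v \<Longrightarrow> valid F w \<and> length w \<le> length v + d \<and> (\<exists>u. u \<noteq> [] \<and> w = v @ u)"
proof (induction d arbitrary: v)
  case (Suc d)
  then obtain a where a: "a \<in> F (length v)" "w = v @ [a] \<or> w \<in> desc F d (v @ [a])" by auto
  hence v: "valid F (v @ [a])" using Suc.prems by (simp add: valid_snoc)
  from a(2) show ?case
  proof
    assume "w = v @ [a]"
    thus ?case using v by auto
  next
    assume "w \<in> desc F d (v @ [a])"
    from Suc.IH[OF v this] show ?case by auto
  qed
qed auto

lemma finite_desc: "(\<And>k. finite (F k)) \<Longrightarrow> finite (desc F d v)"
  by (induction d arbitrary: v) auto

lemma finite_surv: "(\<And>k. finite (F k)) \<Longrightarrow> finite (surv F \<theta> d x v)"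
  by (induction d arbitrary: v) auto

lemma card_surv:
  assumes "\<And>k. finite (F k)"
  shows "valid F v \<Longrightarrow> card (surv F \<theta> d x v) = nsurv F \<theta> d x v"
proof (induction d arbitrary: v)
  case (Suc d)
  have "card (surv F \<theta> (Suc d) x v) = (\<Sum>a\<in>F (length v). card (if \<theta> (length v) \<le> x (v @ [a]) then surv F \<theta> d x (v @ [a]) else {}))"
    unfolding surv.simps
  proof (rule card_UN_disjoint)
    show "\<forall>i\<in>F (length v). \<forall>j\<in>F (length v). i \<noteq> j \<longrightarrow>
       (if \<theta> (length v) \<le> x (v @ [i]) then surv F \<theta> d x (v @ [i]) else {}) \<inter>
       (if \<theta> (length v) \<le> x (v @ [j]) then surv F \<theta> d x (v @ [j]) else {}) = {}"
    proof (intro ballI impI)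
      fix i j assume ij: "i \<in> F (length v)" "j \<in> F (length v)" "i \<noteq> j"
      have "surv F \<theta> d x (v @ [i]) \<inter> surv F \<theta> d x (v @ [j]) = {}"
      proof (rule ccontr)
        assume "\<not> ?thesis"
        then obtain w where "w \<in> surv F \<theta> d x (v @ [i])" "w \<in> surv F \<theta> d x (v @ [j])" by blast
        hence "\<exists>u. w = (v @ [i]) @ u" "\<exists>u. w = (v @ [j]) @ u"
          using surv_valid[of F] ij Suc.prems by (meson valid_snoc)+
        thus False using ij(3) by auto
      qed
      thus "(if \<theta> (length v) \<le> x (v @ [i]) then surv F \<theta> d x (v @ [i]) else {}) \<inter>
       (if \<theta> (length v) \<le> x (v @ [j]) then surv F \<theta> d x (v @ [j]) else {}) = {}" by auto
    qed
  qed (use assms finite_surv[OF assms] in auto)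
  also have "\<dots> = nsurv F \<theta> (Suc d) x v"
    unfolding nsurv.simps using Suc by (intro sum.cong refl) (auto simp: valid_snoc)
  finally show ?case .
qed auto

lemma nsurv_cong: "(\<And>w. w \<in> desc F d v \<Longrightarrow> x w = y w) \<Longrightarrow> nsurv F \<theta> d x v = nsurv F \<theta> d y v"
proof (induction d arbitrary: v)
  case (Suc d)
  have "x (v @ [a]) = y (v @ [a]) \<and> nsurv F \<theta> d x (v @ [a]) = nsurv F \<theta> d y (v @ [a])" if "a \<in> F (length v)" for a
    using that Suc.prems by (intro conjI Suc.IH) auto
  thus ?case by (auto intro!: sum.cong)
qed auto

lemma measurable_nsurv:
  assumes "\<And>k. finite (F k)" "desc F d v \<subseteq> S"
  shows "(\<lambda>x. real (nsurv F \<theta> d x v)) \<in> borel_measurable (PiM S (\<lambda>_. borel))"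
  using assms(2)
proof (induction d arbitrary: v)
  case (Suc d)
  have "(\<lambda>x. if \<theta> (length v) \<le> x (v @ [a]) then real (nsurv F \<theta> d x (v @ [a])) else 0) \<in> borel_measurable (PiM S (\<lambda>_. borel))"
    if "a \<in> F (length v)" for a
  proof -
    have [measurable]: "(\<lambda>x. x (v @ [a])) \<in> borel_measurable (PiM S (\<lambda>_. borel))"
      using that Suc.prems by (intro measurable_component_singleton) auto
    have [measurable]: "(\<lambda>x. real (nsurv F \<theta> d x (v @ [a]))) \<in> borel_measurable (PiM S (\<lambda>_. borel))"
      using that Suc.prems by (intro Suc.IH) auto
    show ?thesis by measurable
  qed
  hence "(\<lambda>x. \<Sum>a\<in>F (length v). if \<theta> (length v) \<le> x (v @ [a]) then real (nsurv F \<theta> d x (v @ [a])) else 0)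
      \<in> borel_measurable (PiM S (\<lambda>_. borel))"
    by (intro borel_measurable_sum) auto
  thus ?case by (simp add: if_distrib of_nat_sum cong: if_cong)
qed auto

text \<open>The convex function k -> u^k lies below its chord between 0 and b. The bound is affine
  in \<open>k\<close>, so for a random number of survivors only its expectation matters.\<close>

lemma power_le_chord:
  fixes u :: real
  assumes u: "0 \<le> u" "u \<le> 1" and k: "k \<le> b" and b: "b > 0"
  shows "u ^ k \<le> 1 - real k / real b * (1 - u ^ b)"
proof -
  have "real k * (1 - u ^ b) \<le> real b * (1 - u ^ k)"
    using k
  proof (induction b rule: dec_induct)
    case (step n)
    \<comment> \<open>The secant slopes (1 - u^n) / n decrease in n.\<close>
    have "real n * (1 - u ^ Suc n) \<le> real (Suc n) * (1 - u ^ n)"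
    proof (induction n)
      case (Suc n)
      have e: "1 - u ^ Suc n = (1 - u) * (\<Sum>i\<le>n. u ^ i)"
        unfolding lessThan_Suc_atMost[symmetric] by (rule one_diff_power_eq)
      have "0 \<le> (1 - u) * (\<Sum>i\<le>n. u ^ i - u ^ Suc n)"
      proof (intro mult_nonneg_nonneg sum_nonneg)
        fix i assume "i \<in> {..n}"
        thus "0 \<le> u ^ i - u ^ Suc n" using power_decreasing[of i "Suc n" u] u by simp
      qed (use u in auto)
      also have "\<dots> = (1 - u) * (\<Sum>i\<le>n. u ^ i) - real (Suc n) * u ^ Suc n * (1 - u)"
        by (simp add: sum_subtractf algebra_simps)
      also have "\<dots> = (1 - u ^ Suc n) - real (Suc n) * u ^ Suc n * (1 - u)" unfolding e ..
      also have "\<dots> = real (Suc (Suc n)) * (1 - u ^ Suc n) - real (Suc n) * (1 - u ^ Suc (Suc n))"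
        by (simp add: algebra_simps)
      finally show ?case by simp
    qed auto
    hence *: "real n * (1 - u ^ Suc n) \<le> real (Suc n) * (1 - u ^ n)" .
    show ?case
    proof (cases "n = 0")
      case True
      thus ?thesis using step by (auto simp: u)
    next
      case False
      have "real n * (real k * (1 - u ^ Suc n)) = real k * (real n * (1 - u ^ Suc n))" by simp
      also have "\<dots> \<le> real k * (real (Suc n) * (1 - u ^ n))" using * by (intro mult_left_mono) auto
      also have "\<dots> = real (Suc n) * (real k * (1 - u ^ n))" by simp
      also have "\<dots> \<le> real (Suc n) * (real n * (1 - u ^ k))" using step.IH by (intro mult_left_mono) auto
      also have "\<dots> = real n * (real (Suc n) * (1 - u ^ k))" by simp
      finally show ?thesis using False by (simp only: mult_le_cancel_left_pos of_nat_0_less_iff)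
    qed
  qed auto
  hence "real k * (1 - u ^ b) / real b \<le> 1 - u ^ k" using b by (simp add: pos_divide_le_eq mult.commute)
  thus ?thesis by simp
qed

text \<open>Two families of increments are independent when no member of one shares its parent with
  a member of the other. Siblings may depend on each other in any way.\<close>

locale tree_field = prob_space M for M :: "'a measure" +
  fixes F :: "nat \<Rightarrow> 'b set" and J :: nat and \<xi> :: "'b list \<Rightarrow> 'a \<Rightarrow> real" and \<theta> :: "nat \<Rightarrow> real"
  assumes fin [simp]: "\<And>k. finite (F k)"
    and meas: "\<And>v. \<xi> v \<in> borel_measurable M"
    and indep: "\<And>S T. finite S \<Longrightarrow> finite T \<Longrightarrow> (\<And>v. v \<in> S \<union> T \<Longrightarrow> valid F v \<and> v \<noteq> [] \<and> length v \<le> J)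
      \<Longrightarrow> (\<And>s t. s \<in> S \<Longrightarrow> t \<in> T \<Longrightarrow> butlast s \<noteq> butlast t)
      \<Longrightarrow> indep_var (PiM S (\<lambda>_. borel)) (\<lambda>\<omega>. \<lambda>v\<in>S. \<xi> v \<omega>) (PiM T (\<lambda>_. borel)) (\<lambda>\<omega>. \<lambda>v\<in>T. \<xi> v \<omega>)"
begin

lemma expectation_mult_indep:
  fixes f g :: "('b list \<Rightarrow> real) \<Rightarrow> real"
  assumes S: "finite S" "finite T" "\<And>v. v \<in> S \<union> T \<Longrightarrow> valid F v \<and> v \<noteq> [] \<and> length v \<le> J"
      "\<And>s t. s \<in> S \<Longrightarrow> t \<in> T \<Longrightarrow> butlast s \<noteq> butlast t"
    and f: "f \<in> borel_measurable (PiM S (\<lambda>_. borel))" "\<And>x. \<bar>f x\<bar> \<le> 1"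
    and g: "g \<in> borel_measurable (PiM T (\<lambda>_. borel))" "\<And>x. \<bar>g x\<bar> \<le> 1"
  shows "expectation (\<lambda>\<omega>. f (\<lambda>v\<in>S. \<xi> v \<omega>) * g (\<lambda>v\<in>T. \<xi> v \<omega>))
     = expectation (\<lambda>\<omega>. f (\<lambda>v\<in>S. \<xi> v \<omega>)) * expectation (\<lambda>\<omega>. g (\<lambda>v\<in>T. \<xi> v \<omega>))"
proof -
  have i: "indep_var borel (f \<circ> (\<lambda>\<omega>. \<lambda>v\<in>S. \<xi> v \<omega>)) borel (g \<circ> (\<lambda>\<omega>. \<lambda>v\<in>T. \<xi> v \<omega>))"
    using indep[OF S] f(1) g(1) by (rule indep_var_compose)
  have m: "(f \<circ> (\<lambda>\<omega>. \<lambda>v\<in>S. \<xi> v \<omega>)) \<in> borel_measurable M" "(g \<circ> (\<lambda>\<omega>. \<lambda>v\<in>T. \<xi> v \<omega>)) \<in> borel_measurable M"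
    using indep_var_rv1[OF i] indep_var_rv2[OF i] by auto
  have "integrable M (f \<circ> (\<lambda>\<omega>. \<lambda>v\<in>S. \<xi> v \<omega>))" "integrable M (g \<circ> (\<lambda>\<omega>. \<lambda>v\<in>T. \<xi> v \<omega>))"
    by (rule integrable_bounded[where B = 1, OF m(1)], simp add: f)
       (rule integrable_bounded[where B = 1, OF m(2)], simp add: g)
  from indep_var_lebesgue_integral[OF i this] show ?thesis by (simp only: o_def)
qed

abbreviation ns :: "nat \<Rightarrow> 'b list \<Rightarrow> 'a \<Rightarrow> nat" where
  "ns d v \<omega> \<equiv> nsurv F \<theta> d (\<lambda>w. \<xi> w \<omega>) v"

lemma ns_restrict: "desc F d v \<subseteq> S \<Longrightarrow> ns d v \<omega> = nsurv F \<theta> d (\<lambda>w\<in>S. \<xi> w \<omega>) v"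
  by (rule nsurv_cong) auto

lemma measurable_ns [measurable]: "(\<lambda>\<omega>. ns d v \<omega>) \<in> measurable M (count_space UNIV)"
proof -
  have "(\<lambda>\<omega>. \<lambda>w\<in>desc F d v. \<xi> w \<omega>) \<in> measurable M (PiM (desc F d v) (\<lambda>_. borel))"
    using meas by (intro measurable_restrict) auto
  from measurable_compose[OF this measurable_nsurv[OF fin order_refl, where \<theta> = \<theta>]]
  have [measurable]: "(\<lambda>\<omega>. real (ns d v \<omega>)) \<in> borel_measurable M"
    by (simp add: ns_restrict[OF order_refl, symmetric])
  have "(\<lambda>\<omega>. nat \<lfloor>real (ns d v \<omega>)\<rfloor>) \<in> measurable M (count_space UNIV)" by measurable
  thus ?thesis by simp
qed

lemma measurable_fun_nsurv:
  fixes f :: "nat \<Rightarrow> real"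
  assumes "desc F d v \<subseteq> S"
  shows "(\<lambda>x. f (nsurv F \<theta> d x v)) \<in> borel_measurable (PiM S (\<lambda>_. borel))"
proof -
  note [measurable] = measurable_nsurv[OF fin assms, of \<theta>]
  have "(\<lambda>x. f (nat \<lfloor>real (nsurv F \<theta> d x v)\<rfloor>)) \<in> borel_measurable (PiM S (\<lambda>_. borel))" by measurable
  thus ?thesis by simp
qed

lemma desc_child_props:
  assumes "valid F v" "length v + Suc d \<le> J" "a \<in> F (length v)" "w \<in> desc F d (v @ [a])"
  shows "valid F w \<and> w \<noteq> [] \<and> length w \<le> J" "\<exists>u. butlast w = v @ [a] @ u"
proof -
  have "valid F (v @ [a])" using assms by (simp add: valid_snoc)
  from desc_valid[OF this assms(4)] obtain u where u: "valid F w" "length w \<le> Suc (length v) + d" "u \<noteq> []" "w = (v @ [a]) @ u"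
    by auto
  thus "valid F w \<and> w \<noteq> [] \<and> length w \<le> J" using assms(2) by auto
  show "\<exists>u. butlast w = v @ [a] @ u" using u by (auto simp: butlast_append)
qed

text \<open>The counts below different children of \<open>v\<close> read increments whose parents
  extend different nodes \<open>v @ [a]\<close>, so no parent is shared and one factor can be split
  off at a time.\<close>

lemma expectation_prod_children:
  fixes f :: "nat \<Rightarrow> real"
  assumes v: "valid F v" "length v + Suc d \<le> J" and A: "A \<subseteq> F (length v)" and f: "\<And>n. 0 \<le> f n" "\<And>n. f n \<le> 1"
  shows "expectation (\<lambda>\<omega>. \<Prod>a\<in>A. f (ns d (v @ [a]) \<omega>)) = (\<Prod>a\<in>A. expectation (\<lambda>\<omega>. f (ns d (v @ [a]) \<omega>)))"
  using finite_subset[OF A fin] A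
proof (induction A rule: finite_induct)
  case empty
  show ?case by (simp add: prob_space)
next
  case (insert a A)
  let ?S = "desc F d (v @ [a])" and ?T = "\<Union>b\<in>A. desc F d (v @ [b])"
  have "expectation (\<lambda>\<omega>. f (nsurv F \<theta> d (\<lambda>w\<in>?S. \<xi> w \<omega>) (v @ [a])) * (\<Prod>b\<in>A. f (nsurv F \<theta> d (\<lambda>w\<in>?T. \<xi> w \<omega>) (v @ [b]))))
      = expectation (\<lambda>\<omega>. f (nsurv F \<theta> d (\<lambda>w\<in>?S. \<xi> w \<omega>) (v @ [a]))) * expectation (\<lambda>\<omega>. \<Prod>b\<in>A. f (nsurv F \<theta> d (\<lambda>w\<in>?T. \<xi> w \<omega>) (v @ [b])))"
  proof (rule expectation_mult_indep)
    show "finite ?S" "finite ?T" using insert.hyps by (auto intro!: finite_desc)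
    show "valid F w \<and> w \<noteq> [] \<and> length w \<le> J" if "w \<in> ?S \<union> ?T" for w
      using that insert.prems desc_child_props(1)[OF v] by blast
    show "butlast s \<noteq> butlast t" if st: "s \<in> ?S" "t \<in> ?T" for s t
    proof -
      obtain b where b: "b \<in> A" "t \<in> desc F d (v @ [b])" using st(2) by blast
      obtain u where "butlast s = v @ [a] @ u"
        using desc_child_props(2)[OF v _ st(1)] insert.prems by blast
      moreover obtain u' where "butlast t = v @ [b] @ u'"
        using desc_child_props(2)[OF v _ b(2)] b(1) insert.prems by blast
      ultimately show ?thesis using b(1) insert.hyps(2) by auto
    qed
    show "(\<lambda>x. f (nsurv F \<theta> d x (v @ [a]))) \<in> borel_measurable (PiM ?S (\<lambda>_. borel))"
      by (rule measurable_fun_nsurv) auto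
    show "(\<lambda>x. \<Prod>b\<in>A. f (nsurv F \<theta> d x (v @ [b]))) \<in> borel_measurable (PiM ?T (\<lambda>_. borel))"
      by (intro borel_measurable_prod measurable_fun_nsurv) auto
    show "\<bar>f (nsurv F \<theta> d x (v @ [a]))\<bar> \<le> 1" for x using f by simp
    show "\<bar>\<Prod>b\<in>A. f (nsurv F \<theta> d x (v @ [b]))\<bar> \<le> 1" for x
      using f by (simp add: abs_prod prod_le_1)
  qed
  also have "(\<lambda>\<omega>. f (nsurv F \<theta> d (\<lambda>w\<in>?S. \<xi> w \<omega>) (v @ [a])) * (\<Prod>b\<in>A. f (nsurv F \<theta> d (\<lambda>w\<in>?T. \<xi> w \<omega>) (v @ [b]))))
    = (\<lambda>\<omega>. \<Prod>b\<in>insert a A. f (ns d (v @ [b]) \<omega>))"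
  proof
    fix \<omega>
    have "nsurv F \<theta> d (\<lambda>w\<in>?T. \<xi> w \<omega>) (v @ [b]) = ns d (v @ [b]) \<omega>" if "b \<in> A" for b
      using that by (intro ns_restrict[symmetric]) blast
    moreover have "nsurv F \<theta> d (\<lambda>w\<in>?S. \<xi> w \<omega>) (v @ [a]) = ns d (v @ [a]) \<omega>" by (rule ns_restrict[symmetric]) simp
    ultimately show "f (nsurv F \<theta> d (\<lambda>w\<in>?S. \<xi> w \<omega>) (v @ [a])) * (\<Prod>b\<in>A. f (nsurv F \<theta> d (\<lambda>w\<in>?T. \<xi> w \<omega>) (v @ [b])))
      = (\<Prod>b\<in>insert a A. f (ns d (v @ [b]) \<omega>))" using insert.hyps by simp
  qed
  also have "(\<lambda>\<omega>. f (nsurv F \<theta> d (\<lambda>w\<in>?S. \<xi> w \<omega>) (v @ [a]))) = (\<lambda>\<omega>. f (ns d (v @ [a]) \<omega>))"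
    by (simp add: ns_restrict[OF order_refl, symmetric])
  also have "(\<lambda>\<omega>. \<Prod>b\<in>A. f (nsurv F \<theta> d (\<lambda>w\<in>?T. \<xi> w \<omega>) (v @ [b]))) = (\<lambda>\<omega>. \<Prod>b\<in>A. f (ns d (v @ [b]) \<omega>))"
  proof (intro ext prod.cong refl arg_cong[where f = f])
    fix \<omega> b assume "b \<in> A"
    thus "nsurv F \<theta> d (\<lambda>w\<in>?T. \<xi> w \<omega>) (v @ [b]) = ns d (v @ [b]) \<omega>"
      by (intro ns_restrict[symmetric]) blast
  qed
  finally show ?case using insert by simp
qed

text \<open>The increments of the children have parent \<open>v\<close>, all deeper ones have a
  longer parent; hence the dependence among siblings does not reach into their subtrees.\<close>

lemma expectation_children_indep:
  fixes g h :: "('b list \<Rightarrow> real) \<Rightarrow> real"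
  assumes v: "valid F v" "length v + Suc d \<le> J"
  defines "S \<equiv> (\<lambda>a. v @ [a]) ` F (length v)" and "T \<equiv> \<Union>a\<in>F (length v). desc F d (v @ [a])"
  assumes g: "g \<in> borel_measurable (PiM S (\<lambda>_. borel))" "\<And>x. \<bar>g x\<bar> \<le> 1"
    and h: "h \<in> borel_measurable (PiM T (\<lambda>_. borel))" "\<And>x. \<bar>h x\<bar> \<le> 1"
  shows "expectation (\<lambda>\<omega>. g (\<lambda>w\<in>S. \<xi> w \<omega>) * h (\<lambda>w\<in>T. \<xi> w \<omega>))
    = expectation (\<lambda>\<omega>. g (\<lambda>w\<in>S. \<xi> w \<omega>)) * expectation (\<lambda>\<omega>. h (\<lambda>w\<in>T. \<xi> w \<omega>))"
proof (rule expectation_mult_indep[OF _ _ _ _ g h])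
  show "finite S" "finite T" by (auto simp: S_def T_def intro!: finite_desc)
  show "valid F w \<and> w \<noteq> [] \<and> length w \<le> J" if "w \<in> S \<union> T" for w
    using that v desc_child_props(1)[OF v] by (auto simp: S_def T_def valid_snoc)
  show "butlast s \<noteq> butlast t" if "s \<in> S" "t \<in> T" for s t
    using that desc_child_props(2)[OF v] by (fastforce simp: S_def T_def)
qed

text \<open>Given the set of children that pass the threshold, their subtrees are independent and
  contribute at most u^k for k of them. The chord bound makes this affine in k, and the mean of k is
  at least \<open>p * b\<close> whatever the joint law of the siblings.\<close>

lemma laplace_step:
  assumes v: "valid F v" "length v + Suc d \<le> J"
    and b: "b = card (F (length v))" "b > 0"
    and p: "\<And>a. a \<in> F (length v) \<Longrightarrow> prob {\<omega> \<in> space M. \<theta> (length v) \<le> \<xi> (v @ [a]) \<omega>} \<ge> p"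
    and lam: "lam \<ge> 0" and u: "0 \<le> u" "u \<le> 1"
    and uc: "\<And>a. a \<in> F (length v) \<Longrightarrow> expectation (\<lambda>\<omega>. exp (- lam * real (ns d (v @ [a]) \<omega>))) \<le> u"
  shows "expectation (\<lambda>\<omega>. exp (- lam * real (ns (Suc d) v \<omega>))) \<le> 1 - p * (1 - u ^ b)"
proof -
  note [measurable] = meas
  let ?F = "F (length v)" and ?t = "\<theta> (length v)"
  define S where "S = (\<lambda>a. v @ [a]) ` ?F"
  define T where "T = (\<Union>a\<in>?F. desc F d (v @ [a]))"
  \<comment> \<open>The random set of passing children. The finite partition by its values replaces
    conditioning.\<close>
  define pat where "pat = (\<lambda>x :: 'b list \<Rightarrow> real. {a \<in> ?F. ?t \<le> x (v @ [a])})"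
  define f where "f = (\<lambda>n. exp (- lam * real n))"
  have f: "0 \<le> f n" "f n \<le> 1" for n using lam by (auto simp: f_def)
  define X where "X = (\<lambda>\<omega> w. \<xi> w \<omega>)"
  have pat_S: "pat (\<lambda>w\<in>S. \<xi> w \<omega>) = pat (X \<omega>)" for \<omega> by (auto simp: pat_def S_def X_def)
  have ns_T: "nsurv F \<theta> d (\<lambda>w\<in>T. \<xi> w \<omega>) (v @ [a]) = ns d (v @ [a]) \<omega>" if "a \<in> ?F" for a \<omega>
    using that by (intro ns_restrict[symmetric]) (auto simp: T_def)
  have mpat: "(\<lambda>x. if pat x = A then 1 else 0 :: real) \<in> borel_measurable (PiM S (\<lambda>_. borel))" if "A \<subseteq> ?F" for A
  proof -
    have c[measurable]: "(\<lambda>x. x (v @ [a])) \<in> borel_measurable (PiM S (\<lambda>_. borel))" if "a \<in> ?F" for a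
      using that by (intro measurable_component_singleton) (auto simp: S_def)
    have "pat x = A \<longleftrightarrow> (\<forall>a\<in>?F. (?t \<le> x (v @ [a])) = (a \<in> A))" for x using that by (auto simp: pat_def)
    moreover have "Measurable.pred (PiM S (\<lambda>_. borel)) (\<lambda>x. \<forall>a\<in>?F. (?t \<le> x (v @ [a])) = (a \<in> A))"
      by measurable
    ultimately show ?thesis by simp
  qed
  have mpatM: "(\<lambda>\<omega>. if pat (X \<omega>) = A then 1 else 0 :: real) \<in> borel_measurable M" if "A \<subseteq> ?F" for A
  proof -
    have "(\<lambda>\<omega>. \<lambda>w\<in>S. \<xi> w \<omega>) \<in> measurable M (PiM S (\<lambda>_. borel))" by (intro measurable_restrict) auto
    from measurable_compose[OF this mpat[OF that]] show ?thesis by (simp add: pat_S)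
  qed
  have intpat: "integrable M (\<lambda>\<omega>. c * (if pat (X \<omega>) = A then 1 else 0 :: real))" if "A \<subseteq> ?F" for A c
    using mpatM[OF that] by (intro integrable_mult_right integrable_bounded[where B = 1]) auto
  have patsub: "pat x \<in> Pow ?F" for x by (auto simp: pat_def)
  have decomp: "h (pat x) = (\<Sum>A\<in>Pow ?F. h A * (if pat x = A then 1 else 0))" for h :: "'b set \<Rightarrow> real" and x
    using patsub[of x] by (simp add: if_distrib cong: if_cong)
  have e1: "exp (- lam * real (ns (Suc d) v \<omega>)) = (\<Prod>a\<in>pat (X \<omega>). f (ns d (v @ [a]) \<omega>))" for \<omega>
  proof -
    have "real (ns (Suc d) v \<omega>) = (\<Sum>a\<in>pat (X \<omega>). real (ns d (v @ [a]) \<omega>))"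
      by (simp add: pat_def X_def sum.inter_filter of_nat_sum if_distrib cong: if_cong)
    thus ?thesis by (simp add: f_def exp_sum[symmetric] sum_distrib_left pat_def sum_negf)
  qed
  have term_le: "expectation (\<lambda>\<omega>. (\<Prod>a\<in>A. f (ns d (v @ [a]) \<omega>)) * (if pat (X \<omega>) = A then 1 else 0))
      \<le> u ^ card A * expectation (\<lambda>\<omega>. if pat (X \<omega>) = A then 1 else 0)" if A: "A \<subseteq> ?F" for A
  proof -
    have "expectation (\<lambda>\<omega>. (if pat (\<lambda>w\<in>S. \<xi> w \<omega>) = A then 1 else 0) * (\<Prod>a\<in>A. f (nsurv F \<theta> d (\<lambda>w\<in>T. \<xi> w \<omega>) (v @ [a]))))
       = expectation (\<lambda>\<omega>. if pat (\<lambda>w\<in>S. \<xi> w \<omega>) = A then 1 else 0) * expectation (\<lambda>\<omega>. \<Prod>a\<in>A. f (nsurv F \<theta> d (\<lambda>w\<in>T. \<xi> w \<omega>) (v @ [a])))"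
      unfolding S_def T_def
    proof (rule expectation_children_indep[OF v])
      show "(\<lambda>x. if pat x = A then 1 else 0 :: real) \<in> borel_measurable (PiM ((\<lambda>a. v @ [a]) ` ?F) (\<lambda>_. borel))"
        using mpat[OF A] by (simp add: S_def)
      show "(\<lambda>x. \<Prod>a\<in>A. f (nsurv F \<theta> d x (v @ [a]))) \<in> borel_measurable (PiM (\<Union>a\<in>?F. desc F d (v @ [a])) (\<lambda>_. borel))"
        using A by (intro borel_measurable_prod measurable_fun_nsurv) auto
      show "\<bar>\<Prod>a\<in>A. f (nsurv F \<theta> d x (v @ [a]))\<bar> \<le> 1" for x
        using f by (simp add: abs_prod prod_le_1)
    qed auto
    also have "(\<lambda>\<omega>. \<Prod>a\<in>A. f (nsurv F \<theta> d (\<lambda>w\<in>T. \<xi> w \<omega>) (v @ [a]))) = (\<lambda>\<omega>. \<Prod>a\<in>A. f (ns d (v @ [a]) \<omega>))"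
      using A by (intro ext prod.cong refl arg_cong[where f = f] ns_T) auto
    also have "expectation (\<lambda>\<omega>. \<Prod>a\<in>A. f (ns d (v @ [a]) \<omega>)) = (\<Prod>a\<in>A. expectation (\<lambda>\<omega>. f (ns d (v @ [a]) \<omega>)))"
      by (rule expectation_prod_children[OF v A f])
    also have "expectation (\<lambda>\<omega>. if pat (\<lambda>w\<in>S. \<xi> w \<omega>) = A then 1 else 0) * (\<Prod>a\<in>A. expectation (\<lambda>\<omega>. f (ns d (v @ [a]) \<omega>)))
       \<le> expectation (\<lambda>\<omega>. if pat (X \<omega>) = A then 1 else 0) * (\<Prod>a\<in>A. u)"
      unfolding pat_S
    proof (intro mult_left_mono prod_mono conjI)
      fix a assume "a \<in> A"
      thus "expectation (\<lambda>\<omega>. f (ns d (v @ [a]) \<omega>)) \<le> u" using uc A by (auto simp: f_def)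
    qed (auto intro!: integral_nonneg_AE f)
    finally show ?thesis unfolding pat_S by (simp add: mult.commute)
  qed
  have "expectation (\<lambda>\<omega>. exp (- lam * real (ns (Suc d) v \<omega>)))
     = expectation (\<lambda>\<omega>. \<Sum>A\<in>Pow ?F. (\<Prod>a\<in>A. f (ns d (v @ [a]) \<omega>)) * (if pat (X \<omega>) = A then 1 else 0))"
  proof (rule Bochner_Integration.integral_cong[OF refl])
    fix \<omega>
    show "exp (- lam * real (ns (Suc d) v \<omega>)) = (\<Sum>A\<in>Pow ?F. (\<Prod>a\<in>A. f (ns d (v @ [a]) \<omega>)) * (if pat (X \<omega>) = A then 1 else 0))"
      unfolding e1 by (rule decomp[of "\<lambda>A. \<Prod>a\<in>A. f (ns d (v @ [a]) \<omega>)" "X \<omega>"])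
  qed
  also have "\<dots> = (\<Sum>A\<in>Pow ?F. expectation (\<lambda>\<omega>. (\<Prod>a\<in>A. f (ns d (v @ [a]) \<omega>)) * (if pat (X \<omega>) = A then 1 else 0)))"
  proof (rule Bochner_Integration.integral_sum)
    fix A assume "A \<in> Pow ?F"
    hence [measurable]: "(\<lambda>\<omega>. if pat (X \<omega>) = A then 1 else 0 :: real) \<in> borel_measurable M" using mpatM by auto
    have "\<bar>(\<Prod>a\<in>A. f (ns d (v @ [a]) \<omega>)) * (if pat (X \<omega>) = A then 1 else 0)\<bar> \<le> 1" for \<omega>
      using f by (simp add: abs_prod prod_le_1)
    thus "integrable M (\<lambda>\<omega>. (\<Prod>a\<in>A. f (ns d (v @ [a]) \<omega>)) * (if pat (X \<omega>) = A then 1 else 0))"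
      by (intro integrable_bounded[where B = 1]) auto
  qed
  also have "\<dots> \<le> (\<Sum>A\<in>Pow ?F. u ^ card A * expectation (\<lambda>\<omega>. if pat (X \<omega>) = A then 1 else 0))"
    by (intro sum_mono term_le) auto
  also have "\<dots> \<le> (\<Sum>A\<in>Pow ?F. (1 - real (card A) / real b * (1 - u ^ b)) * expectation (\<lambda>\<omega>. if pat (X \<omega>) = A then 1 else 0))"
  proof (intro sum_mono mult_right_mono power_le_chord u b(2))
    fix A assume "A \<in> Pow ?F"
    thus "card A \<le> b" unfolding b by (intro card_mono) auto
  qed (auto intro!: integral_nonneg_AE)
  also have "\<dots> = (\<Sum>A\<in>Pow ?F. expectation (\<lambda>\<omega>. (1 - real (card A) / real b * (1 - u ^ b)) * (if pat (X \<omega>) = A then 1 else 0)))"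
    by (simp only: integral_mult_right_zero)
  also have "\<dots> = expectation (\<lambda>\<omega>. \<Sum>A\<in>Pow ?F. (1 - real (card A) / real b * (1 - u ^ b)) * (if pat (X \<omega>) = A then 1 else 0))"
    using intpat by (intro Bochner_Integration.integral_sum[symmetric]) auto
  also have "\<dots> = expectation (\<lambda>\<omega>. 1 - real (card (pat (X \<omega>))) / real b * (1 - u ^ b))"
    by (rule Bochner_Integration.integral_cong[OF refl]) (rule decomp[symmetric, of "\<lambda>A. 1 - real (card A) / real b * (1 - u ^ b)"])
  also have "\<dots> = expectation (\<lambda>\<omega>. 1 - (\<Sum>a\<in>?F. indicator {\<omega> \<in> space M. ?t \<le> \<xi> (v @ [a]) \<omega>} \<omega>) * ((1 - u ^ b) / real b))"
  proof (rule Bochner_Integration.integral_cong[OF refl])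
    fix \<omega> assume "\<omega> \<in> space M"
    hence "real (card (pat (X \<omega>))) = (\<Sum>a\<in>?F. indicator {\<omega> \<in> space M. ?t \<le> \<xi> (v @ [a]) \<omega>} \<omega>)"
      by (simp add: pat_def X_def indicator_def sum.If_cases Int_def)
    thus "1 - real (card (pat (X \<omega>))) / real b * (1 - u ^ b) = 1 - (\<Sum>a\<in>?F. indicator {\<omega> \<in> space M. ?t \<le> \<xi> (v @ [a]) \<omega>} \<omega>) * ((1 - u ^ b) / real b)"
      by simp
  qed
  also have "\<dots> = 1 - (\<Sum>a\<in>?F. prob {\<omega> \<in> space M. ?t \<le> \<xi> (v @ [a]) \<omega>}) * ((1 - u ^ b) / real b)"
  proof -
    have i: "integrable M (indicator {\<omega> \<in> space M. ?t \<le> \<xi> (v @ [a]) \<omega>} :: 'a \<Rightarrow> real)" for a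
      by (intro integrable_bounded[where B = 1]) (auto simp: indicator_def)
    hence "integrable M (\<lambda>\<omega>. (\<Sum>a\<in>?F. indicator {\<omega> \<in> space M. ?t \<le> \<xi> (v @ [a]) \<omega>} \<omega>) * ((1 - u ^ b) / real b))"
      by (intro integrable_mult_left Bochner_Integration.integrable_sum)
    thus ?thesis
      using i by (subst Bochner_Integration.integral_diff) (simp_all add: prob_space Bochner_Integration.integral_sum)
  qed
  also have "\<dots> \<le> 1 - (\<Sum>a\<in>?F. p) * ((1 - u ^ b) / real b)"
    using u b by (intro diff_left_mono mult_right_mono sum_mono p divide_nonneg_pos) (auto simp: power_le_one)
  also have "\<dots> = 1 - p * (1 - u ^ b)" using b by simp
  finally show ?thesis .
qed

text \<open>The set of successful children is independent of the increments of the children, so the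
  latter only have to be controlled on each deterministic set.\<close>

lemma root_failure_bound:
  assumes J: "J = Suc d"
    and succ: "\<And>a. a \<in> F 0 \<Longrightarrow> prob {\<omega> \<in> space M. m \<le> ns d [a] \<omega>} \<ge> s" and s: "s \<ge> 0"
    and \<kappa>: "\<kappa> \<ge> 0"
    and neg: "\<And>A. A \<subseteq> F 0 \<Longrightarrow> prob {\<omega> \<in> space M. \<forall>a\<in>A. \<xi> [a] \<omega> < \<tau>} \<le> exp (- \<kappa> * real (card A))"
  shows "prob {\<omega> \<in> space M. \<forall>a\<in>F 0. m \<le> ns d [a] \<omega> \<longrightarrow> \<xi> [a] \<omega> < \<tau>} \<le> exp (- real (card (F 0)) * s * (1 - exp (- \<kappa>)))"
proof -
  note [measurable] = meas
  have v: "valid F []" "length [] + Suc d \<le> J" using J by auto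
  let ?F = "F 0"
  define S where "S = (\<lambda>a. [] @ [a]) ` ?F"
  define T where "T = (\<Union>a\<in>?F. desc F d ([] @ [a]))"
  define pat where "pat = (\<lambda>x. {a \<in> ?F. m \<le> nsurv F \<theta> d x [a]})"
  define X where "X = (\<lambda>\<omega> w. \<xi> w \<omega>)"
  have pat_T: "pat (\<lambda>w\<in>T. \<xi> w \<omega>) = pat (X \<omega>)" for \<omega>
  proof -
    have "nsurv F \<theta> d (\<lambda>w\<in>T. \<xi> w \<omega>) [a] = ns d [a] \<omega>" if "a \<in> ?F" for a
      using that by (intro ns_restrict[symmetric]) (auto simp: T_def)
    thus ?thesis by (auto simp: pat_def X_def)
  qed
  have patsub: "pat x \<in> Pow ?F" for x by (auto simp: pat_def)
  have decomp: "h (pat x) = (\<Sum>A\<in>Pow ?F. h A * (if pat x = A then 1 else 0))" for h :: "'b set \<Rightarrow> real" and x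
    using patsub[of x] by (simp add: if_distrib cong: if_cong)
  have mpat: "(\<lambda>x. if pat x = A then 1 else 0 :: real) \<in> borel_measurable (PiM T (\<lambda>_. borel))" if "A \<subseteq> ?F" for A
  proof -
    have c[measurable]: "(\<lambda>x. real (nsurv F \<theta> d x [a])) \<in> borel_measurable (PiM T (\<lambda>_. borel))" if "a \<in> ?F" for a
      using that by (intro measurable_nsurv) (auto simp: T_def)
    have "pat x = A \<longleftrightarrow> (\<forall>a\<in>?F. (real m \<le> real (nsurv F \<theta> d x [a])) = (a \<in> A))" for x using that by (auto simp: pat_def)
    moreover have "Measurable.pred (PiM T (\<lambda>_. borel)) (\<lambda>x. \<forall>a\<in>?F. (real m \<le> real (nsurv F \<theta> d x [a])) = (a \<in> A))"
      by measurable
    ultimately show ?thesis by simp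
  qed
  have mpatM: "(\<lambda>\<omega>. if pat (X \<omega>) = A then 1 else 0 :: real) \<in> borel_measurable M" if "A \<subseteq> ?F" for A
  proof -
    have "(\<lambda>\<omega>. \<lambda>w\<in>T. \<xi> w \<omega>) \<in> measurable M (PiM T (\<lambda>_. borel))" by (intro measurable_restrict) auto
    from measurable_compose[OF this mpat[OF that]] show ?thesis by (simp add: pat_T)
  qed
  define q where "q = (\<lambda>A (x :: 'b list \<Rightarrow> real). if \<forall>a\<in>A. x [a] < \<tau> then 1 else 0 :: real)"
  have mq: "q A \<in> borel_measurable (PiM S (\<lambda>_. borel))" if "A \<subseteq> ?F" for A
  proof -
    have c[measurable]: "(\<lambda>x. x [a]) \<in> borel_measurable (PiM S (\<lambda>_. borel))" if "a \<in> A" for a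
      using that \<open>A \<subseteq> ?F\<close> by (intro measurable_component_singleton) (auto simp: S_def)
    have [measurable]: "finite A" using that finite_subset fin by blast
    have "Measurable.pred (PiM S (\<lambda>_. borel)) (\<lambda>x. \<forall>a\<in>A. x [a] < \<tau>)" by measurable
    thus ?thesis unfolding q_def by simp
  qed
  have q_S: "q A (\<lambda>w\<in>S. \<xi> w \<omega>) = q A (X \<omega>)" if "A \<subseteq> ?F" for A \<omega>
    using that by (auto simp: q_def S_def X_def subset_iff)
  have mqM: "(\<lambda>\<omega>. q A (X \<omega>)) \<in> borel_measurable M" if "A \<subseteq> ?F" for A
  proof -
    have "(\<lambda>\<omega>. \<lambda>w\<in>S. \<xi> w \<omega>) \<in> measurable M (PiM S (\<lambda>_. borel))" by (intro measurable_restrict) auto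
    from measurable_compose[OF this mq[OF that]] show ?thesis by (simp add: q_S[OF that])
  qed
  have [simp]: "\<bar>q A x\<bar> \<le> 1" "0 \<le> q A x" "q A x \<le> 1" for A x by (auto simp: q_def)
  have qprob: "expectation (\<lambda>\<omega>. q A (X \<omega>)) \<le> exp (- \<kappa>) ^ card A" if A: "A \<subseteq> ?F" for A
  proof -
    have [measurable]: "finite A" using A finite_subset fin by blast
    have [measurable]: "{\<omega> \<in> space M. \<forall>a\<in>A. \<xi> [a] \<omega> < \<tau>} \<in> sets M" by measurable
    have "expectation (\<lambda>\<omega>. q A (X \<omega>)) = expectation (indicator {\<omega> \<in> space M. \<forall>a\<in>A. \<xi> [a] \<omega> < \<tau>})"
      by (intro Bochner_Integration.integral_cong) (auto simp: q_def X_def indicator_def)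
    also have "\<dots> \<le> exp (- \<kappa> * real (card A))" using neg[OF A] by simp
    finally show ?thesis by (simp add: exp_of_nat_mult[symmetric] mult.commute)
  qed
  have "prob {\<omega> \<in> space M. \<forall>a\<in>?F. m \<le> ns d [a] \<omega> \<longrightarrow> \<xi> [a] \<omega> < \<tau>} = expectation (\<lambda>\<omega>. q (pat (X \<omega>)) (X \<omega>))"
  proof -
    have [measurable]: "{\<omega> \<in> space M. \<forall>a\<in>?F. m \<le> ns d [a] \<omega> \<longrightarrow> \<xi> [a] \<omega> < \<tau>} \<in> sets M" by measurable
    have "expectation (\<lambda>\<omega>. q (pat (X \<omega>)) (X \<omega>)) = expectation (indicator {\<omega> \<in> space M. \<forall>a\<in>?F. m \<le> ns d [a] \<omega> \<longrightarrow> \<xi> [a] \<omega> < \<tau>})"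
      by (intro Bochner_Integration.integral_cong) (auto simp: q_def X_def indicator_def pat_def)
    thus ?thesis by simp
  qed
  also have "\<dots> = expectation (\<lambda>\<omega>. \<Sum>A\<in>Pow ?F. q A (X \<omega>) * (if pat (X \<omega>) = A then 1 else 0))"
    by (rule Bochner_Integration.integral_cong[OF refl]) (rule decomp[of "\<lambda>A. q A (X _)"])
  also have "\<dots> = (\<Sum>A\<in>Pow ?F. expectation (\<lambda>\<omega>. q A (X \<omega>) * (if pat (X \<omega>) = A then 1 else 0)))"
  proof (rule Bochner_Integration.integral_sum)
    fix A assume "A \<in> Pow ?F"
    hence [measurable]: "(\<lambda>\<omega>. if pat (X \<omega>) = A then 1 else 0 :: real) \<in> borel_measurable M" "(\<lambda>\<omega>. q A (X \<omega>)) \<in> borel_measurable M"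
      using mpatM mqM by auto
    show "integrable M (\<lambda>\<omega>. q A (X \<omega>) * (if pat (X \<omega>) = A then 1 else 0))"
      by (rule integrable_bounded[where B = 1]) auto
  qed
  also have "\<dots> \<le> (\<Sum>A\<in>Pow ?F. exp (- \<kappa>) ^ card A * expectation (\<lambda>\<omega>. if pat (X \<omega>) = A then 1 else 0))"
  proof (intro sum_mono)
    fix A assume "A \<in> Pow ?F"
    hence A: "A \<subseteq> ?F" by simp
    have "expectation (\<lambda>\<omega>. q A (\<lambda>w\<in>S. \<xi> w \<omega>) * (if pat (\<lambda>w\<in>T. \<xi> w \<omega>) = A then 1 else 0))
      = expectation (\<lambda>\<omega>. q A (\<lambda>w\<in>S. \<xi> w \<omega>)) * expectation (\<lambda>\<omega>. if pat (\<lambda>w\<in>T. \<xi> w \<omega>) = A then 1 else 0)"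
      using expectation_children_indep[OF v, of "q A" "\<lambda>x. if pat x = A then 1 else 0"] mq[OF A] mpat[OF A]
      by (simp add: S_def T_def)
    hence "expectation (\<lambda>\<omega>. q A (X \<omega>) * (if pat (X \<omega>) = A then 1 else 0))
      = expectation (\<lambda>\<omega>. q A (X \<omega>)) * expectation (\<lambda>\<omega>. if pat (X \<omega>) = A then 1 else 0)"
      by (simp only: pat_T q_S[OF A])
    also have "\<dots> \<le> exp (- \<kappa>) ^ card A * expectation (\<lambda>\<omega>. if pat (X \<omega>) = A then 1 else 0)"
      by (intro mult_right_mono qprob A) (auto intro!: integral_nonneg_AE)
    finally show "expectation (\<lambda>\<omega>. q A (X \<omega>) * (if pat (X \<omega>) = A then 1 else 0))
      \<le> exp (- \<kappa>) ^ card A * expectation (\<lambda>\<omega>. if pat (X \<omega>) = A then 1 else 0)" .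
  qed
  also have "\<dots> = (\<Sum>A\<in>Pow ?F. expectation (\<lambda>\<omega>. exp (- \<kappa>) ^ card A * (if pat (X \<omega>) = A then 1 else 0)))"
    by (simp only: integral_mult_right_zero)
  also have "\<dots> = expectation (\<lambda>\<omega>. \<Sum>A\<in>Pow ?F. exp (- \<kappa>) ^ card A * (if pat (X \<omega>) = A then 1 else 0))"
    using mpatM by (intro Bochner_Integration.integral_sum[symmetric] integrable_mult_right integrable_bounded[where B = 1]) auto
  also have "\<dots> = expectation (\<lambda>\<omega>. exp (- \<kappa>) ^ card (pat (X \<omega>)))"
    by (rule Bochner_Integration.integral_cong[OF refl]) (rule decomp[symmetric, of "\<lambda>A. exp (- \<kappa>) ^ card A"])
  \<comment> \<open>With the root increments integrated out, each successful child contributes a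
    factor \<open>exp (- \<kappa>)\<close>, and success is a function of the independent subtrees
    only.\<close>
  also have "\<dots> = expectation (\<lambda>\<omega>. \<Prod>a\<in>?F. (\<lambda>n. if m \<le> n then exp (- \<kappa>) else 1) (ns d ([] @ [a]) \<omega>))"
  proof (rule Bochner_Integration.integral_cong[OF refl])
    fix \<omega>
    show "exp (- \<kappa>) ^ card (pat (X \<omega>)) = (\<Prod>a\<in>?F. (\<lambda>n. if m \<le> n then exp (- \<kappa>) else 1) (ns d ([] @ [a]) \<omega>))"
      by (simp add: pat_def X_def prod.If_cases Int_def)
  qed
  also have "\<dots> = (\<Prod>a\<in>?F. expectation (\<lambda>\<omega>. (\<lambda>n. if m \<le> n then exp (- \<kappa>) else 1) (ns d ([] @ [a]) \<omega>)))"
    using \<kappa> by (intro expectation_prod_children[OF v]) auto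
  also have "\<dots> \<le> (\<Prod>a\<in>?F. exp (- s * (1 - exp (- \<kappa>))))"
  proof (intro prod_mono conjI)
    fix a assume a: "a \<in> ?F"
    have [measurable]: "{\<omega> \<in> space M. m \<le> ns d [a] \<omega>} \<in> sets M" by measurable
    have "expectation (\<lambda>\<omega>. if m \<le> ns d ([] @ [a]) \<omega> then exp (- \<kappa>) else 1)
       = expectation (\<lambda>\<omega>. 1 - (1 - exp (- \<kappa>)) * indicator {\<omega> \<in> space M. m \<le> ns d [a] \<omega>} \<omega>)"
      by (intro Bochner_Integration.integral_cong) (auto simp: indicator_def)
    also have "\<dots> = 1 - (1 - exp (- \<kappa>)) * prob {\<omega> \<in> space M. m \<le> ns d [a] \<omega>}"
    proof -
      have "integrable M (\<lambda>\<omega>. (1 - exp (- \<kappa>)) * indicator {\<omega> \<in> space M. m \<le> ns d [a] \<omega>} \<omega>)"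
        by (intro integrable_mult_right integrable_bounded[where B = 1]) (auto simp: indicator_def)
      thus ?thesis by (subst Bochner_Integration.integral_diff) (simp_all add: prob_space)
    qed
    also have "\<dots> \<le> 1 - (1 - exp (- \<kappa>)) * s" using succ[OF a] \<kappa> by (intro diff_left_mono mult_left_mono) auto
    also have "\<dots> \<le> exp (- s * (1 - exp (- \<kappa>)))" using exp_ge_add_one_self[of "- s * (1 - exp (- \<kappa>))"] by (simp add: mult.commute)
    finally show "expectation (\<lambda>\<omega>. (\<lambda>n. if m \<le> n then exp (- \<kappa>) else 1) (ns d ([] @ [a]) \<omega>)) \<le> exp (- s * (1 - exp (- \<kappa>)))" .
  qed (auto intro!: integral_nonneg_AE)
  also have "\<dots> = exp (- real (card ?F) * s * (1 - exp (- \<kappa>)))"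
    by (simp add: exp_of_nat_mult[symmetric] mult.assoc)
  finally show ?thesis .
qed

end

section \<open>Lower bound for the probability of a large surviving population\<close>

context tree_field
begin

lemma exp_neg_le_half: "exp (- x) \<le> 1 - x / 2" if "0 \<le> x" "x \<le> 1" for x :: real
proof -
  have "exp (- x) = inverse (exp x)" by (rule exp_minus)
  also have "\<dots> \<le> inverse (1 + x)" using that by (intro le_imp_inverse_le exp_ge_add_one_self) auto
  also have "\<dots> \<le> 1 - x / 2"
  proof -
    have "x * x \<le> x" using mult_right_mono[OF that(2,1)] by simp
    hence "1 \<le> (1 - x / 2) * (1 + x)" by (simp add: field_simps)
    thus ?thesis using that by (simp add: inverse_eq_divide pos_divide_le_eq)
  qed
  finally show ?thesis .
qed

lemma one_minus_power_le:
  assumes "0 \<le> q" "q * B \<le> 1" "q \<le> 1" "B \<le> real b"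
  shows "(1 - q) ^ b \<le> exp (- (q * B))"
proof -
  have "(1 - q) ^ b \<le> exp (- q) ^ b"
    using assms exp_ge_add_one_self[of "- q"] by (intro power_mono) auto
  also have "\<dots> = exp (- (q * real b))" by (simp add: exp_of_nat_mult[symmetric] mult.commute)
  also have "\<dots> \<le> exp (- (q * B))" using assms by (simp add: mult_left_mono)
  finally show ?thesis .
qed

text \<open>Let 1 - q be the current bound for the Laplace transform. As long as q B is at most 1,
  one generation multiplies q by at least p B / 2. Starting at the leaves with a parameter of order
  (2 / (p B))^(J - 2) / B, depth 2 is reached with q = 1 / B; the at least B children at depth 1
  then bring 1 minus the transform up to p1 / 2. An exponential Markov inequality turns this into a
  lower bound for the probability of at least m survivors.\<close>

lemma success_probability:
  assumes J: "J \<ge> 2"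
    and B: "\<And>k. 1 \<le> k \<Longrightarrow> k < J \<Longrightarrow> real (card (F k)) \<ge> B"
    and p: "0 < p" "p \<le> 1" "p * B \<ge> 2" and p1: "0 < p1" "p1 \<le> 1"
    and prob1: "\<And>v a. length v = 1 \<Longrightarrow> valid F (v @ [a]) \<Longrightarrow> prob {\<omega> \<in> space M. \<theta> 1 \<le> \<xi> (v @ [a]) \<omega>} \<ge> p1"
    and prob: "\<And>v a. 2 \<le> length v \<Longrightarrow> length v < J \<Longrightarrow> valid F (v @ [a]) \<Longrightarrow> prob {\<omega> \<in> space M. \<theta> (length v) \<le> \<xi> (v @ [a]) \<omega>} \<ge> p"
    and m: "real m \<le> p1 / 8 * B * (p * B / 2) ^ (J - 2)" and a: "a \<in> F 0"
  shows "prob {\<omega> \<in> space M. m \<le> ns (J - 1) [a] \<omega>} \<ge> p1 / 8"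
proof -
  \<comment> \<open>Solves \<open>p * (q (Suc k) * B / 2) = q k\<close> with q 2 = 1 / B.\<close>
  define q where "q = (\<lambda>k. (2 / (p * B)) ^ (k - 2) / B)"
  have "p * B \<le> 1 * B \<or> B < 0" using mult_right_mono[OF p(2), of B] by linarith
  moreover have "\<not> B < 0" using p mult_pos_neg[of p B] by auto
  ultimately have B2: "B \<ge> 2" using p by auto
  have qpos: "q k > 0" for k using B2 p by (simp add: q_def)
  have r: "0 \<le> 2 / (p * B)" "2 / (p * B) \<le> 1" using p B2 by auto
  have qB: "q k * B \<le> 1" for k using B2 r by (simp add: q_def power_le_one)
  have q1: "q k \<le> 1 / B" for k using qB[of k] B2 by (simp add: pos_le_divide_eq)
  have qh: "q k \<le> 1 / 2" for k using q1[of k] B2 frac_le[of 1 1 2 B] by linarith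
  have qrec: "p * (q (Suc k) * B / 2) = q k" if "k \<ge> 2" for k
  proof -
    obtain j where "k = 2 + j" using \<open>k \<ge> 2\<close> le_Suc_ex by blast
    hence "q (Suc k) = q k * (2 / (p * B))" by (simp add: q_def mult.commute)
    thus ?thesis using p B2 by simp
  qed
  \<comment> \<open>The factor 2 makes up for the half lost in 1 - exp (- x) \<ge> x / 2 at the
    leaves.\<close>
  define lam where "lam = 2 * q J"
  have lam: "lam \<ge> 0" using qpos[of J] by (simp add: lam_def)
  have main: "expectation (\<lambda>\<omega>. exp (- lam * real (ns d v \<omega>))) \<le> 1 - q (length v)"
    if "valid F v" "length v + d = J" "2 \<le> length v" for d v
    using that
  proof (induction d arbitrary: v)
    case 0
    have "exp (- (2 * q J)) \<le> 1 - 2 * q J / 2" using qpos[of J] qh[of J] by (intro exp_neg_le_half) auto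
    thus ?case using 0 by (simp add: lam_def prob_space)
  next
    case (Suc d)
    have k: "length v < J" "1 \<le> length v" using Suc.prems by auto
    let ?u = "1 - q (Suc (length v))"
    have b0: "card (F (length v)) > 0" using B[OF k(2,1)] B2 by (intro Nat.gr0I) auto
    have "expectation (\<lambda>\<omega>. exp (- lam * real (ns (Suc d) v \<omega>))) \<le> 1 - p * (1 - ?u ^ card (F (length v)))"
    proof (rule laplace_step[OF _ _ refl b0])
      show "0 \<le> ?u" "?u \<le> 1" using qpos qh[of "Suc (length v)"] less_imp_le by auto
      fix a assume a: "a \<in> F (length v)"
      hence va: "valid F (v @ [a])" using Suc.prems by (simp add: valid_snoc)
      show "p \<le> prob {\<omega> \<in> space M. \<theta> (length v) \<le> \<xi> (v @ [a]) \<omega>}" using prob Suc.prems k va by simp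
      show "expectation (\<lambda>\<omega>. exp (- lam * real (ns d (v @ [a]) \<omega>))) \<le> ?u"
        using Suc.IH[OF va] Suc.prems by simp
    qed (use Suc.prems lam in auto)
    also have "\<dots> \<le> 1 - p * (q (Suc (length v)) * B / 2)"
    proof (intro diff_left_mono mult_left_mono)
      have "?u ^ card (F (length v)) \<le> exp (- (q (Suc (length v)) * B))"
        using qpos[of "Suc (length v)"] qh[of "Suc (length v)"] B[OF k(2,1)] qB by (intro one_minus_power_le) auto
      also have "\<dots> \<le> 1 - q (Suc (length v)) * B / 2"
        using qpos[of "Suc (length v)"] B2 qB by (intro exp_neg_le_half) auto
      finally show "q (Suc (length v)) * B / 2 \<le> 1 - ?u ^ card (F (length v))" by simp
    qed (use p in auto)
    finally show ?case using qrec Suc.prems by simp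
  qed
  have len: "valid F [a]" using a valid_snoc[of F "[]" a] by simp
  have J1: "1 + Suc (J - 2) = J" using J by simp
  have b0: "card (F (length [a])) > 0" using B[of 1] J B2 by (intro Nat.gr0I) auto
  have "expectation (\<lambda>\<omega>. exp (- lam * real (ns (Suc (J - 2)) [a] \<omega>))) \<le> 1 - p1 * (1 - (1 - q 2) ^ card (F (length [a])))"
  proof (rule laplace_step[OF len _ refl b0])
    show "length [a] + Suc (J - 2) \<le> J" using J by simp
    show "0 \<le> 1 - q 2" "1 - q 2 \<le> 1" using qpos[of 2] qh[of 2] by auto
    fix a' assume a': "a' \<in> F (length [a])"
    hence va: "valid F ([a] @ [a'])" using len by (simp only: valid_snoc)
    show "p1 \<le> prob {\<omega> \<in> space M. \<theta> (length [a]) \<le> \<xi> ([a] @ [a']) \<omega>}" using prob1[OF _ va] by simp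
    show "expectation (\<lambda>\<omega>. exp (- lam * real (ns (J - 2) ([a] @ [a']) \<omega>))) \<le> 1 - q 2"
      using main[OF va, of "J - 2"] J by (simp add: numeral_2_eq_2)
  qed (use lam in auto)
  also have "\<dots> \<le> 1 - p1 * (1 / 2)"
  proof (intro diff_left_mono mult_left_mono)
    have "(1 - q 2) ^ card (F (length [a])) \<le> exp (- (q 2 * B))"
      using qpos[of 2] qh[of 2] qB B[of 1] J by (intro one_minus_power_le) auto
    also have "\<dots> \<le> 1 - q 2 * B / 2" using qpos[of 2] B2 qB by (intro exp_neg_le_half) auto
    also have "\<dots> = 1 / 2" using B2 by (simp add: q_def)
    finally show "1 / 2 \<le> 1 - (1 - q 2) ^ card (F (length [a]))" by simp
  qed (use p1 in auto)
  finally have E: "expectation (\<lambda>\<omega>. exp (- lam * real (ns (J - 1) [a] \<omega>))) \<le> 1 - p1 / 2"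
    using J by (simp add: Suc_diff_Suc numeral_2_eq_2)
  have lm: "lam * real m \<le> p1 / 4"
  proof -
    have "lam * real m \<le> lam * (p1 / 8 * B * (p * B / 2) ^ (J - 2))" using m lam by (rule mult_left_mono)
    also have "\<dots> = p1 / 4 * ((2 / (p * B)) ^ (J - 2) * (p * B / 2) ^ (J - 2))"
      using B2 by (simp add: lam_def q_def)
    also have "(2 / (p * B)) ^ (J - 2) * (p * B / 2) ^ (J - 2) = 1"
      using B2 p by (simp add: power_mult_distrib[symmetric])
    finally show ?thesis by simp
  qed
  have [measurable]: "{\<omega> \<in> space M. m \<le> ns (J - 1) [a] \<omega>} \<in> sets M" by measurable
  have i: "integrable M (\<lambda>\<omega>. exp (lam * real m) * exp (- lam * real (ns (J - 1) [a] \<omega>)))"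
    using lam by (intro integrable_mult_right integrable_bounded[where B = 1]) auto
  have "1 - prob {\<omega> \<in> space M. m \<le> ns (J - 1) [a] \<omega>} = expectation (\<lambda>\<omega>. 1 - indicator {\<omega> \<in> space M. m \<le> ns (J - 1) [a] \<omega>} \<omega>)"
    by (subst Bochner_Integration.integral_diff) (auto simp: prob_space intro!: integrable_bounded[where B = 1] simp: indicator_def)
  also have "\<dots> \<le> expectation (\<lambda>\<omega>. exp (lam * real m) * exp (- lam * real (ns (J - 1) [a] \<omega>)))"
  proof (rule integral_mono)
    show "integrable M (\<lambda>\<omega>. 1 - indicator {\<omega> \<in> space M. m \<le> ns (J - 1) [a] \<omega>} \<omega> :: real)"
      by (intro integrable_bounded[where B = 1]) (auto simp: indicator_def)
    fix \<omega> assume "\<omega> \<in> space M"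
    show "1 - indicator {\<omega> \<in> space M. m \<le> ns (J - 1) [a] \<omega>} \<omega> \<le> exp (lam * real m) * exp (- lam * real (ns (J - 1) [a] \<omega>))"
    proof (cases "m \<le> ns (J - 1) [a] \<omega>")
      case False
      hence "lam * real (ns (J - 1) [a] \<omega>) \<le> lam * real m" using lam by (intro mult_left_mono) auto
      thus ?thesis using False by (simp add: indicator_def exp_add[symmetric])
    qed (use \<open>\<omega> \<in> space M\<close> in auto)
  qed (rule i)
  also have "\<dots> = exp (lam * real m) * expectation (\<lambda>\<omega>. exp (- lam * real (ns (J - 1) [a] \<omega>)))" by simp
  \<comment> \<open>Since \<open>m\<close> is chosen with \<open>lam * m \<le> p1 / 4\<close>, the
    Markov factor eats only half of the gain p1 / 2.\<close>
  also have "\<dots> \<le> exp (p1 / 4) * (1 - p1 / 2)"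
    using lm E p1 by (intro mult_mono) (auto intro!: integral_nonneg_AE)
  also have "\<dots> \<le> exp (p1 / 4) * exp (- (p1 / 2))"
    using exp_ge_add_one_self[of "- (p1 / 2)"] by (intro mult_left_mono) auto
  also have "\<dots> = exp (- (p1 / 4))" by (simp add: exp_add[symmetric])
  also have "\<dots> \<le> 1 - p1 / 4 / 2" using p1 by (intro exp_neg_le_half) auto
  finally show ?thesis by simp
qed

end

section \<open>The Gaussian field and its linear functionals\<close>

text \<open>To the right of z the density is at most exp (- z^2 / 2) times the density shifted by z,
  because z (x - z) is nonnegative there; the shifted density has mass 1.\<close>

lemma (in prob_space) std_normal_tail_ge:
  assumes Z: "distributed M lborel Z std_normal_density" and z: "z \<ge> 0"
  shows "prob {\<omega> \<in> space M. z \<le> Z \<omega>} \<le> exp (- z\<^sup>2 / 2)"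
proof -
  have [measurable]: "Z \<in> borel_measurable M" using Z by (auto simp: distributed_def)
  have "emeasure M (Z -` {z..} \<inter> space M) = (\<integral>\<^sup>+x. ennreal (std_normal_density x) * indicator {z..} x \<partial>lborel)"
    using Z by (intro distributed_emeasure) auto
  also have "\<dots> \<le> (\<integral>\<^sup>+x. ennreal (exp (- z\<^sup>2 / 2)) * ennreal (normal_density z 1 x) \<partial>lborel)"
  proof (intro nn_integral_mono)
    fix x :: real
    show "ennreal (std_normal_density x) * indicator {z..} x \<le> ennreal (exp (- z\<^sup>2 / 2)) * ennreal (normal_density z 1 x)"
    proof (cases "z \<le> x")
      case True
      have "0 \<le> z * (x - z)" using True z by simp
      hence "- x\<^sup>2 / 2 \<le> - z\<^sup>2 / 2 + - (x - z)\<^sup>2 / 2" by (simp add: power2_eq_square algebra_simps)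
      hence "exp (- x\<^sup>2 / 2) \<le> exp (- z\<^sup>2 / 2) * exp (- (x - z)\<^sup>2 / 2)" by (simp only: exp_add[symmetric] exp_le_cancel_iff)
      hence "std_normal_density x \<le> exp (- z\<^sup>2 / 2) * normal_density z 1 x"
        by (simp add: normal_density_def divide_right_mono)
      thus ?thesis using True by (simp add: ennreal_mult[symmetric] ennreal_leI)
    qed simp
  qed
  also have "\<dots> = ennreal (exp (- z\<^sup>2 / 2)) * (\<integral>\<^sup>+x. ennreal (normal_density z 1 x) \<partial>lborel)"
    by (rule nn_integral_cmult) simp
  also have "(\<integral>\<^sup>+x. ennreal (normal_density z 1 x) \<partial>lborel) = 1"
    by (subst nn_integral_eq_integral) auto
  finally have "emeasure M (Z -` {z..} \<inter> space M) \<le> ennreal (exp (- z\<^sup>2 / 2))" by simp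
  moreover have "Z -` {z..} \<inter> space M = {\<omega> \<in> space M. z \<le> Z \<omega>}" by auto
  ultimately show ?thesis by (simp add: emeasure_eq_measure)
qed

text \<open>Only the mass of [z, z + 1] is kept. The shift from z to z + 1 in the exponent is
  harmless on the scale of powers of N.\<close>

lemma (in prob_space) std_normal_lower_tail:
  assumes Z: "distributed M lborel Z std_normal_density" and z: "z \<ge> 0"
  shows "prob {\<omega> \<in> space M. z \<le> Z \<omega>} \<ge> exp (- (z + 1)\<^sup>2 / 2) / sqrt (2 * pi)"
proof -
  have [measurable]: "Z \<in> borel_measurable M" using Z by (auto simp: distributed_def)
  let ?c = "exp (- (z + 1)\<^sup>2 / 2) / sqrt (2 * pi)"
  have "ennreal ?c = (\<integral>\<^sup>+x. ennreal ?c * indicator {z..z + 1} x \<partial>lborel)"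
    by (subst nn_integral_cmult_indicator) auto
  also have "\<dots> \<le> (\<integral>\<^sup>+x. ennreal (std_normal_density x) * indicator {z..} x \<partial>lborel)"
  proof (intro nn_integral_mono)
    fix x :: real
    show "ennreal ?c * indicator {z..z + 1} x \<le> ennreal (std_normal_density x) * indicator {z..} x"
    proof (cases "x \<in> {z..z + 1}")
      case True
      hence "x\<^sup>2 \<le> (z + 1)\<^sup>2" using z by (intro power_mono) auto
      hence "?c \<le> std_normal_density x" by (simp add: normal_density_def divide_right_mono)
      thus ?thesis using True by (simp add: ennreal_leI)
    qed simp
  qed
  also have "\<dots> = emeasure M (Z -` {z..} \<inter> space M)"
    using Z by (intro distributed_emeasure[symmetric]) auto
  also have "Z -` {z..} \<inter> space M = {\<omega> \<in> space M. z \<le> Z \<omega>}" by auto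
  finally show ?thesis by (simp add: emeasure_eq_measure)
qed

section \<open>The field as an isometry from energy to variance\<close>

locale gff_field =
  fixes M :: "'a measure" and N :: nat and Phi :: "pt \<Rightarrow> 'a \<Rightarrow> real"
  assumes is_gff: "is_GFF M N Phi"

sublocale gff_field \<subseteq> prob_space M
  using is_gff by (simp add: is_GFF_def)

lemma finite_intr [simp]: "finite (intr N)"
  by (simp add: intr_def box_def)

context gff_field
begin

lemma Phi_meas [measurable]: "Phi x \<in> borel_measurable M"
  using is_gff by (simp add: is_GFF_def del: split_paired_All)

text \<open>As \<open>lap\<close> inverts the covariance, weighting the field by
  \<open>lap u\<close> makes the variance of \<open>Y u\<close> the energy of \<open>u\<close>, and
  \<open>gr (intr N) x\<close> corresponds to \<open>Phi x\<close>.\<close>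

definition Y :: "(pt \<Rightarrow> real) \<Rightarrow> 'a \<Rightarrow> real" where
  "Y u \<omega> = (\<Sum>x\<in>intr N. lap u x * Phi x \<omega>)"

lemma Y_meas [measurable]: "Y u \<in> borel_measurable M"
  unfolding Y_def by measurable

lemma Y_add: "Y (\<lambda>z. u z + v z) \<omega> = Y u \<omega> + Y v \<omega>"
  and Y_diff: "Y (\<lambda>z. u z - v z) \<omega> = Y u \<omega> - Y v \<omega>"
  and Y_cmult: "Y (\<lambda>z. c * u z) \<omega> = c * Y u \<omega>"
  by (simp_all add: Y_def lap_add lap_diff lap_cmult algebra_simps sum.distrib sum_subtractf sum_distrib_left)

lemma Y_sum: "Y (\<lambda>z. \<Sum>i\<in>I. c i * u i z) \<omega> = (\<Sum>i\<in>I. c i * Y (u i) \<omega>)"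
proof -
  have "Y (\<lambda>z. \<Sum>i\<in>I. c i * u i z) \<omega> = (\<Sum>x\<in>intr N. \<Sum>i\<in>I. c i * (lap (u i) x * Phi x \<omega>))"
    by (simp add: Y_def lap_sum lap_cmult sum_distrib_right mult.assoc)
  also have "\<dots> = (\<Sum>i\<in>I. \<Sum>x\<in>intr N. c i * (lap (u i) x * Phi x \<omega>))" by (rule sum.swap)
  finally show ?thesis by (simp add: Y_def sum_distrib_left)
qed

lemma Y_gr: "x \<in> intr N \<Longrightarrow> Y (gr (intr N) x) \<omega> = Phi x \<omega>"
proof -
  assume x: "x \<in> intr N"
  have "Y (gr (intr N) x) \<omega> = (\<Sum>y\<in>intr N. if x = y then Phi x \<omega> else 0)"
    unfolding Y_def by (intro sum.cong refl) (auto simp: lap_gr)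
  thus ?thesis using x by simp
qed

abbreviation V :: "(pt \<Rightarrow> real) \<Rightarrow> real" where "V u \<equiv> En (intr N) u u"

lemma covariance_sum:
  assumes "supp_in (intr N) u"
  shows "(\<Sum>x\<in>intr N. \<Sum>y\<in>intr N. lap u x * lap u y * green N x y) = V u"
proof -
  have "(\<Sum>x\<in>intr N. \<Sum>y\<in>intr N. lap u x * lap u y * green N x y)
     = (\<Sum>x\<in>intr N. lap u x * (\<Sum>y\<in>intr N. gr (intr N) x y * lap u y))"
    by (intro sum.cong refl) (simp add: sum_distrib_left gr_eq_green mult_ac)
  also have "\<dots> = (\<Sum>x\<in>intr N. lap u x * u x)"
    by (intro sum.cong refl arg_cong2[where f = "(*)"] gr_repr[symmetric] assms finite_intr)
  finally show ?thesis by (simp add: En_def mult.commute)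
qed

text \<open>\<open>is_GFF\<close> prescribes a law only for positive variance. In the degenerate
  case definiteness of the energy gives u = 0, so the functional vanishes identically.\<close>

lemma Y_zero:
  assumes "supp_in (intr N) u" "V u = 0"
  shows "Y u \<omega> = 0"
proof -
  have "u = (\<lambda>_. 0)" using En_zero_imp[OF finite_intr assms] by auto
  thus ?thesis by (simp add: Y_def lap_def)
qed

lemma Y_std:
  assumes u: "supp_in (intr N) u" "V u > 0"
  shows "distributed M lborel (\<lambda>\<omega>. Y u \<omega> / sqrt (V u)) std_normal_density"
proof -
  have "distributed M lborel (Y u) (normal_density 0 (sqrt (V u)))"
    using is_gff u(2) covariance_sum[OF u(1)] unfolding is_GFF_def Y_def[abs_def]
    by (auto simp: Let_def dest!: spec[of _ "lap u"])
  thus ?thesis using normal_standard_normal_convert[of "sqrt (V u)" "Y u" 0] u(2) by simp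
qed

lemma Y_char:
  assumes u: "supp_in (intr N) u"
  shows "(CLINT \<omega>|M. iexp (Y u \<omega>)) = complex_of_real (exp (- V u / 2))"
proof (cases "V u = 0")
  case True
  thus ?thesis using Y_zero[OF u] by (simp add: prob_space)
next
  case False
  hence V: "V u > 0" using En_nonneg[OF finite_intr u] by simp
  let ?Z = "\<lambda>\<omega>. Y u \<omega> / sqrt (V u)"
  have "(CLINT \<omega>|M. iexp (Y u \<omega>)) = (CLINT \<omega>|M. iexp (sqrt (V u) * ?Z \<omega>))"
    using V by simp
  also have "\<dots> = (CLINT x|distr M lborel ?Z. iexp (sqrt (V u) * x))"
    by (subst integral_distr) auto
  also have "distr M lborel ?Z = std_normal_distribution"
    by (rule distributed_distr_eq_density[OF Y_std[OF u V]])
  also have "(CLINT x|std_normal_distribution. iexp (sqrt (V u) * x)) = char std_normal_distribution (sqrt (V u))"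
    by (simp add: char_def)
  also have "\<dots> = complex_of_real (exp (- V u / 2))"
    using V by (simp add: char_std_normal_distribution)
  finally show ?thesis .
qed

lemma Y_tail:
  assumes u: "supp_in (intr N) u" and W: "V u \<le> W" "W > 0" and t: "t \<ge> 0"
  shows "prob {\<omega> \<in> space M. t \<le> Y u \<omega>} \<le> exp (- t\<^sup>2 / (2 * W))"
proof (cases "V u = 0")
  case True
  show ?thesis
  proof (cases "t = 0")
    case False
    thus ?thesis using t Y_zero[OF u True] by simp
  qed simp
next
  case False
  hence V: "V u > 0" using En_nonneg[OF finite_intr u] by simp
  have "{\<omega> \<in> space M. t \<le> Y u \<omega>} = {\<omega> \<in> space M. t / sqrt (V u) \<le> Y u \<omega> / sqrt (V u)}"
    using V by (auto simp: divide_le_cancel)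
  also have "prob \<dots> \<le> exp (- (t / sqrt (V u))\<^sup>2 / 2)"
    using t V by (intro std_normal_tail_ge Y_std u) auto
  also have "(t / sqrt (V u))\<^sup>2 = t\<^sup>2 / V u" using V by (simp add: power_divide)
  also have "exp (- (t\<^sup>2 / V u) / 2) \<le> exp (- t\<^sup>2 / (2 * W))"
  proof -
    have "t\<^sup>2 / W \<le> t\<^sup>2 / V u" using V W by (intro divide_left_mono) auto
    thus ?thesis by simp
  qed
  finally show ?thesis .
qed

lemma Y_tail_le:
  assumes u: "supp_in (intr N) u" and W: "V u \<le> W" "W > 0" and t: "t \<ge> 0"
  shows "prob {\<omega> \<in> space M. Y u \<omega> \<le> - t} \<le> exp (- t\<^sup>2 / (2 * W))"
proof -
  have "{\<omega> \<in> space M. Y u \<omega> \<le> - t} = {\<omega> \<in> space M. t \<le> Y (\<lambda>z. (- 1) * u z) \<omega>}"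
    unfolding Y_cmult by auto
  moreover have "prob {\<omega> \<in> space M. t \<le> Y (\<lambda>z. (- 1) * u z) \<omega>} \<le> exp (- t\<^sup>2 / (2 * W))"
  proof (rule Y_tail[OF _ _ W(2) t])
    show "V (\<lambda>z. (- 1) * u z) \<le> W" unfolding En_cmult_left En_cmult_right using W by simp
  qed (rule supp_in_intros(4)[OF u])
  ultimately show ?thesis by simp
qed

lemma Y_lower_tail:
  assumes u: "supp_in (intr N) u" and W: "W \<le> V u" "W > 0" and t: "t \<ge> 0"
  shows "prob {\<omega> \<in> space M. t \<le> Y u \<omega>} \<ge> exp (- (t / sqrt W + 1)\<^sup>2 / 2) / sqrt (2 * pi)"
proof -
  have V: "V u > 0" using W by simp
  have "t / sqrt (V u) \<le> t / sqrt W" using W t by (intro divide_left_mono) auto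
  hence "(t / sqrt (V u) + 1)\<^sup>2 \<le> (t / sqrt W + 1)\<^sup>2" using t V by (intro power_mono) auto
  hence "exp (- (t / sqrt W + 1)\<^sup>2 / 2) / sqrt (2 * pi) \<le> exp (- (t / sqrt (V u) + 1)\<^sup>2 / 2) / sqrt (2 * pi)"
    by (intro divide_right_mono) auto
  also have "\<dots> \<le> prob {\<omega> \<in> space M. t / sqrt (V u) \<le> Y u \<omega> / sqrt (V u)}"
    using t V by (intro std_normal_lower_tail Y_std u) auto
  also have "{\<omega> \<in> space M. t / sqrt (V u) \<le> Y u \<omega> / sqrt (V u)} = {\<omega> \<in> space M. t \<le> Y u \<omega>}"
    using V by (auto simp: divide_le_cancel)
  finally show ?thesis .
qed

text \<open>Linear combinations of the functionals are again of the form \<open>Y u\<close>. For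
  orthogonal families the energies add, so the joint characteristic function factorises.\<close>

lemma Y_indep:
  fixes u :: "'i \<Rightarrow> pt \<Rightarrow> real"
  assumes fin: "finite S" "finite T" and supp: "\<And>i. i \<in> S \<union> T \<Longrightarrow> supp_in (intr N) (u i)"
    and orth: "\<And>i j. i \<in> S \<Longrightarrow> j \<in> T \<Longrightarrow> En (intr N) (u i) (u j) = 0"
  shows "indep_var (PiM S (\<lambda>_. borel)) (\<lambda>\<omega>. \<lambda>i\<in>S. Y (u i) \<omega>) (PiM T (\<lambda>_. borel)) (\<lambda>\<omega>. \<lambda>i\<in>T. Y (u i) \<omega>)"
proof (rule indep_var_PiM_of_char[OF fin])
  fix t s :: "'i \<Rightarrow> real"
  define a where "a = (\<lambda>z. \<Sum>i\<in>S. t i * u i z)"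
  define b where "b = (\<lambda>z. \<Sum>i\<in>T. s i * u i z)"
  have sa: "supp_in (intr N) a" "supp_in (intr N) b"
    unfolding a_def b_def using supp by (intro supp_in_intros; simp)+
  have ab: "En (intr N) a b = 0"
    unfolding a_def b_def En_sum_left En_sum_right En_cmult_left En_cmult_right using orth by simp
  hence ba: "En (intr N) b a = 0" using En_commute[OF finite_intr sa] by simp
  have Vab: "V (\<lambda>z. a z + b z) = V a + V b"
    by (simp add: En_add_left En_add_right ab ba)
  have Ya: "Y a \<omega> = (\<Sum>i\<in>S. t i * Y (u i) \<omega>)" and Yb: "Y b \<omega> = (\<Sum>i\<in>T. s i * Y (u i) \<omega>)" for \<omega>
    unfolding a_def b_def by (rule Y_sum)+
  have "(CLINT \<omega>|M. iexp (Y a \<omega>) * iexp (Y b \<omega>)) = (CLINT \<omega>|M. iexp (Y (\<lambda>z. a z + b z) \<omega>))"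
    by (simp add: Y_add exp_add distrib_left)
  also have "\<dots> = complex_of_real (exp (- V a / 2)) * complex_of_real (exp (- V b / 2))"
    using sa by (subst Y_char) (auto simp: Vab exp_add[symmetric] add_divide_distrib simp flip: of_real_mult)
  also have "\<dots> = (CLINT \<omega>|M. iexp (Y a \<omega>)) * (CLINT \<omega>|M. iexp (Y b \<omega>))"
    using sa by (simp add: Y_char)
  finally show "(CLINT x|M. iexp (\<Sum>i\<in>S. t i * Y (u i) x) * iexp (\<Sum>j\<in>T. s j * Y (u j) x))
       = (CLINT x|M. iexp (\<Sum>i\<in>S. t i * Y (u i) x)) * (CLINT x|M. iexp (\<Sum>j\<in>T. s j * Y (u j) x))"
    unfolding Ya Yb .
qed auto

end

section \<open>Hierarchies of boxes\<close>

lemma list_comparison: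
  "(\<exists>w. t = s @ w) \<or> (\<exists>w. s = t @ w) \<or> (\<exists>v a b s' t'. a \<noteq> b \<and> s = (v @ [a]) @ s' \<and> t = (v @ [b]) @ t')"
proof (induction s arbitrary: t)
  case (Cons x s)
  show ?case
  proof (cases t)
    case (Cons y t')
    show ?thesis
    proof (cases "x = y")
      case True
      from Cons.IH[of t'] show ?thesis
      proof (elim disjE exE conjE)
        fix v a b u u' assume "a \<noteq> b" "s = (v @ [a]) @ u" "t' = (v @ [b]) @ u'"
        hence "a \<noteq> b \<and> x # s = ((x # v) @ [a]) @ u \<and> t = ((x # v) @ [b]) @ u'" using Cons True by simp
        thus ?thesis by blast
      qed (use Cons True in auto)
    next
      case False
      hence "x \<noteq> y \<and> x # s = ([] @ [x]) @ s \<and> t = ([] @ [y]) @ t'" using Cons by simp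
      thus ?thesis by blast
    qed
  qed auto
qed auto

lemma separated_mono: "separated A B \<Longrightarrow> A' \<subseteq> A \<Longrightarrow> B' \<subseteq> B \<Longrightarrow> separated A' B'"
  unfolding separated_def by blast

lemma separated_Qb:
  assumes "2 * int R \<le> \<bar>fst c - fst c'\<bar> \<or> 2 * int R \<le> \<bar>snd c - snd c'\<bar>"
  shows "separated (Qb c R) (Qb c' R)"
  unfolding separated_def
proof (intro conjI ballI)
  show "Qb c R \<inter> Qb c' R = {}" using assms by (auto simp: in_Qb)
  fix a assume "a \<in> Qb c R"
  hence "b \<notin> Qb c' R" if "b \<in> nbrs a" for b using that assms by (auto simp: in_Qb nbrs_def)
  thus "nbrs a \<inter> Qb c' R = {}" by blast
qed

text \<open>\<open>F k\<close> holds the displacements from the centre of a box at depth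
  \<open>k\<close> to the centres of its children, the same for all boxes of that depth. The root is
  the whole interior and not a \<open>Qb\<close>, hence its separate condition.\<close>

locale box_tree = gff_field M N Phi for M :: "'a measure" and N Phi +
  fixes c0 :: pt and r :: "nat \<Rightarrow> nat" and F :: "nat \<Rightarrow> pt set" and J :: nat
  assumes finF [simp]: "\<And>k. finite (F k)"
    and r_pos: "\<And>k. 1 \<le> k \<Longrightarrow> k \<le> J \<Longrightarrow> r k \<ge> 1"
    and F_sep: "\<And>k a b. k < J \<Longrightarrow> a \<in> F k \<Longrightarrow> b \<in> F k \<Longrightarrow> a \<noteq> b \<Longrightarrow>
       2 * int (r (Suc k)) \<le> \<bar>fst a - fst b\<bar> \<or> 2 * int (r (Suc k)) \<le> \<bar>snd a - snd b\<bar>"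
    and F_in: "\<And>k a. 1 \<le> k \<Longrightarrow> k < J \<Longrightarrow> a \<in> F k \<Longrightarrow>
       \<bar>fst a\<bar> + int (r (Suc k)) \<le> int (r k) \<and> \<bar>snd a\<bar> + int (r (Suc k)) \<le> int (r k)"
    and F_root: "\<And>a. a \<in> F 0 \<Longrightarrow> Qb (c0 + a) (r 1) \<subseteq> intr N"
begin

definition ctr :: "pt list \<Rightarrow> pt" where "ctr v = c0 + sum_list v"

definition dom :: "pt list \<Rightarrow> pt set" where
  "dom v = (if v = [] then intr N else Qb (ctr v) (r (length v)))"

lemma ctr_snoc: "ctr (v @ [a]) = ctr v + a"
  by (simp add: ctr_def add.assoc)

lemma finite_dom [simp]: "finite (dom v)"
  by (simp add: dom_def)

lemma dom_child:
  assumes "valid F (v @ [a])" "length v < J"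
  shows "dom (v @ [a]) \<subseteq> dom v"
proof (cases "v = []")
  case True
  have "a \<in> F 0" using assms(1) True unfolding valid_snoc by simp
  thus ?thesis using F_root[of a] True by (simp add: dom_def ctr_def)
next
  case False
  have a: "a \<in> F (length v)" using assms(1) unfolding valid_snoc by simp
  have "1 \<le> length v" using False by (cases v) auto
  from F_in[OF this assms(2) a] show ?thesis
    using False by (auto simp: dom_def in_Qb ctr_snoc)
qed

lemma dom_append: "valid F (v @ w) \<Longrightarrow> length (v @ w) \<le> J \<Longrightarrow> dom (v @ w) \<subseteq> dom v"
proof (induction w rule: rev_induct)
  case (snoc a w)
  have "dom ((v @ w) @ [a]) \<subseteq> dom (v @ w)" using snoc.prems by (intro dom_child) auto
  moreover have "valid F (v @ w)" using snoc.prems valid_append1[of F "v @ w" "[a]"] by simp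
  ultimately show ?case using snoc.IH snoc.prems by auto
qed simp

lemma dom_intr: "valid F v \<Longrightarrow> length v \<le> J \<Longrightarrow> dom v \<subseteq> intr N"
  using dom_append[of "[]" v] by (simp add: dom_def)

lemma ctr_in_dom: "v \<noteq> [] \<Longrightarrow> length v \<le> J \<Longrightarrow> ctr v \<in> dom v"
  using r_pos[of "length v"] by (cases v) (auto simp: dom_def in_Qb)

lemma separated_siblings:
  assumes "valid F (v @ [a])" "valid F (v @ [b])" "a \<noteq> b" "length v < J"
  shows "separated (dom (v @ [a])) (dom (v @ [b]))"
proof -
  have "a \<in> F (length v)" "b \<in> F (length v)" using assms by (simp_all only: valid_snoc)
  from F_sep[OF assms(4) this assms(3)] show ?thesis
    unfolding dom_def by (auto simp: ctr_snoc intro!: separated_Qb)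
qed

lemma separated_branches:
  assumes "valid F ((v @ [a]) @ s)" "valid F ((v @ [b]) @ t)" "a \<noteq> b"
    "length ((v @ [a]) @ s) \<le> J" "length ((v @ [b]) @ t) \<le> J"
  shows "separated (dom ((v @ [a]) @ s)) (dom ((v @ [b]) @ t))"
proof -
  have "separated (dom (v @ [a])) (dom (v @ [b]))"
    using assms(3,4) by (intro separated_siblings valid_append1[OF assms(1)] valid_append1[OF assms(2)]) auto
  thus ?thesis using dom_append[OF assms(1,4)] dom_append[OF assms(2,5)] by (rule separated_mono)
qed

text \<open>Two different nodes of the same depth branch at a common ancestor, so their domains are
  disjoint and each contains its own centre. Distinct surviving leaves therefore count as distinct
  lattice points.\<close>

lemma inj_ctr: "inj_on ctr {v. valid F v \<and> length v = k}" if "1 \<le> k" "k \<le> J"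
proof (rule inj_onI)
  fix s t assume st: "s \<in> {v. valid F v \<and> length v = k}" "t \<in> {v. valid F v \<and> length v = k}" "ctr s = ctr t"
  show "s = t"
    using list_comparison[of t s]
  proof (elim disjE exE conjE)
    fix v a b s' t' assume *: "a \<noteq> b" "s = (v @ [a]) @ s'" "t = (v @ [b]) @ t'"
    have "separated (dom s) (dom t)" unfolding *(2,3) using st that *(1) unfolding *(2,3)
      by (intro separated_branches) auto
    moreover have "s \<noteq> []" "t \<noteq> []" "length s \<le> J" "length t \<le> J" using st(1,2) that by auto
    hence "ctr s \<in> dom s \<and> ctr t \<in> dom t" by (blast intro: ctr_in_dom)
    ultimately show ?thesis using st(3) by (auto simp: separated_def)
  qed (use st in auto)
qed

lemma card_nodes: "finite {v. valid F v \<and> length v = k} \<and> card {v. valid F v \<and> length v = k} \<le> N\<^sup>2" if "1 \<le> k" "k \<le> J"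
proof -
  have sub: "ctr ` {v. valid F v \<and> length v = k} \<subseteq> intr N"
  proof (rule image_subsetI)
    fix v assume "v \<in> {v. valid F v \<and> length v = k}"
    hence v: "valid F v" "length v \<le> J" "v \<noteq> []" using that by auto
    show "ctr v \<in> intr N" using ctr_in_dom[OF v(3,2)] dom_intr[OF v(1,2)] by blast
  qed
  have "finite {v. valid F v \<and> length v = k}"
    using finite_subset[OF sub finite_intr] inj_ctr[OF that] by (rule finite_imageD)
  moreover have "card {v. valid F v \<and> length v = k} \<le> card (intr N)"
    by (rule card_inj_on_le[OF inj_ctr[OF that] sub finite_intr])
  moreover have "card (intr N) \<le> card (box N)" by (intro card_mono) (auto simp: intr_def box_def)
  moreover have "card (box N) = N\<^sup>2" by (simp add: box_def power2_eq_square)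
  ultimately show ?thesis by simp
qed

text \<open>For a domain D the function \<open>gr (intr N) x - gr D x\<close> represents, through
  \<open>Y\<close>, the harmonic extension of the field into D at \<open>x\<close>. Here the
  representer for the parent box is subtracted from the one for \<open>dom v\<close>; the result is
  supported in the parent box, and its \<open>lap\<close> vanishes inside
  \<open>dom v\<close>.\<close>

definition uxi :: "pt list \<Rightarrow> pt \<Rightarrow> real" where
  "uxi v = (\<lambda>z. gr (dom (butlast v)) (ctr v) z - gr (dom v) (ctr v) z)"

lemma gr_supp_intr: "valid F v \<Longrightarrow> length v \<le> J \<Longrightarrow> supp_in (intr N) (gr (dom v) x)"
  by (rule supp_in_mono[OF gr_supp(1) dom_intr])

lemma butlast_props: "valid F v \<Longrightarrow> v \<noteq> [] \<Longrightarrow> length v \<le> J \<Longrightarrow>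
    valid F (butlast v) \<and> length (butlast v) < J \<and> dom v \<subseteq> dom (butlast v)"
proof (cases v rule: rev_cases)
  case (snoc w a)
  assume "valid F v" "length v \<le> J"
  thus ?thesis using snoc dom_child[of w a] by (auto simp: valid_snoc)
qed auto

lemma uxi_supp:
  assumes "valid F v" "v \<noteq> []" "length v \<le> J"
  shows "supp_in (dom (butlast v)) (uxi v)" "supp_in (intr N) (uxi v)"
proof -
  note b = butlast_props[OF assms]
  show 1: "supp_in (dom (butlast v)) (uxi v)"
    unfolding uxi_def using b by (intro supp_in_intros gr_supp) (meson gr_supp supp_in_mono)
  show "supp_in (intr N) (uxi v)" using 1 b dom_intr[of "butlast v"] supp_in_mono by auto
qed

text \<open>\<open>f\<close> lives in a single child box of the parent of \<open>s\<close>. If that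
  box is \<open>dom s\<close>, both Green functions in \<open>uxi s\<close> reproduce
  \<open>f (ctr s)\<close> and cancel; if it is the box of a sibling, \<open>f (ctr s) = 0\<close>
  and the supports are separated.\<close>

lemma uxi_orth_aux:
  assumes s: "valid F s" "s \<noteq> []" "length s \<le> J"
    and w: "butlast s @ a # u = t" "valid F t" "length t \<le> J"
    and f: "supp_in (dom t) f"
  shows "En (intr N) f (uxi s) = 0"
proof -
  define v where "v = butlast s"
  define b where "b = last s"
  have sv: "s = v @ [b]" using s by (simp add: v_def b_def)
  have t: "t = (v @ [a]) @ u" using w by (simp add: v_def)
  have lv: "length v < J" using s sv by simp
  have va: "valid F (v @ [a])" "valid F v" using w(2) valid_append1[of F "v @ [a]" u] valid_append1[of F v "a # u"] unfolding t by auto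
  have tv: "dom t \<subseteq> dom (v @ [a])" "dom (v @ [a]) \<subseteq> dom v" "dom v \<subseteq> intr N"
    using dom_append[of "v @ [a]" u] w(2,3) t dom_child[OF va(1) lv] dom_intr[OF va(2)] lv by auto
  have 1: "En (intr N) f (gr (dom v) (ctr s)) = f (ctr s)"
    using tv by (intro En_gr supp_in_mono[OF f]) auto
  have cs: "ctr s \<in> dom s" using s by (intro ctr_in_dom) auto
  show ?thesis
  proof (cases "a = b")
    case True
    hence "En (intr N) f (gr (dom s) (ctr s)) = f (ctr s)"
      using tv sv by (intro En_gr supp_in_mono[OF f]) auto
    thus ?thesis using 1 by (simp add: uxi_def En_diff_right v_def)
  next
    case False
    have sep: "separated (dom (v @ [a])) (dom s)"
      using separated_siblings[OF va(1) _ False lv, of] s(1) sv by simp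
    hence "En (intr N) f (gr (dom s) (ctr s)) = 0"
      using tv by (intro En_separated[OF _ f gr_supp(1)]) (auto intro: separated_mono)
    moreover have "f (ctr s) = 0"
      using cs sep tv by (intro supp_inD[OF f]) (auto simp: separated_def)
    ultimately show ?thesis using 1 by (simp add: uxi_def En_diff_right v_def)
  qed
qed

text \<open>The parents are either nested, where the increment of the larger one is harmonic on the
  support of the other, or they branch, where the supports are separated.\<close>

lemma uxi_orth:
  assumes s: "valid F s" "s \<noteq> []" "length s \<le> J" and t: "valid F t" "t \<noteq> []" "length t \<le> J"
    and ne: "butlast s \<noteq> butlast t"
  shows "En (intr N) (uxi s) (uxi t) = 0"
proof -
  note bs = butlast_props[OF s] and bt = butlast_props[OF t]
  note us = uxi_supp[OF s] and ut = uxi_supp[OF t]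
  show ?thesis
    using list_comparison[of "butlast t" "butlast s"]
  proof (elim disjE exE conjE)
    fix w assume w: "butlast t = butlast s @ w"
    then obtain a u where "w = a # u" using ne by (cases w) auto
    hence "En (intr N) (uxi t) (uxi s) = 0"
      using w bt us ut by (intro uxi_orth_aux[OF s, of a u "butlast t"]) auto
    thus ?thesis using En_commute[OF finite_intr us(2) ut(2)] by simp
  next
    fix w assume w: "butlast s = butlast t @ w"
    then obtain a u where "w = a # u" using ne by (cases w) auto
    thus ?thesis
      using w bs us ut by (intro uxi_orth_aux[OF t, of a u "butlast s"]) auto
  next
    fix v a b s' t' assume *: "a \<noteq> b" "butlast s = (v @ [a]) @ s'" "butlast t = (v @ [b]) @ t'"
    have "separated (dom (butlast s)) (dom (butlast t))"
      unfolding *(2,3) using bs bt *(1) unfolding *(2,3) by (intro separated_branches) auto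
    thus ?thesis using us(1) ut(1) by (rule En_separated)
  qed
qed

lemma V_uxi:
  assumes "valid F v" "v \<noteq> []" "length v \<le> J"
  shows "V (uxi v) = gr (dom (butlast v)) (ctr v) (ctr v) - gr (dom v) (ctr v) (ctr v)"
proof -
  note b = butlast_props[OF assms]
  have "dom (butlast v) \<subseteq> intr N" "dom v \<subseteq> intr N" using b dom_intr[of v] dom_intr[of "butlast v"] assms by auto
  thus ?thesis
    unfolding uxi_def En_diff_left En_diff_right using b by (simp add: En_gr_gr_subset)
qed

text \<open>The centre of each of the two boxes lies outside the other box, so of the four pairings
  only the Green function of the whole interior remains.\<close>

lemma En_uxi_root:
  assumes "a \<in> F 0" "b \<in> F 0" "a \<noteq> b" "J \<ge> 1"
  shows "En (intr N) (uxi [a]) (uxi [b]) = gr (intr N) (ctr [a]) (ctr [b])"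
proof -
  have va: "valid F [a]" "valid F [b]" using assms valid_snoc[of F "[]"] by auto
  have sub: "dom [a] \<subseteq> intr N" "dom [b] \<subseteq> intr N" using dom_intr[OF va(1)] dom_intr[OF va(2)] assms(4) by simp_all
  have sep: "separated (dom [a]) (dom [b])" using separated_siblings[of "[]" a b] va assms by simp
  have "ctr [a] \<in> dom [a]" "ctr [b] \<in> dom [b]" using assms(4) by (auto intro!: ctr_in_dom)
  hence "ctr [b] \<notin> dom [a]" "ctr [a] \<notin> dom [b]" using sep by (auto simp: separated_def)
  hence z: "gr (dom [a]) (ctr [a]) (ctr [b]) = 0" "gr (dom [b]) (ctr [b]) (ctr [a]) = 0"
    by (auto simp: gr_def)
  have "En (intr N) (gr (dom [a]) (ctr [a])) (gr (dom [b]) (ctr [b])) = 0"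
    by (rule En_separated[OF sep gr_supp(1) gr_supp(1)])
  moreover have "dom [] = intr N" by (simp add: dom_def)
  ultimately show ?thesis
    using sub z by (simp add: uxi_def En_diff_left En_diff_right En_gr_gr_subset)
qed

text \<open>Represents the harmonic extension of the field into \<open>dom v\<close>, evaluated at
  the centre of that box.\<close>

definition hP :: "pt list \<Rightarrow> pt \<Rightarrow> real" where
  "hP v = (\<lambda>z. gr (intr N) (ctr v) z - gr (dom v) (ctr v) z)"

text \<open>Represents the change of the harmonic extension into \<open>dom v\<close> when the
  evaluation point moves from the centre of \<open>v\<close> to the centre of a child. It is the
  only error when the field at a centre is written as a sum of increments along the path.\<close>

definition du :: "pt list \<Rightarrow> pt \<Rightarrow> pt \<Rightarrow> real" where
  "du v a = (\<lambda>z. (gr (intr N) (ctr (v @ [a])) z - gr (dom v) (ctr (v @ [a])) z) - hP v z)"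

lemma Y_zero_fun [simp]: "Y (\<lambda>z. 0) \<omega> = 0"
  by (simp add: Y_def lap_def)

lemma Y_hP_snoc: "Y (hP (v @ [a])) \<omega> = Y (hP v) \<omega> + Y (uxi (v @ [a])) \<omega> + Y (du v a) \<omega>"
  by (simp add: hP_def du_def uxi_def Y_diff)

lemma Y_hP_Nil: "Y (hP []) \<omega> = 0"
  by (simp add: hP_def dom_def)

lemma Y_du_Nil: "Y (du [] a) \<omega> = 0"
  by (simp add: hP_def dom_def du_def)

lemma du_supp: "valid F v \<Longrightarrow> length v \<le> J \<Longrightarrow> supp_in (intr N) (du v a)"
  unfolding du_def hP_def by (intro supp_in_intros gr_supp gr_supp_intr)

lemma V_du:
  fixes v a
  defines "\<Delta> \<equiv> \<lambda>x y. gr (intr N) x y - gr (dom v) x y"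
  assumes v: "valid F v" "length v \<le> J"
  shows "V (du v a) = \<Delta> (ctr (v @ [a])) (ctr (v @ [a])) + \<Delta> (ctr v) (ctr v) - 2 * \<Delta> (ctr (v @ [a])) (ctr v)"
proof -
  have sub: "dom v \<subseteq> intr N" by (rule dom_intr[OF v])
  define g where "g = (\<lambda>x z. gr (intr N) x z - gr (dom v) x z)"
  have e: "En (intr N) (g x) (g y) = \<Delta> x y" for x y
    unfolding g_def En_diff_left En_diff_right \<Delta>_def
    using sub gr_sym[of "intr N" x y] gr_sym[of "dom v" x y] by (simp add: En_gr_gr_subset)
  have s: "\<Delta> (ctr v) (ctr (v @ [a])) = \<Delta> (ctr (v @ [a])) (ctr v)"
    by (simp add: \<Delta>_def gr_sym)
  have "du v a = (\<lambda>z. g (ctr (v @ [a])) z - g (ctr v) z)"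
    by (simp add: du_def hP_def g_def)
  thus ?thesis by (simp add: En_diff_left En_diff_right e s)
qed

abbreviation "xi v \<omega> \<equiv> Y (uxi v) \<omega>"

lemma tree: "tree_field M F J (\<lambda>v \<omega>. xi v \<omega>)"
proof (unfold_locales)
  show "\<And>S T. finite S \<Longrightarrow> finite T \<Longrightarrow>
           (\<And>v. v \<in> S \<union> T \<Longrightarrow> valid F v \<and> v \<noteq> [] \<and> length v \<le> J) \<Longrightarrow>
           (\<And>s t. s \<in> S \<Longrightarrow> t \<in> T \<Longrightarrow> butlast s \<noteq> butlast t) \<Longrightarrow>
           indep_var (Pi\<^sub>M S (\<lambda>_. borel)) (\<lambda>\<omega>. \<lambda>v\<in>S. xi v \<omega>) (Pi\<^sub>M T (\<lambda>_. borel)) (\<lambda>\<omega>. \<lambda>v\<in>T. xi v \<omega>)"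
    by (rule Y_indep) (auto intro!: uxi_supp uxi_orth)
qed auto

lemma surviving_leaf_bound:
  assumes err: "\<And>v a. valid F (v @ [a]) \<Longrightarrow> length v < J \<Longrightarrow> - e \<le> Y (du v a) \<omega>"
  shows "valid F v \<Longrightarrow> length v + d \<le> J \<Longrightarrow> w \<in> surv F \<theta> d (\<lambda>v. xi v \<omega>) v \<Longrightarrow>
    Y (hP w) \<omega> \<ge> Y (hP v) \<omega> + (\<Sum>k\<in>{length v..<length v + d}. \<theta> k) - real d * e"
proof (induction d arbitrary: v)
  case (Suc d)
  then obtain a where a: "a \<in> F (length v)" "\<theta> (length v) \<le> xi (v @ [a]) \<omega>" "w \<in> surv F \<theta> d (\<lambda>v. xi v \<omega>) (v @ [a])"
    by (auto split: if_splits)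
  have va: "valid F (v @ [a])" using a Suc.prems unfolding valid_snoc by simp
  have "Y (hP (v @ [a])) \<omega> \<ge> Y (hP v) \<omega> + \<theta> (length v) - e"
    unfolding Y_hP_snoc using a(2) err[OF va] Suc.prems(2) by simp
  moreover have "Y (hP w) \<omega> \<ge> Y (hP (v @ [a])) \<omega> + (\<Sum>k\<in>{length (v @ [a])..<length (v @ [a]) + d}. \<theta> k) - real d * e"
    using Suc.prems by (intro Suc.IH va a) auto
  moreover have "(\<Sum>k\<in>{length v..<length v + Suc d}. \<theta> k) = \<theta> (length v) + (\<Sum>k\<in>{length (v @ [a])..<length (v @ [a]) + d}. \<theta> k)"
    by (subst sum.atLeast_Suc_lessThan) auto
  ultimately show ?case by (simp add: algebra_simps)
qed auto

text \<open>Three kinds of bad events: all successful level one boxes have a root increment below -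
  \<tau>, some displacement error is at most - e, some leaf has a local field at most - e. Outside
  them one successful box with a tolerable root increment carries all its surviving leaves above
  height T. The last two kinds cost a union bound over at most (J + 1) N^2 nodes.\<close>

lemma few_thick_points_bound:
  assumes J: "J = Suc d" and T: "T \<le> (\<Sum>k\<in>{1..<J}. \<theta> k) - \<tau> - (real J + 1) * e" and e: "e \<ge> 0"
    and succ: "\<And>a. a \<in> F 0 \<Longrightarrow> prob {\<omega> \<in> space M. m \<le> nsurv F \<theta> d (\<lambda>v. xi v \<omega>) [a]} \<ge> s" and s: "s \<ge> 0"
    and \<kappa>: "\<kappa> \<ge> 0"
    and neg: "\<And>A. A \<subseteq> F 0 \<Longrightarrow> prob {\<omega> \<in> space M. \<forall>a\<in>A. xi [a] \<omega> < - \<tau>} \<le> exp (- \<kappa> * real (card A))"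
    and W: "W > 0" "\<And>v a. valid F (v @ [a]) \<Longrightarrow> 1 \<le> length v \<Longrightarrow> length v < J \<Longrightarrow> V (du v a) \<le> W"
      "\<And>v. valid F v \<Longrightarrow> length v = J \<Longrightarrow> gr (dom v) (ctr v) (ctr v) \<le> W"
    and S: "finite S" "\<And>a. a \<in> F 0 \<Longrightarrow> Qb (c0 + a) (r 1) \<subseteq> S"
    and A: "\<And>\<omega>. \<omega> \<in> A \<Longrightarrow> \<omega> \<in> space M \<and> card {x \<in> S. Phi x \<omega> \<ge> T} < m"
  shows "prob A \<le> exp (- real (card (F 0)) * s * (1 - exp (- \<kappa>))) + (real J + 1) * (real N)\<^sup>2 * exp (- e\<^sup>2 / (2 * W))"
proof -
  interpret tree_field M F J "\<lambda>v \<omega>. xi v \<omega>" \<theta> by (rule tree)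
  define L where "L = {v. valid F v \<and> length v = J}"
  \<comment> \<open>Depth 1 is left out: the harmonic extension into the whole interior is zero, so
    there is no displacement error at the root.\<close>
  define L' where "L' = (\<Union>k\<in>{2..J}. {v. valid F v \<and> length v = k})"
  have fL: "finite L" "card L \<le> N\<^sup>2" using card_nodes[of J] J by (auto simp: L_def)
  have fL': "finite L'" unfolding L'_def using card_nodes by (intro finite_UN_I) auto
  have cL': "card L' \<le> J * N\<^sup>2"
  proof -
    have "card L' \<le> (\<Sum>k\<in>{2..J}. card {v. valid F v \<and> length v = k})" unfolding L'_def by (rule card_UN_le) simp
    also have "\<dots> \<le> (\<Sum>k\<in>{2..J}. N\<^sup>2)" using card_nodes by (intro sum_mono) auto
    also have "\<dots> \<le> J * N\<^sup>2" by simp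
    finally show ?thesis .
  qed
  define E0 where "E0 = {\<omega> \<in> space M. \<forall>a\<in>F 0. m \<le> ns d [a] \<omega> \<longrightarrow> xi [a] \<omega> < - \<tau>}"
  define E1 where "E1 = (\<lambda>v. {\<omega> \<in> space M. Y (du (butlast v) (last v)) \<omega> \<le> - e})"
  define E2 where "E2 = (\<lambda>v. {\<omega> \<in> space M. Y (gr (dom v) (ctr v)) \<omega> \<le> - e})"
  have [measurable]: "E0 \<in> sets M" "E1 v \<in> sets M" "E2 v \<in> sets M" for v
    unfolding E0_def E1_def E2_def by measurable
  have p0: "prob E0 \<le> exp (- real (card (F 0)) * s * (1 - exp (- \<kappa>)))"
    unfolding E0_def using J succ s \<kappa> neg by (intro root_failure_bound) auto
  have p1: "prob (E1 v) \<le> exp (- e\<^sup>2 / (2 * W))" if "v \<in> L'" for v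
  proof -
    have v: "valid F v" "2 \<le> length v" "length v \<le> J" using that by (auto simp: L'_def)
    obtain w a where wa: "v = w @ [a]" using v(2) by (cases v rule: rev_cases) auto
    have vw: "valid F w" using v wa by (simp add: valid_snoc)
    have "V (du w a) \<le> W" using v wa by (intro W(2)) auto
    hence "prob {\<omega> \<in> space M. Y (du w a) \<omega> \<le> - e} \<le> exp (- e\<^sup>2 / (2 * W))"
      using wa v by (intro Y_tail_le du_supp vw W(1) e) auto
    thus ?thesis by (simp add: E1_def wa)
  qed
  have p2: "prob (E2 v) \<le> exp (- e\<^sup>2 / (2 * W))" if "v \<in> L" for v
  proof -
    have v: "valid F v" "length v = J" using that by (auto simp: L_def)
    have "V (gr (dom v) (ctr v)) = gr (dom v) (ctr v) (ctr v)"
      using v dom_intr[of v] by (intro En_gr_gr_subset) auto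
    thus ?thesis unfolding E2_def using W(1) W(3)[OF v] e v by (intro Y_tail_le gr_supp_intr) auto
  qed
  have "A \<subseteq> E0 \<union> ((\<Union>v\<in>L'. E1 v) \<union> (\<Union>v\<in>L. E2 v))"
  proof
    fix \<omega> assume "\<omega> \<in> A"
    note w = A[OF this]
    show "\<omega> \<in> E0 \<union> ((\<Union>v\<in>L'. E1 v) \<union> (\<Union>v\<in>L. E2 v))"
    proof (rule ccontr)
      assume c: "\<omega> \<notin> E0 \<union> ((\<Union>v\<in>L'. E1 v) \<union> (\<Union>v\<in>L. E2 v))"
      then obtain a where a: "a \<in> F 0" "m \<le> ns d [a] \<omega>" "xi [a] \<omega> \<ge> - \<tau>"
        using w by (auto simp: E0_def not_less)
      have va: "valid F [a]" using a(1) valid_snoc[of F "[]" a] by simp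
      have err: "- e \<le> Y (du v b) \<omega>" if "valid F (v @ [b])" "length v < J" for v b
      proof (cases "v = []")
        case True
        thus ?thesis using e by (simp add: Y_du_Nil)
      next
        case False
        hence "1 \<le> length v" by (cases v) auto
        hence "v @ [b] \<in> L'" using that by (auto simp: L'_def)
        hence "\<omega> \<notin> E1 (v @ [b])" using c by blast
        thus ?thesis using w by (simp add: E1_def)
      qed
      let ?X = "surv F \<theta> d (\<lambda>v. xi v \<omega>) [a]"
      have leaf: "v \<in> L \<and> ctr v \<in> S \<and> Phi (ctr v) \<omega> \<ge> T" if "v \<in> ?X" for v
      proof -
        from surv_valid[OF va that] J obtain u where v: "valid F v" "length v = J" "v = [a] @ u" by auto
        hence vL: "v \<in> L" by (simp add: L_def)
        have ne: "v \<noteq> []" using v by simp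
        have cv: "ctr v \<in> dom v" using v J by (intro ctr_in_dom) auto
        moreover have "dom v \<subseteq> dom [a]" using dom_append[of "[a]" u] v by simp
        moreover have "dom [a] \<subseteq> S" using S(2)[OF a(1)] by (simp add: dom_def ctr_def)
        moreover have "dom v \<subseteq> intr N" using v by (intro dom_intr) auto
        ultimately have cS: "ctr v \<in> S" "ctr v \<in> intr N" by auto
        have "Y (hP [a]) \<omega> = xi [a] \<omega>"
          using Y_hP_snoc[of "[]" a \<omega>] by (simp add: Y_hP_Nil Y_du_Nil)
        hence "Y (hP v) \<omega> \<ge> - \<tau> + (\<Sum>k\<in>{1..<J}. \<theta> k) - real d * e"
          using surviving_leaf_bound[OF err va _ that] a(3) J by auto
        moreover have "Y (gr (dom v) (ctr v)) \<omega> \<ge> - e" using c vL w by (auto simp: E2_def)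
        moreover have "Phi (ctr v) \<omega> = Y (hP v) \<omega> + Y (gr (dom v) (ctr v)) \<omega>"
          using Y_gr[OF cS(2), of \<omega>] by (simp add: hP_def Y_diff)
        ultimately have "Phi (ctr v) \<omega> \<ge> (\<Sum>k\<in>{1..<J}. \<theta> k) - \<tau> - (real d + 1) * e" by (simp add: algebra_simps)
        moreover have "(real d + 1) * e \<le> (real J + 1) * e" using e J by (intro mult_right_mono) auto
        ultimately show ?thesis using T vL cS by simp
      qed
      have "m \<le> card ?X" using a(2) card_surv[OF finF va] by simp
      also have "card ?X = card (ctr ` ?X)"
        using inj_on_subset[OF inj_ctr[of J], of ?X] leaf J by (intro card_image[symmetric]) (auto simp: L_def)
      also have "\<dots> \<le> card {x \<in> S. Phi x \<omega> \<ge> T}" using leaf S(1) by (intro card_mono) auto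
      finally show False using w by simp
    qed
  qed
  hence "prob A \<le> prob (E0 \<union> ((\<Union>v\<in>L'. E1 v) \<union> (\<Union>v\<in>L. E2 v)))"
    using fL(1) fL' by (intro finite_measure_mono) auto
  also have "\<dots> \<le> prob E0 + prob ((\<Union>v\<in>L'. E1 v) \<union> (\<Union>v\<in>L. E2 v))"
    using fL(1) fL' by (intro measure_Un_le) auto
  also have "prob ((\<Union>v\<in>L'. E1 v) \<union> (\<Union>v\<in>L. E2 v)) \<le> prob (\<Union>v\<in>L'. E1 v) + prob (\<Union>v\<in>L. E2 v)"
    using fL(1) fL' by (intro measure_Un_le) auto
  also have "prob (\<Union>v\<in>L'. E1 v) \<le> (\<Sum>v\<in>L'. prob (E1 v))"
    using fL' by (intro measure_UNION_le) auto
  also have "\<dots> \<le> real (J * N\<^sup>2) * exp (- e\<^sup>2 / (2 * W))"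
  proof -
    have "(\<Sum>v\<in>L'. prob (E1 v)) \<le> real (card L') * exp (- e\<^sup>2 / (2 * W))" using p1 by (intro sum_bounded_above)
    also have "\<dots> \<le> real (J * N\<^sup>2) * exp (- e\<^sup>2 / (2 * W))" using cL' by (intro mult_right_mono) (auto simp flip: of_nat_mult of_nat_power)
    finally show ?thesis .
  qed
  also have "prob (\<Union>v\<in>L. E2 v) \<le> (\<Sum>v\<in>L. prob (E2 v))"
    using fL by (intro measure_UNION_le) auto
  also have "\<dots> \<le> real (N\<^sup>2) * exp (- e\<^sup>2 / (2 * W))"
  proof -
    have "(\<Sum>v\<in>L. prob (E2 v)) \<le> real (card L) * exp (- e\<^sup>2 / (2 * W))" using p2 by (intro sum_bounded_above)
    also have "\<dots> \<le> real (N\<^sup>2) * exp (- e\<^sup>2 / (2 * W))" using fL(2) by (intro mult_right_mono) (auto simp flip: of_nat_power)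
    finally show ?thesis .
  qed
  finally have "prob A \<le> prob E0 + (real (J * N\<^sup>2) * exp (- e\<^sup>2 / (2 * W)) + real (N\<^sup>2) * exp (- e\<^sup>2 / (2 * W)))" by simp
  also have "real (J * N\<^sup>2) * exp (- e\<^sup>2 / (2 * W)) + real (N\<^sup>2) * exp (- e\<^sup>2 / (2 * W)) = (real J + 1) * (real N)\<^sup>2 * exp (- e\<^sup>2 / (2 * W))"
    by (simp add: algebra_simps)
  finally show ?thesis using p0 by simp
qed

end

section \<open>Logarithmic sums along a row, and the concrete hierarchy of boxes\<close>

lemma sum_ln_ratio_le:
  assumes "n \<ge> 1"
  shows "(\<Sum>k\<in>{1..n}. ln (real n) - ln (real k)) \<le> real n"
  using assms
proof (induction n rule: dec_induct)
  case (step n)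
  have "(\<Sum>k\<in>{1..Suc n}. ln (real (Suc n)) - ln (real k)) = (\<Sum>k\<in>{1..n}. (ln (real n) - ln (real k)) + (ln (real (Suc n)) - ln (real n)))"
    by simp
  also have "\<dots> = (\<Sum>k\<in>{1..n}. ln (real n) - ln (real k)) + real n * (ln (real (Suc n)) - ln (real n))"
    by (subst sum.distrib) simp
  also have "ln (real (Suc n)) - ln (real n) \<le> 1 / real n"
  proof -
    have "ln (real (Suc n)) - ln (real n) = ln (real (Suc n) / real n)" using step by (simp add: ln_div)
    also have "\<dots> \<le> real (Suc n) / real n - 1" using step by (intro ln_le_minus_one) auto
    finally show ?thesis using step by (simp add: field_simps)
  qed
  hence "real n * (ln (real (Suc n)) - ln (real n)) \<le> 1"
    using step by (simp add: field_simps)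
  finally show ?case using step.IH by simp
qed simp

text \<open>A row sum of the covariances ln (n / |i - j|). Each side of \<open>i\<close> contributes
  at most ln (n^n / n!), which is at most n; so the mean over a row of n points stays bounded
  although single covariances are of order ln n.\<close>

lemma sum_ln_dist_le:
  assumes i: "i \<in> {1..n}"
  shows "(\<Sum>j\<in>{1..n} - {i}. ln (real n) - ln \<bar>real i - real j\<bar>) \<le> 2 * real n"
proof -
  let ?h = "\<lambda>k. ln (real n) - ln (real k)"
  have h0: "?h k \<ge> 0" if "k \<in> {1..n}" for k using that by simp
  have n: "n \<ge> 1" using i by simp
  have s: "{1..n} - {i} = {1..<i} \<union> {i<..n}" using i by auto
  have "(\<Sum>j\<in>{1..n} - {i}. ln (real n) - ln \<bar>real i - real j\<bar>)
     = (\<Sum>j\<in>{1..<i}. ln (real n) - ln \<bar>real i - real j\<bar>) + (\<Sum>j\<in>{i<..n}. ln (real n) - ln \<bar>real i - real j\<bar>)"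
    unfolding s by (rule sum.union_disjoint) auto
  also have "(\<Sum>j\<in>{1..<i}. ln (real n) - ln \<bar>real i - real j\<bar>) = (\<Sum>k\<in>(\<lambda>j. i - j) ` {1..<i}. ?h k)"
    by (subst sum.reindex) (auto simp: inj_on_def of_nat_diff intro!: sum.cong)
  also have "\<dots> \<le> (\<Sum>k\<in>{1..n}. ?h k)" using i h0 by (intro sum_mono2) auto
  also have "\<dots> \<le> real n" by (rule sum_ln_ratio_le[OF n])
  also have "(\<Sum>j\<in>{i<..n}. ln (real n) - ln \<bar>real i - real j\<bar>) = (\<Sum>k\<in>(\<lambda>j. j - i) ` {i<..n}. ?h k)"
    by (subst sum.reindex) (auto simp: inj_on_def of_nat_diff abs_minus_commute intro!: sum.cong)
  also have "\<dots> \<le> (\<Sum>k\<in>{1..n}. ?h k)" using i h0 by (intro sum_mono2) auto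
  also have "\<dots> \<le> real n" by (rule sum_ln_ratio_le[OF n])
  finally show ?thesis by simp
qed

text \<open>Depth 0 is a single row of boxes. Deeper down the children fill a square grid in one
  quadrant of the parent, with spacing equal to twice their radius; the divisor 8 keeps their
  centres within a quarter of the radius of the parent from its centre, where the Green function
  estimate is uniform.\<close>

definition boxF :: "(nat \<Rightarrow> nat) \<Rightarrow> nat \<Rightarrow> nat \<Rightarrow> pt set" where
  "boxF r n k = (if k = 0 then (\<lambda>i. (2 * int (r 1) * int i, 0)) ` {1..n}
     else (\<lambda>(i, j). (2 * int (r (Suc k)) * int i, 2 * int (r (Suc k)) * int j)) `
       ({1..r k div (8 * r (Suc k))} \<times> {1..r k div (8 * r (Suc k))}))"

lemma finite_boxF [simp]: "finite (boxF r n k)"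
  by (simp add: boxF_def)

lemma card_boxF_0: "r 1 \<ge> 1 \<Longrightarrow> card (boxF r n 0) = n"
  unfolding boxF_def by (simp, subst card_image) (auto simp: inj_on_def)

lemma card_boxF: "k \<ge> 1 \<Longrightarrow> r (Suc k) \<ge> 1 \<Longrightarrow> card (boxF r n k) = (r k div (8 * r (Suc k)))\<^sup>2"
  unfolding boxF_def by (simp, subst card_image) (auto simp: inj_on_def power2_eq_square)

lemma boxF_sep_aux:
  fixes R i j :: int
  assumes "R \<ge> 0" "i \<noteq> j"
  shows "2 * R \<le> \<bar>2 * R * i - 2 * R * j\<bar>"
proof -
  have "\<bar>2 * R * i - 2 * R * j\<bar> = 2 * R * \<bar>i - j\<bar>"
    using assms by (simp add: abs_mult right_diff_distrib[symmetric])
  moreover have "1 \<le> \<bar>i - j\<bar>" using assms by simp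
  hence "2 * R * 1 \<le> 2 * R * \<bar>i - j\<bar>" using assms by (intro mult_left_mono) auto
  ultimately show ?thesis by simp
qed

lemma boxF_sep:
  assumes "a \<in> boxF r n k" "b \<in> boxF r n k" "a \<noteq> b"
  shows "2 * int (r (Suc k)) \<le> \<bar>fst a - fst b\<bar> \<or> 2 * int (r (Suc k)) \<le> \<bar>snd a - snd b\<bar>"
proof (cases "k = 0")
  case True
  then obtain i j where "a = (2 * int (r 1) * int i, 0)" "b = (2 * int (r 1) * int j, 0)"
    using assms by (auto simp: boxF_def)
  thus ?thesis using boxF_sep_aux[of "int (r 1)" "int i" "int j"] assms(3) True by auto
next
  case False
  then obtain i j i' j' where *: "a = (2 * int (r (Suc k)) * int i, 2 * int (r (Suc k)) * int j)"
     "b = (2 * int (r (Suc k)) * int i', 2 * int (r (Suc k)) * int j')"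
    using assms by (auto simp: boxF_def)
  hence "int i \<noteq> int i' \<or> int j \<noteq> int j'" using assms(3) by auto
  thus ?thesis
    using boxF_sep_aux[of "int (r (Suc k))" "int i" "int i'"] boxF_sep_aux[of "int (r (Suc k))" "int j" "int j'"] * by auto
qed

lemma boxF_bound:
  assumes "k \<ge> 1" "a \<in> boxF r n k"
  shows "4 * \<bar>fst a\<bar> \<le> int (r k)" "4 * \<bar>snd a\<bar> \<le> int (r k)"
proof -
  let ?m = "r k div (8 * r (Suc k))"
  obtain i j where ij: "a = (2 * int (r (Suc k)) * int i, 2 * int (r (Suc k)) * int j)" "i \<le> ?m" "j \<le> ?m"
  proof -
    have "a \<in> (\<lambda>(i, j). (2 * int (r (Suc k)) * int i, 2 * int (r (Suc k)) * int j)) ` ({1..?m} \<times> {1..?m})"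
      using assms by (simp add: boxF_def)
    then obtain q where q: "a = (\<lambda>(i, j). (2 * int (r (Suc k)) * int i, 2 * int (r (Suc k)) * int j)) q" "q \<in> {1..?m} \<times> {1..?m}"
      by (rule imageE)
    show ?thesis by (rule that[of "fst q" "snd q"]) (use q in \<open>auto simp: case_prod_beta\<close>)
  qed
  have "8 * r (Suc k) * t \<le> r k" if "t \<le> ?m" for t
  proof -
    have "8 * r (Suc k) * t \<le> 8 * r (Suc k) * ?m" using that by (rule mult_left_mono) simp
    also have "\<dots> \<le> r k" by (rule times_div_less_eq_dividend)
    finally show ?thesis .
  qed
  from this[OF ij(2)] this[OF ij(3)] have "int (8 * r (Suc k) * i) \<le> int (r k)" "int (8 * r (Suc k) * j) \<le> int (r k)"
    unfolding of_nat_le_iff by blast+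
  thus "4 * \<bar>fst a\<bar> \<le> int (r k)" "4 * \<bar>snd a\<bar> \<le> int (r k)" using ij(1) by (simp_all add: abs_mult)
qed

text \<open>The numerical input: Green function estimates with a common error \<open>C\<close> for
  the whole box and for the sub-boxes, leaves reduced to points by \<open>r J = 1\<close>, and a row
  of level one boxes of length comparable to N, which is what \<open>N_bound\<close>
  expresses.\<close>

locale gff_tree = gff_field M N Phi for M :: "'a measure" and N Phi +
  fixes l C K1 :: real and c0 :: pt and r :: "nat \<Rightarrow> nat" and n J :: nat
  assumes J2: "J \<ge> 2" and C0: "C \<ge> 0" and K1: "K1 \<ge> 0" and n1: "n \<ge> 1"
    and greenD: "\<And>x y. x \<in> intr N \<Longrightarrow> y \<in> intr N \<Longrightarrow> y \<in> box_l N l \<Longrightarrow>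
       \<bar>gr (intr N) x y - 2 / pi * (ln (real N) - lf (x - y))\<bar> \<le> C"
    and greenB: "\<And>c R x y. R \<ge> 1 \<Longrightarrow> x \<in> Qb c R \<Longrightarrow> y \<in> Qb c R \<Longrightarrow> 4 * \<bar>fst y - fst c\<bar> \<le> int R \<Longrightarrow> 4 * \<bar>snd y - snd c\<bar> \<le> int R
       \<Longrightarrow> \<bar>gr (Qb c R) x y - 2 / pi * (ln (real R) - lf (x - y))\<bar> \<le> C"
    and rJ: "r J = 1" and r_dec: "\<And>k. 1 \<le> k \<Longrightarrow> k < J \<Longrightarrow> r k \<ge> 8 * r (Suc k)"
    and r_ge: "\<And>k. 1 \<le> k \<Longrightarrow> k \<le> J \<Longrightarrow> r k \<ge> 1"
    and root_in: "\<And>i. i \<in> {1..n} \<Longrightarrow> Qb (c0 + (2 * int (r 1) * int i, 0)) (r 1) \<subseteq> box_l N l \<inter> intr N"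
    and N_bound: "ln (real N) \<le> ln (real (r 1)) + ln (real n) + K1"

sublocale gff_tree \<subseteq> box_tree M N Phi c0 r "boxF r n" J
proof
  fix k a assume k: "1 \<le> k" "k < J" "a \<in> boxF r n k"
  have "int (8 * r (Suc k)) \<le> int (r k)" using r_dec[OF k(1,2)] by (simp only: of_nat_le_iff)
  thus "\<bar>fst a\<bar> + int (r (Suc k)) \<le> int (r k) \<and> \<bar>snd a\<bar> + int (r (Suc k)) \<le> int (r k)"
    using boxF_bound[OF k(1,3)] by simp
next
  fix a assume "a \<in> boxF r n 0"
  then obtain i where "i \<in> {1..n}" "a = (2 * int (r 1) * int i, 0)" unfolding boxF_def by auto
  thus "Qb (c0 + a) (r 1) \<subseteq> intr N" using root_in by blast
next
  show "\<And>k. 1 \<le> k \<Longrightarrow> k \<le> J \<Longrightarrow> r k \<ge> 1" by (rule r_ge)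
  show "\<And>k a b. k < J \<Longrightarrow> a \<in> boxF r n k \<Longrightarrow> b \<in> boxF r n k \<Longrightarrow> a \<noteq> b \<Longrightarrow>
       2 * int (r (Suc k)) \<le> \<bar>fst a - fst b\<bar> \<or> 2 * int (r (Suc k)) \<le> \<bar>snd a - snd b\<bar>"
    by (rule boxF_sep)
qed simp

context gff_tree
begin

lemma root_box_l:
  assumes "a \<in> boxF r n 0"
  shows "Qb (c0 + a) (r 1) \<subseteq> box_l N l"
proof -
  obtain i where "i \<in> {1..n}" "a = (2 * int (r 1) * int i, 0)" using assms unfolding boxF_def by auto
  thus ?thesis using root_in by blast
qed

lemma ctr_in_box_l:
  assumes "valid (boxF r n) v" "v \<noteq> []" "length v \<le> J"
  shows "ctr v \<in> box_l N l" "ctr v \<in> intr N"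
proof -
  obtain a w where v: "v = [a] @ w" using assms by (cases v) auto
  have va: "valid (boxF r n) [a]" using assms(1) valid_append1 unfolding v by blast
  hence a: "a \<in> boxF r n 0" using valid_snoc[of _ "[]" a] by simp
  have "dom v \<subseteq> dom [a]" using dom_append[of "[a]" w] assms v by simp
  moreover have "dom [a] \<subseteq> box_l N l" using root_box_l[OF a] by (simp add: dom_def ctr_def)
  ultimately show "ctr v \<in> box_l N l" using ctr_in_dom[OF assms(2,3)] by blast
  show "ctr v \<in> intr N" using ctr_in_dom[OF assms(2,3)] dom_intr[OF assms(1,3)] by blast
qed

lemma green_dom:
  assumes v: "valid (boxF r n) v" "v \<noteq> []" "length v < J" and a: "a \<in> boxF r n (length v)"
  defines "\<rho> \<equiv> real (r (length v))"
  shows "x \<in> dom v \<Longrightarrow> \<bar>gr (dom v) x (ctr v) - 2 / pi * (ln \<rho> - lf (x - ctr v))\<bar> \<le> C"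
    "x \<in> dom v \<Longrightarrow> \<bar>gr (dom v) x (ctr (v @ [a])) - 2 / pi * (ln \<rho> - lf (x - ctr (v @ [a])))\<bar> \<le> C"
    "ctr (v @ [a]) \<in> dom v"
proof -
  have k: "1 \<le> length v" using v(2) by (cases v) auto
  have d: "dom v = Qb (ctr v) (r (length v))" using v(2) by (simp add: dom_def)
  have r1: "r (length v) \<ge> 1" using r_ge[OF k] v(3) by simp
  have va: "valid (boxF r n) (v @ [a])" using v a unfolding valid_snoc by simp
  show 1: "ctr (v @ [a]) \<in> dom v"
    using ctr_in_dom[of "v @ [a]"] dom_child[OF va v(3)] v(3) by auto
  show "x \<in> dom v \<Longrightarrow> \<bar>gr (dom v) x (ctr v) - 2 / pi * (ln \<rho> - lf (x - ctr v))\<bar> \<le> C"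
    unfolding d \<rho>_def using r1 by (intro greenB) (auto simp: in_Qb)
  show "x \<in> dom v \<Longrightarrow> \<bar>gr (dom v) x (ctr (v @ [a])) - 2 / pi * (ln \<rho> - lf (x - ctr (v @ [a])))\<bar> \<le> C"
    using 1 boxF_bound[OF k a] unfolding d \<rho>_def
    by (intro greenB r1) (simp_all add: ctr_snoc)
qed

lemma green_ctr:
  assumes v: "valid (boxF r n) v" "v \<noteq> []" "length v \<le> J"
  shows "\<bar>gr (dom v) (ctr v) (ctr v) - 2 / pi * ln (real (r (length v)))\<bar> \<le> C"
proof -
  have k: "1 \<le> length v" using v(2) by (cases v) auto
  have d: "dom v = Qb (ctr v) (r (length v))" using v(2) by (simp add: dom_def)
  have "ctr v \<in> dom v" by (rule ctr_in_dom[OF v(2,3)])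
  thus ?thesis using greenB[OF r_ge[OF k v(3)], of "ctr v" "ctr v" "ctr v"] by (simp add: d)
qed

text \<open>For each pair of centres the difference of the two Green functions is the same constant
  up to 2 C, since the terms \<open>lf (x - y)\<close> cancel. In the second difference with
  coefficients 1, 1, -2 the constant drops out and 8 C is left.\<close>

lemma V_du_le:
  assumes "valid (boxF r n) (v @ [a])" "1 \<le> length v" "length v < J"
  shows "V (du v a) \<le> 8 * C"
proof -
  have v: "valid (boxF r n) v" "a \<in> boxF r n (length v)" using assms(1) unfolding valid_snoc by auto
  have ne: "v \<noteq> []" using assms(2) by auto
  define L where "L = 2 / pi * (ln (real N) - ln (real (r (length v))))"
  define \<Delta> where "\<Delta> = (\<lambda>x y. gr (intr N) x y - gr (dom v) x y)"
  note g = green_dom[OF v(1) ne assms(3) v(2)]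
  have cv: "ctr v \<in> dom v" using ne assms(3) by (intro ctr_in_dom) auto
  have b: "ctr v \<in> box_l N l" "ctr v \<in> intr N" using ctr_in_box_l[OF v(1) ne] assms(3) by auto
  have b': "ctr (v @ [a]) \<in> box_l N l" "ctr (v @ [a]) \<in> intr N" using ctr_in_box_l[OF assms(1)] assms(3) by auto
  have D: "\<bar>\<Delta> x y - L\<bar> \<le> 2 * C"
    if "\<bar>gr (intr N) x y - 2 / pi * (ln (real N) - lf (x - y))\<bar> \<le> C"
       "\<bar>gr (dom v) x y - 2 / pi * (ln (real (r (length v))) - lf (x - y))\<bar> \<le> C" for x y
  proof -
    have "\<Delta> x y - L = (gr (intr N) x y - 2 / pi * (ln (real N) - lf (x - y))) - (gr (dom v) x y - 2 / pi * (ln (real (r (length v))) - lf (x - y)))"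
      by (simp add: \<Delta>_def L_def right_diff_distrib)
    thus ?thesis using that by linarith
  qed
  have "\<bar>\<Delta> (ctr (v @ [a])) (ctr (v @ [a])) - L\<bar> \<le> 2 * C" by (rule D[OF greenD[OF b'(2,2,1)] g(2)[OF g(3)]])
  moreover have "\<bar>\<Delta> (ctr v) (ctr v) - L\<bar> \<le> 2 * C" by (rule D[OF greenD[OF b(2,2,1)] g(1)[OF cv]])
  moreover have "\<bar>\<Delta> (ctr (v @ [a])) (ctr v) - L\<bar> \<le> 2 * C" by (rule D[OF greenD[OF b'(2) b(2,1)] g(1)[OF g(3)]])
  moreover have "V (du v a) = \<Delta> (ctr (v @ [a])) (ctr (v @ [a])) + \<Delta> (ctr v) (ctr v) - 2 * \<Delta> (ctr (v @ [a])) (ctr v)"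
    unfolding \<Delta>_def using assms(3) by (intro V_du v) auto
  ultimately show ?thesis by linarith
qed

lemma V_uxi_ge:
  assumes "valid (boxF r n) (v @ [a])" "1 \<le> length v" "length v < J"
  shows "V (uxi (v @ [a])) \<ge> 2 / pi * (ln (real (r (length v))) - ln (real (r (Suc (length v))))) - 2 * C"
proof -
  have v: "valid (boxF r n) v" "a \<in> boxF r n (length v)" using assms(1) unfolding valid_snoc by auto
  have ne: "v \<noteq> []" using assms(2) by auto
  note g = green_dom[OF v(1) ne assms(3) v(2)]
  have "V (uxi (v @ [a])) = gr (dom v) (ctr (v @ [a])) (ctr (v @ [a])) - gr (dom (v @ [a])) (ctr (v @ [a])) (ctr (v @ [a]))"
    using V_uxi[OF assms(1)] assms(3) by simp
  moreover have "\<bar>gr (dom (v @ [a])) (ctr (v @ [a])) (ctr (v @ [a])) - 2 / pi * ln (real (r (Suc (length v))))\<bar> \<le> C"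
    using green_ctr[OF assms(1)] assms(3) by simp
  moreover have "\<bar>gr (dom v) (ctr (v @ [a])) (ctr (v @ [a])) - 2 / pi * ln (real (r (length v)))\<bar> \<le> C"
    using g(2)[OF g(3)] by simp
  ultimately show ?thesis unfolding right_diff_distrib by linarith
qed

text \<open>Off the diagonal the centres are at distance 2 r(1) |i - j| while N is at most a
  constant times r(1) n, so the covariance is about ln (n / |i - j|). On the diagonal ln n is
  replaced by n, since a row sum of order n is all that is needed.\<close>

lemma En_root_le:
  assumes i: "i \<in> {1..n}" and j: "j \<in> {1..n}"
  defines "a \<equiv> (2 * int (r 1) * int i, 0::int)" and "b \<equiv> (2 * int (r 1) * int j, 0::int)"
  shows "En (intr N) (uxi [a]) (uxi [b]) \<ge> 0"
    "En (intr N) (uxi [a]) (uxi [b]) \<le> K1 + 2 * C + (if i = j then real n else ln (real n) - ln \<bar>real i - real j\<bar>)"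
proof -
  have r1: "r 1 \<ge> 1" using r_ge[of 1] J2 by simp
  have ab: "a \<in> boxF r n 0" "b \<in> boxF r n 0" using i j by (auto simp: boxF_def a_def b_def)
  have va: "valid (boxF r n) [a]" "valid (boxF r n) [b]" using ab valid_snoc[of "boxF r n" "[]"] by auto
  have J1: "length [a] \<le> J" "length [b] \<le> J" using J2 by auto
  note ca = ctr_in_box_l[OF va(1) _ J1(1)] and cb = ctr_in_box_l[OF va(2) _ J1(2)]
  have p: "0 < 2 / pi" "2 / pi \<le> 1" using pi_gt3 by auto
  have pm: "2 / pi * x \<le> x" if "x \<ge> 0" for x using mult_right_mono[OF p(2) that] by simp
  have ln_n: "ln (real n) \<ge> 0" using n1 by simp
  have "En (intr N) (uxi [a]) (uxi [b]) \<ge> 0 \<and>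
    En (intr N) (uxi [a]) (uxi [b]) \<le> K1 + 2 * C + (if i = j then real n else ln (real n) - ln \<bar>real i - real j\<bar>)"
  proof (cases "i = j")
    case True
    hence e: "b = a" by (simp add: a_def b_def)
    have "V (uxi [a]) = gr (intr N) (ctr [a]) (ctr [a]) - gr (dom [a]) (ctr [a]) (ctr [a])"
      using V_uxi[OF va(1) _ J1(1)] by (simp add: dom_def)
    moreover have "\<bar>gr (intr N) (ctr [a]) (ctr [a]) - 2 / pi * ln (real N)\<bar> \<le> C"
      using greenD[of "ctr [a]" "ctr [a]"] ca by simp
    moreover have "\<bar>gr (dom [a]) (ctr [a]) (ctr [a]) - 2 / pi * ln (real (r 1))\<bar> \<le> C"
      using green_ctr[OF va(1) _ J1(1)] by simp
    ultimately have "V (uxi [a]) \<le> 2 / pi * (ln (real N) - ln (real (r 1))) + 2 * C"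
      unfolding right_diff_distrib by linarith
    also have "2 / pi * (ln (real N) - ln (real (r 1))) \<le> 2 / pi * (ln (real n) + K1)"
      using N_bound p by (intro mult_left_mono) auto
    also have "\<dots> \<le> ln (real n) + K1" using ln_n K1 by (intro pm) auto
    also have "ln (real n) \<le> real n" using ln_le_minus_one[of "real n"] n1 by simp
    finally have "V (uxi [a]) \<le> K1 + 2 * C + real n" by simp
    moreover have "V (uxi [a]) \<ge> 0" using uxi_supp(2)[OF va(1) _ J1(1)] by (intro En_nonneg) auto
    ultimately show ?thesis using True e by simp
  next
    case False
    hence ne: "a \<noteq> b" using r1 by (auto simp: a_def b_def)
    have e: "En (intr N) (uxi [a]) (uxi [b]) = gr (intr N) (ctr [a]) (ctr [b])"
      using J2 by (intro En_uxi_root ab ne) auto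
    define t where "t = \<bar>real i - real j\<bar>"
    have "1 \<le> \<bar>int i - int j\<bar>" using False by linarith
    hence "1 \<le> real_of_int \<bar>int i - int j\<bar>" by linarith
    hence t: "t \<ge> 1" by (simp add: t_def)
    have "real i \<le> real n" "real j \<le> real n" "0 \<le> real i" "0 \<le> real j" using i j by auto
    hence tn: "t \<le> real n" unfolding t_def abs_le_iff by linarith
    have "ctr [a] - ctr [b] = (2 * int (r 1) * (int i - int j), 0)"
      by (simp add: ctr_def a_def b_def right_diff_distrib)
    hence "lf (ctr [a] - ctr [b]) = ln ((2 * real (r 1) * (real i - real j))\<^sup>2 + 1) / 2"
      by (simp add: lf_def)
    also have "(2 * real (r 1) * (real i - real j))\<^sup>2 = (2 * real (r 1) * t)\<^sup>2" by (simp add: t_def power_mult_distrib)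
    also have "ln ((2 * real (r 1) * t)\<^sup>2 + 1) \<ge> ln ((real (r 1) * t)\<^sup>2)"
    proof (subst ln_le_cancel_iff)
      have "(real (r 1) * t)\<^sup>2 \<le> (2 * real (r 1) * t)\<^sup>2" using t by (intro power_mono) auto
      thus "(real (r 1) * t)\<^sup>2 \<le> (2 * real (r 1) * t)\<^sup>2 + 1" by simp
    qed (use r1 t in \<open>auto intro: add_nonneg_pos\<close>)
    hence "ln ((2 * real (r 1) * t)\<^sup>2 + 1) / 2 \<ge> ln ((real (r 1) * t)\<^sup>2) / 2" by simp
    also have "ln ((real (r 1) * t)\<^sup>2) / 2 = ln (real (r 1)) + ln t"
      using r1 t by (simp add: ln_realpow ln_mult)
    finally have lfb: "lf (ctr [a] - ctr [b]) \<ge> ln (real (r 1)) + ln t" .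
    have "\<bar>gr (intr N) (ctr [a]) (ctr [b]) - 2 / pi * (ln (real N) - lf (ctr [a] - ctr [b]))\<bar> \<le> C"
      using greenD ca cb by simp
    hence "gr (intr N) (ctr [a]) (ctr [b]) \<le> 2 / pi * (ln (real N) - lf (ctr [a] - ctr [b])) + C" by linarith
    also have "2 / pi * (ln (real N) - lf (ctr [a] - ctr [b])) \<le> 2 / pi * (ln (real n) - ln t + K1)"
      using N_bound lfb p by (intro mult_left_mono) auto
    also have "\<dots> \<le> ln (real n) - ln t + K1" using t tn K1 by (intro pm) (simp add: add_nonneg_nonneg)
    finally show ?thesis using False e C0 gr_nonneg[of "intr N"] by (simp add: t_def)
  qed
  thus "En (intr N) (uxi [a]) (uxi [b]) \<ge> 0"
    "En (intr N) (uxi [a]) (uxi [b]) \<le> K1 + 2 * C + (if i = j then real n else ln (real n) - ln \<bar>real i - real j\<bar>)" by auto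
qed

text \<open>If all increments in \<open>A\<close> are below - \<tau>, so is their average, whose
  variance is at most C4 n / |A|. In \<open>C4\<close> the 3 consists of n from the diagonal and 2 n
  from the logarithmic row sum, divided by n.\<close>

lemma root_increments_not_all_low:
  assumes A: "A \<subseteq> boxF r n 0" and \<tau>: "\<tau> \<ge> 0"
  defines "C4 \<equiv> K1 + 2 * C + 3"
  shows "prob {\<omega> \<in> space M. \<forall>a\<in>A. xi [a] \<omega> < - \<tau>} \<le> exp (- (\<tau>\<^sup>2 / (2 * C4 * real n)) * real (card A))"
proof (cases "A = {}")
  case True
  thus ?thesis by (simp add: prob_space)
next
  case False
  define f where "f = (\<lambda>i::nat. (2 * int (r 1) * int i, 0::int))"
  have r1: "r 1 \<ge> 1" using r_ge[of 1] J2 by simp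
  have inj: "inj_on f {1..n}" using r1 by (auto simp: inj_on_def f_def)
  have F0: "boxF r n 0 = f ` {1..n}" by (simp add: boxF_def f_def)
  have fA: "finite A" using A finite_subset finite_boxF by blast
  have cA: "card A > 0" using False fA by (simp add: card_gt_0_iff)
  have C4: "C4 > 0" using K1 C0 by (simp add: C4_def)
  define u where "u = (\<lambda>z. \<Sum>a\<in>A. 1 * uxi [a] z)"
  have va: "valid (boxF r n) [a]" if "a \<in> A" for a using that A valid_snoc[of "boxF r n" "[]" a] by auto
  have su: "supp_in (intr N) u" unfolding u_def using va J2 by (intro supp_in_intros uxi_supp) auto
  have row: "(\<Sum>b\<in>A. En (intr N) (uxi [a]) (uxi [b])) \<le> C4 * real n" if a: "a \<in> A" for a
  proof -
    obtain i where i: "i \<in> {1..n}" "a = f i" using a A F0 by auto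
    have "(\<Sum>b\<in>A. En (intr N) (uxi [a]) (uxi [b])) \<le> (\<Sum>b\<in>f ` {1..n}. En (intr N) (uxi [a]) (uxi [b]))"
      using A F0 En_root_le(1)[OF i(1)] i(2) by (intro sum_mono2) (auto simp: f_def)
    also have "\<dots> = (\<Sum>j\<in>{1..n}. En (intr N) (uxi [f i]) (uxi [f j]))"
      using inj i(2) by (simp add: sum.reindex)
    also have "\<dots> \<le> (\<Sum>j\<in>{1..n}. K1 + 2 * C + (if i = j then real n else ln (real n) - ln \<bar>real i - real j\<bar>))"
      unfolding f_def by (intro sum_mono En_root_le(2) i)
    also have "\<dots> = real n * (K1 + 2 * C) + (\<Sum>j\<in>{1..n}. if i = j then real n else ln (real n) - ln \<bar>real i - real j\<bar>)"
      by (simp add: sum.distrib)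
    also have "(\<Sum>j\<in>{1..n}. if i = j then real n else ln (real n) - ln \<bar>real i - real j\<bar>)
       = real n + (\<Sum>j\<in>{1..n} - {i}. ln (real n) - ln \<bar>real i - real j\<bar>)"
      using i(1) by (subst sum.remove[of _ i]) (auto intro!: sum.cong)
    also have "(\<Sum>j\<in>{1..n} - {i}. ln (real n) - ln \<bar>real i - real j\<bar>) \<le> 2 * real n"
      by (rule sum_ln_dist_le[OF i(1)])
    finally show ?thesis by (simp add: C4_def algebra_simps)
  qed
  have "V u = (\<Sum>a\<in>A. \<Sum>b\<in>A. En (intr N) (uxi [a]) (uxi [b]))"
    unfolding u_def En_sum_left En_sum_right En_cmult_left En_cmult_right by simp
  also have "\<dots> \<le> (\<Sum>a\<in>A. C4 * real n)" by (intro sum_mono row)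
  also have "\<dots> = real (card A) * (C4 * real n)" by simp
  finally have Vu: "V u \<le> real (card A) * (C4 * real n)" .
  have "{\<omega> \<in> space M. \<forall>a\<in>A. xi [a] \<omega> < - \<tau>} \<subseteq> {\<omega> \<in> space M. Y u \<omega> \<le> - (\<tau> * real (card A))}"
  proof safe
    fix \<omega> assume "\<forall>a\<in>A. xi [a] \<omega> < - \<tau>"
    hence "(\<Sum>a\<in>A. xi [a] \<omega>) \<le> (\<Sum>a\<in>A. - \<tau>)" by (intro sum_mono) auto
    thus "Y u \<omega> \<le> - (\<tau> * real (card A))" unfolding u_def Y_sum by (simp add: mult.commute)
  qed
  hence "prob {\<omega> \<in> space M. \<forall>a\<in>A. xi [a] \<omega> < - \<tau>} \<le> prob {\<omega> \<in> space M. Y u \<omega> \<le> - (\<tau> * real (card A))}"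
    by (intro finite_measure_mono) auto
  also have "\<dots> \<le> exp (- (\<tau> * real (card A))\<^sup>2 / (2 * (real (card A) * (C4 * real n))))"
    using \<tau> C4 cA n1 by (intro Y_tail_le su Vu) auto
  also have "(\<tau> * real (card A))\<^sup>2 / (2 * (real (card A) * (C4 * real n))) = (\<tau>\<^sup>2 / (2 * C4 * real n)) * real (card A)"
    using cA by (simp add: power2_eq_square)
  hence "- (\<tau> * real (card A))\<^sup>2 / (2 * (real (card A) * (C4 * real n))) = - (\<tau>\<^sup>2 / (2 * C4 * real n)) * real (card A)"
    by (simp only: minus_divide_left[symmetric] mult_minus_left)
  finally show ?thesis .
qed

text \<open>The rate per level one box is e^2 / (2 C4 n) and there are n boxes, so n cancels and the
  exponent is a multiple of e^2. The condition \<open>small\<close> allows 1 - exp (- \<kappa>) to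
  be bounded below by \<kappa> / 2. Of the J + 2 errors e one is the tolerated root
  increment.\<close>

lemma few_thick_points:
  assumes B: "\<And>k. 1 \<le> k \<Longrightarrow> k < J \<Longrightarrow> real ((r k div (8 * r (Suc k)))\<^sup>2) \<ge> B"
    and W: "W > 0" "\<And>k. 1 \<le> k \<Longrightarrow> k < J \<Longrightarrow> W \<le> 2 / pi * (ln (real (r k)) - ln (real (r (Suc k)))) - 2 * C"
    and t: "t \<ge> 0" and p: "p = exp (- (t / sqrt W + 1)\<^sup>2 / 2) / sqrt (2 * pi)" "p * B \<ge> 2"
    and p1: "p1 = exp (- 1 / 2) / sqrt (2 * pi)"
    and m: "real m \<le> p1 / 8 * B * (p * B / 2) ^ (J - 2)"
    and e: "e \<ge> 0" and T: "T \<le> real (J - 2) * t - (real J + 2) * e"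
    and small: "e\<^sup>2 / (2 * (K1 + 2 * C + 3) * real n) \<le> 1"
    and A: "\<And>\<omega>. \<omega> \<in> A \<Longrightarrow> \<omega> \<in> space M \<and> card {x \<in> box_l N l. Phi x \<omega> \<ge> T} < m"
  shows "prob A \<le> exp (- (p1 / (32 * (K1 + 2 * C + 3))) * e\<^sup>2) + (real J + 1) * (real N)\<^sup>2 * exp (- e\<^sup>2 / (2 * (8 * C + 1)))"
proof -
  \<comment> \<open>Threshold 0 below the level one boxes gives the constant probability
    \<open>p1\<close>, the lower tail bound at z = 0; the remaining J - 2 generations ask for
    \<open>t\<close> each.\<close>
  define \<theta> where "\<theta> = (\<lambda>k::nat. if k = 1 then 0 else t)"
  interpret tree_field M "boxF r n" J "\<lambda>v \<omega>. xi v \<omega>" \<theta> by (rule tree)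
  define C4 where "C4 = K1 + 2 * C + 3"
  have C4: "C4 > 0" using K1 C0 by (simp add: C4_def)
  define \<kappa> where "\<kappa> = e\<^sup>2 / (2 * C4 * real n)"
  have sq: "sqrt (2 * pi) \<ge> 1" using pi_gt3 by simp
  have p1_bounds: "0 < p1" "p1 \<le> 1" unfolding p1 using sq by (auto simp: pos_divide_le_eq intro: order_trans[of _ 1])
  have p_bounds: "0 < p" "p \<le> 1" unfolding p(1) using sq by (auto simp: pos_divide_le_eq intro: order_trans[of _ 1])
  have r1: "r 1 \<ge> 1" using r_ge[of 1] J2 by simp
  have succ: "p1 / 8 \<le> prob {\<omega> \<in> space M. m \<le> ns (J - 1) [a] \<omega>}" if a: "a \<in> boxF r n 0" for a
  proof (rule success_probability[OF J2 _ p_bounds p(2) p1_bounds _ _ m a])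
    fix k assume k: "1 \<le> k" "k < J"
    thus "B \<le> real (card (boxF r n k))" using B[OF k] r_ge[of "Suc k"] by (simp add: card_boxF)
  next
    fix v a assume v: "length v = 1" "valid (boxF r n) (v @ [a])"
    have "W \<le> V (uxi (v @ [a]))" using V_uxi_ge[OF v(2)] W(2)[of 1] v(1) J2 by force
    hence "exp (- (0 / sqrt W + 1)\<^sup>2 / 2) / sqrt (2 * pi) \<le> prob {\<omega> \<in> space M. 0 \<le> xi (v @ [a]) \<omega>}"
      using W(1) v J2 by (intro Y_lower_tail uxi_supp) auto
    thus "p1 \<le> prob {\<omega> \<in> space M. \<theta> 1 \<le> xi (v @ [a]) \<omega>}" by (simp add: p1 \<theta>_def)
  next
    fix v a assume v: "2 \<le> length v" "length v < J" "valid (boxF r n) (v @ [a])"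
    have "W \<le> V (uxi (v @ [a]))" using V_uxi_ge[OF v(3)] W(2)[of "length v"] v by force
    hence "p \<le> prob {\<omega> \<in> space M. t \<le> xi (v @ [a]) \<omega>}"
      unfolding p(1) using W(1) v J2 t by (intro Y_lower_tail uxi_supp) auto
    thus "p \<le> prob {\<omega> \<in> space M. \<theta> (length v) \<le> xi (v @ [a]) \<omega>}" using v by (simp add: \<theta>_def)
  qed
  have fin_box: "finite (box_l N l)" by (simp add: box_l_def box_def)
  have \<kappa>: "\<kappa> \<ge> 0" "\<kappa> \<le> 1" using C4 small by (auto simp: \<kappa>_def C4_def)
  have sum_\<theta>: "(\<Sum>k\<in>{1..<J}. \<theta> k) = real (J - 2) * t"
  proof -
    have "{1..<J} = insert 1 {2..<J}" using J2 by auto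
    hence "(\<Sum>k\<in>{1..<J}. \<theta> k) = (\<Sum>k\<in>{2..<J}. \<theta> k)" by (simp add: \<theta>_def)
    also have "\<dots> = (\<Sum>k\<in>{2..<J}. t)" by (intro sum.cong) (auto simp: \<theta>_def)
    finally show ?thesis by simp
  qed
  have "prob A \<le> exp (- real (card (boxF r n 0)) * (p1 / 8) * (1 - exp (- \<kappa>))) + (real J + 1) * (real N)\<^sup>2 * exp (- e\<^sup>2 / (2 * (8 * C + 1)))"
  proof (rule few_thick_points_bound[where \<theta> = \<theta> and \<tau> = e and e = e and d = "J - 1" and T = T and S = "box_l N l" and m = m])
    show "T \<le> (\<Sum>k\<in>{1..<J}. \<theta> k) - e - (real J + 1) * e" using T unfolding sum_\<theta> by (simp add: algebra_simps)
    fix A' assume "A' \<subseteq> boxF r n 0"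
    thus "prob {\<omega> \<in> space M. \<forall>a\<in>A'. xi [a] \<omega> < - e} \<le> exp (- \<kappa> * real (card A'))"
      unfolding \<kappa>_def C4_def using root_increments_not_all_low e by blast
  next
    fix v assume v: "valid (boxF r n) v" "length v = J"
    hence "\<bar>gr (dom v) (ctr v) (ctr v) - 2 / pi * ln (real (r J))\<bar> \<le> C" using green_ctr[OF v(1)] J2 by force
    thus "gr (dom v) (ctr v) (ctr v) \<le> 8 * C + 1" using rJ C0 by simp
  next
    fix v a assume "valid (boxF r n) (v @ [a])" "1 \<le> length v" "length v < J"
    from V_du_le[OF this] show "V (du v a) \<le> 8 * C + 1" by simp
  next
    fix \<omega> assume "\<omega> \<in> A"
    thus "\<omega> \<in> space M \<and> card {x \<in> box_l N l. T \<le> Phi x \<omega>} < m" using A by simp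
  qed (use J2 e succ p1_bounds \<kappa> C0 fin_box root_box_l in auto)
  also have "exp (- real (card (boxF r n 0)) * (p1 / 8) * (1 - exp (- \<kappa>))) \<le> exp (- (p1 / (32 * (K1 + 2 * C + 3))) * e\<^sup>2)"
  proof -
    have "\<kappa> / 2 \<le> 1 - exp (- \<kappa>)" using exp_neg_le_half[OF \<kappa>] by simp
    hence "real n * (p1 / 8) * (\<kappa> / 2) \<le> real n * (p1 / 8) * (1 - exp (- \<kappa>))"
      using p1_bounds by (intro mult_left_mono) auto
    moreover have "real n * (p1 / 8) * (\<kappa> / 2) = p1 / (32 * C4) * e\<^sup>2"
      using n1 C4 by (simp add: \<kappa>_def)
    ultimately have "p1 / (32 * C4) * e\<^sup>2 \<le> real n * (p1 / 8) * (1 - exp (- \<kappa>))" by (simp only:)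
    thus ?thesis unfolding card_boxF_0[of r n, OF r1] C4_def by simp
  qed
  finally show ?thesis by simp
qed

end

section \<open>Asymptotics\<close>

text \<open>Here L is ln N, a L the threshold of one generation and b L - d a lower bound for the
  variance of an increment. The limit is the power of 1 / N that one generation costs.\<close>

lemma tail_exponent_limit:
  assumes "a > 0" "b > (0::real)"
  shows "((\<lambda>L. ((a * L / sqrt (b * L - d) + 1)\<^sup>2 / 2 + c) / L) \<longlongrightarrow> a\<^sup>2 / (2 * b)) at_top"
proof -
  have "((\<lambda>L. ((a * L / sqrt (b * L - d) + 1)\<^sup>2 / 2 + c) / L) \<longlongrightarrow> (a * inverse (b powr (1 / 2)))\<^sup>2 / 2) at_top"
    using assms by real_asymp
  moreover have "(x * inverse t)\<^sup>2 / 2 = x\<^sup>2 / (2 * t\<^sup>2)" for x t :: real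
    by (simp only: divide_inverse[symmetric] power_divide divide_divide_eq_left mult.commute[of 2])
  moreover have "(b powr (1 / 2))\<^sup>2 = b" using assms by (simp add: powr_half_sqrt)
  ultimately show ?thesis by simp
qed

lemma eventually_powr_plus_one_le:
  assumes "X < Y" "(0::real) < Y" "c > 0"
  shows "\<forall>\<^sub>F N::real in at_top. N powr X + 1 \<le> c * N powr Y"
proof -
  have 1: "((\<lambda>N::real. N powr (X - Y)) \<longlongrightarrow> 0) at_top" "((\<lambda>N::real. N powr (- Y)) \<longlongrightarrow> 0) at_top"
    using assms by (real_asymp, real_asymp)
  have "((\<lambda>N::real. N powr (X - Y) + N powr (- Y)) \<longlongrightarrow> 0 + 0) at_top"
    by (intro tendsto_add 1)
  hence "\<forall>\<^sub>F N::real in at_top. N powr (X - Y) + N powr (- Y) < c"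
    using assms(3) by (intro order_tendstoD(2)) simp_all
  thus ?thesis
    using eventually_gt_at_top[of 0]
  proof eventually_elim
    case (elim N)
    have "N powr X + 1 = (N powr (X - Y) + N powr (- Y)) * N powr Y"
      using elim(2) by (simp add: distrib_right powr_add[symmetric])
    also have "\<dots> \<le> c * N powr Y" using elim(1) by (intro mult_right_mono) auto
    finally show ?case .
  qed
qed

lemma eventually_exp_square_dominates:
  assumes "c > (0::real)"
  shows "\<forall>\<^sub>F L in at_top. exp (- 2 * c * L\<^sup>2) * (1 + j * exp (2 * L)) \<le> exp (- c * L\<^sup>2)"
  using assms by real_asymp

lemma eventually_ln_square_le_powr:
  assumes "a > (0::real)" "b > 0"
  shows "\<forall>\<^sub>F N in at_top. (c * (ln N)\<^sup>2) / (a * N powr b) \<le> 1"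
  using assms by real_asymp

section \<open>Points in the bulk and uniform Green function estimates\<close>

lemma box_l_coords:
  assumes "x \<in> box_l N l" "N \<ge> 1"
  shows "l * real N \<le> fst x" "l * real N \<le> real N + 1 - fst x" "l * real N \<le> snd x" "l * real N \<le> real N + 1 - snd x"
proof -
  have b: "1 \<le> fst x" "fst x \<le> int N" "1 \<le> snd x" "snd x \<le> int N"
    using assms by (auto simp: box_l_def box_def)
  have d: "l * real N \<le> ptdist x z" if "z \<notin> box N" for z
    using assms(1) that unfolding box_l_def by blast
  show "l * real N \<le> fst x" using d[of "(0, snd x)"] b by (simp add: ptdist_def box_def)
  show "l * real N \<le> real N + 1 - fst x" using d[of "(int N + 1, snd x)"] b by (simp add: ptdist_def box_def)
  show "l * real N \<le> snd x" using d[of "(fst x, 0)"] b by (simp add: ptdist_def box_def)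
  show "l * real N \<le> real N + 1 - snd x" using d[of "(fst x, int N + 1)"] b by (simp add: ptdist_def box_def)
qed

lemma in_box_lI:
  fixes x :: pt
  assumes "l * real N \<le> fst x" "l * real N \<le> real N + 1 - fst x" "l * real N \<le> snd x" "l * real N \<le> real N + 1 - snd x"
    and "l * real N > 0"
  shows "x \<in> box_l N l"
proof -
  have "0 < fst x" "fst x < int N + 1" "0 < snd x" "snd x < int N + 1" using assms by linarith+
  hence b: "x \<in> box N" by (cases x) (auto simp: box_def)
  have "l * real N \<le> ptdist x z" if z: "z \<notin> box N" for z
  proof -
    have "fst z \<le> 0 \<or> fst z \<ge> int N + 1 \<or> snd z \<le> 0 \<or> snd z \<ge> int N + 1"
      using z by (cases z) (auto simp: box_def)
    hence "l * real N \<le> \<bar>real_of_int (fst x - fst z)\<bar> \<or> l * real N \<le> \<bar>real_of_int (snd x - snd z)\<bar>"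
      using assms(1-4) by (elim disjE) linarith+
    moreover have "\<bar>real_of_int (fst x - fst z)\<bar> \<le> ptdist x z" "\<bar>real_of_int (snd x - snd z)\<bar> \<le> ptdist x z"
      unfolding ptdist_def by (intro real_le_rsqrt; simp)+
    ultimately show ?thesis by linarith
  qed
  thus ?thesis using b by (simp add: box_l_def)
qed

lemma in_intr: "x \<in> intr N \<longleftrightarrow> 2 \<le> fst x \<and> fst x \<le> int N - 1 \<and> 2 \<le> snd x \<and> snd x \<le> int N - 1"
  by (cases x) (auto simp: intr_def bdry_def box_def nbrs_def)

lemma box_l_subset_intr:
  assumes "x \<in> box_l N l" "l * real N > 1" "N \<ge> 1"
  shows "x \<in> intr N"
  using box_l_coords[OF assms(1,3)] assms(2) unfolding in_intr by linarith

lemma green_estimate_obtain: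
  assumes "\<kappa> > 0"
  obtains C where "\<And>D \<rho> x y. finite D \<Longrightarrow> \<rho> \<ge> 1 \<Longrightarrow> x \<in> D \<Longrightarrow> y \<in> D \<Longrightarrow>
     (\<And>z. \<bar>real_of_int (fst z - fst y)\<bar> < \<kappa> * \<rho> \<Longrightarrow> \<bar>real_of_int (snd z - snd y)\<bar> < \<kappa> * \<rho> \<Longrightarrow> z \<in> D) \<Longrightarrow>
     (\<And>z. z \<in> D \<Longrightarrow> \<bar>real_of_int (fst z - fst y)\<bar> \<le> \<rho> / \<kappa> \<and> \<bar>real_of_int (snd z - snd y)\<bar> \<le> \<rho> / \<kappa>) \<Longrightarrow>
     \<bar>gr D x y - 2 / pi * (ln \<rho> - lf (x - y))\<bar> \<le> C"
proof -
  obtain C where C: "\<forall>D \<rho> x y. finite D \<and> \<rho> \<ge> 1 \<and> x \<in> D \<and> y \<in> D \<and>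
     (\<forall>z. \<bar>real_of_int (fst z - fst y)\<bar> < \<kappa> * \<rho> \<and> \<bar>real_of_int (snd z - snd y)\<bar> < \<kappa> * \<rho> \<longrightarrow> z \<in> D) \<and>
     (\<forall>z\<in>D. \<bar>real_of_int (fst z - fst y)\<bar> \<le> \<rho> / \<kappa> \<and> \<bar>real_of_int (snd z - snd y)\<bar> \<le> \<rho> / \<kappa>) \<longrightarrow>
     \<bar>gr D x y - 2 / pi * (ln \<rho> - lf (x - y))\<bar> \<le> C"
    using green_estimate[OF assms] by (rule exE)
  show ?thesis
    by (rule that[of C], rule C[rule_format]) (intro conjI allI impI ballI; (elim conjE)?; simp)
qed

lemma green_box_estimate:
  assumes l: "0 < l" "l < 1/2"
  shows "\<exists>C. \<forall>N x y. 2 / l \<le> real N \<longrightarrow> x \<in> intr N \<longrightarrow> y \<in> intr N \<longrightarrow> y \<in> box_l N l \<longrightarrow>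
    \<bar>gr (intr N) x y - 2 / pi * (ln (real N) - lf (x - y))\<bar> \<le> C"
proof -
  \<comment> \<open>Half of \<open>l\<close>, because \<open>intr N\<close> is one layer smaller
    than the box; \<open>l * N \<ge> 2\<close> pays for this layer.\<close>
  have l2: "l / 2 > 0" using l by simp
  obtain C where C: "\<And>D \<rho> x y. finite D \<Longrightarrow> \<rho> \<ge> 1 \<Longrightarrow> x \<in> D \<Longrightarrow> y \<in> D \<Longrightarrow>
     (\<And>z. \<bar>real_of_int (fst z - fst y)\<bar> < l / 2 * \<rho> \<Longrightarrow> \<bar>real_of_int (snd z - snd y)\<bar> < l / 2 * \<rho> \<Longrightarrow> z \<in> D) \<Longrightarrow>
     (\<And>z. z \<in> D \<Longrightarrow> \<bar>real_of_int (fst z - fst y)\<bar> \<le> \<rho> / (l / 2) \<and> \<bar>real_of_int (snd z - snd y)\<bar> \<le> \<rho> / (l / 2)) \<Longrightarrow>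
     \<bar>gr D x y - 2 / pi * (ln \<rho> - lf (x - y))\<bar> \<le> C"
    by (rule green_estimate_obtain[OF l2]) blast
  show ?thesis
  proof (intro exI[of _ C] allI impI)
    fix N x y assume N: "2 / l \<le> real N" and x: "x \<in> intr N" and y: "y \<in> intr N" "y \<in> box_l N l"
    have lN: "l * real N \<ge> 2" using N l by (simp add: pos_divide_le_eq mult.commute)
    hence N1: "N \<ge> 1" by (cases N) auto
    note yc = box_l_coords[OF y(2) N1]
    show "\<bar>gr (intr N) x y - 2 / pi * (ln (real N) - lf (x - y))\<bar> \<le> C"
    proof (intro C)
      fix z assume "\<bar>real_of_int (fst z - fst y)\<bar> < l / 2 * real N" "\<bar>real_of_int (snd z - snd y)\<bar> < l / 2 * real N"
      thus "z \<in> intr N" using yc lN unfolding in_intr by linarith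
    next
      fix z assume z: "z \<in> intr N"
      have "real N * (l / 2) \<le> real N * 1" using l by (intro mult_left_mono) auto
      hence "real N \<le> real N / (l / 2)" using l2 by (simp only: pos_le_divide_eq mult_1_right)
      moreover have "\<bar>real_of_int (fst z - fst y)\<bar> \<le> real N" "\<bar>real_of_int (snd z - snd y)\<bar> \<le> real N"
        using z y(1) unfolding in_intr by linarith+
      ultimately show "\<bar>real_of_int (fst z - fst y)\<bar> \<le> real N / (l / 2) \<and> \<bar>real_of_int (snd z - snd y)\<bar> \<le> real N / (l / 2)"
        by linarith
    qed (use N1 x y in auto)
  qed
qed

lemma green_Qb_estimate:
  "\<exists>C. \<forall>c R x y. R \<ge> 1 \<longrightarrow> x \<in> Qb c R \<longrightarrow> y \<in> Qb c R \<longrightarrow> 4 * \<bar>fst y - fst c\<bar> \<le> int R \<longrightarrow> 4 * \<bar>snd y - snd c\<bar> \<le> int R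
       \<longrightarrow> \<bar>gr (Qb c R) x y - 2 / pi * (ln (real R) - lf (x - y))\<bar> \<le> C"
proof -
  \<comment> \<open>A point within R / 2 of \<open>y\<close> is within 3 R / 4 of the centre, as
    \<open>y\<close> is within R / 4 of it.\<close>
  have h: "(1 / 2 :: real) > 0" by simp
  obtain C where C: "\<And>D \<rho> x y. finite D \<Longrightarrow> \<rho> \<ge> 1 \<Longrightarrow> x \<in> D \<Longrightarrow> y \<in> D \<Longrightarrow>
     (\<And>z. \<bar>real_of_int (fst z - fst y)\<bar> < 1 / 2 * \<rho> \<Longrightarrow> \<bar>real_of_int (snd z - snd y)\<bar> < 1 / 2 * \<rho> \<Longrightarrow> z \<in> D) \<Longrightarrow>
     (\<And>z. z \<in> D \<Longrightarrow> \<bar>real_of_int (fst z - fst y)\<bar> \<le> \<rho> / (1 / 2) \<and> \<bar>real_of_int (snd z - snd y)\<bar> \<le> \<rho> / (1 / 2)) \<Longrightarrow>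
     \<bar>gr D x y - 2 / pi * (ln \<rho> - lf (x - y))\<bar> \<le> C"
    by (rule green_estimate_obtain[OF h]) blast
  show ?thesis
  proof (intro exI[of _ C] allI impI)
    fix c R x y assume R: "R \<ge> 1" and x: "x \<in> Qb c R" and y: "y \<in> Qb c R"
      and yc: "4 * \<bar>fst y - fst c\<bar> \<le> int R" "4 * \<bar>snd y - snd c\<bar> \<le> int R"
    have yc': "4 * \<bar>real_of_int (fst y - fst c)\<bar> \<le> real R" "4 * \<bar>real_of_int (snd y - snd c)\<bar> \<le> real R"
      using yc by linarith+
    show "\<bar>gr (Qb c R) x y - 2 / pi * (ln (real R) - lf (x - y))\<bar> \<le> C"
    proof (intro C)
      fix z assume z: "\<bar>real_of_int (fst z - fst y)\<bar> < 1 / 2 * real R" "\<bar>real_of_int (snd z - snd y)\<bar> < 1 / 2 * real R"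
      have gen: "\<bar>A + B\<bar> < R'" if "\<bar>A\<bar> < 1 / 2 * R'" "4 * \<bar>B\<bar> \<le> R'" "R' \<ge> 1" for A B R' :: real
        using that by linarith
      have "real R \<ge> 1" using R by simp
      from gen[OF z(1) yc'(1) this] gen[OF z(2) yc'(2) this]
      have "\<bar>real_of_int (fst z - fst c)\<bar> < real R" "\<bar>real_of_int (snd z - snd c)\<bar> < real R"
        by simp_all
      hence "real_of_int \<bar>fst z - fst c\<bar> < real_of_int (int R)" "real_of_int \<bar>snd z - snd c\<bar> < real_of_int (int R)"
        by simp_all
      thus "z \<in> Qb c R" unfolding in_Qb of_int_less_iff by blast
    next
      fix z assume z: "z \<in> Qb c R"
      have h2: "real R / (1 / 2) = 2 * real R" by simp
      show "\<bar>real_of_int (fst z - fst y)\<bar> \<le> real R / (1 / 2) \<and> \<bar>real_of_int (snd z - snd y)\<bar> \<le> real R / (1 / 2)"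
        unfolding h2 using y z unfolding in_Qb abs_less_iff abs_le_iff by linarith
    qed (use R x y in auto)
  qed
qed

text \<open>The row starts at the centre of the box. Between N / 2 and l N there is room 2 \<kappa>
  N; the row takes \<kappa> N, the radius \<kappa> N / 2, and the rest covers rounding.\<close>

lemma root_boxes_in_bulk:
  fixes N n R i :: nat
  assumes l: "0 < l" "l < 1/2" and \<kappa>: "\<kappa> = (1/2 - l) / 2"
    and nR: "2 * real R * real n \<le> \<kappa> * real N" and R: "real R \<le> \<kappa> * real N / 2" and N: "2 / \<kappa> \<le> real N" "2 / l \<le> real N"
    and i: "i \<in> {1..n}"
  shows "Qb ((int (N div 2), int (N div 2)) + (2 * int R * int i, 0)) R \<subseteq> box_l N l \<inter> intr N"
proof
  fix z assume z: "z \<in> Qb ((int (N div 2), int (N div 2)) + (2 * int R * int i, 0)) R"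
  have \<kappa>0: "\<kappa> > 0" using l \<kappa> by simp
  have lN: "l * real N \<ge> 2" using N l by (simp add: pos_divide_le_eq mult.commute)
  have kN: "\<kappa> * real N \<ge> 2" using N \<kappa>0 by (simp add: pos_divide_le_eq mult.commute)
  have lk: "l * real N = real N / 2 - 2 * (\<kappa> * real N)" by (simp add: \<kappa> field_simps)
  have h: "real N / 2 - 1/2 \<le> real (N div 2)" "real (N div 2) \<le> real N / 2" by linarith+
  have "2 * real R * real i \<le> 2 * real R * real n" using i by (intro mult_left_mono) auto
  hence iR: "2 * real R * real i \<le> \<kappa> * real N" "0 \<le> 2 * real R * real i" using nR by auto
  have "\<bar>fst z - (int (N div 2) + 2 * int R * int i)\<bar> < int R" "\<bar>snd z - int (N div 2)\<bar> < int R"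
    using z by (auto simp: in_Qb)
  hence "real_of_int \<bar>fst z - (int (N div 2) + 2 * int R * int i)\<bar> < real_of_int (int R)" "real_of_int \<bar>snd z - int (N div 2)\<bar> < real_of_int (int R)"
    by (simp_all only: of_int_less_iff)
  hence "\<bar>real_of_int (fst z) - (real (N div 2) + 2 * real R * real i)\<bar> < real R" "\<bar>real_of_int (snd z) - real (N div 2)\<bar> < real R"
    by simp_all
  hence "l * real N \<le> fst z" "l * real N \<le> real N + 1 - fst z" "l * real N \<le> snd z" "l * real N \<le> real N + 1 - snd z"
    using h iR R kN lk by linarith+
  hence b: "z \<in> box_l N l" using lN by (intro in_box_lI) auto
  moreover have "N \<ge> 1" using lN by (cases N) auto
  ultimately show "z \<in> box_l N l \<inter> intr N" using box_l_subset_intr[OF b] lN by simp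
qed

lemma nat_floor_ge_half:
  fixes x :: real
  assumes "x \<ge> 1"
  shows "x / 2 \<le> real (nat \<lfloor>x\<rfloor>)" "real (nat \<lfloor>x\<rfloor>) \<le> x" "1 \<le> nat \<lfloor>x\<rfloor>"
proof -
  have f: "real (nat \<lfloor>x\<rfloor>) = real_of_int \<lfloor>x\<rfloor>" using assms by simp
  show "real (nat \<lfloor>x\<rfloor>) \<le> x" unfolding f by simp
  have "1 \<le> \<lfloor>x\<rfloor>" using assms by simp
  hence "1 \<le> real_of_int \<lfloor>x\<rfloor>" "x - 1 \<le> real_of_int \<lfloor>x\<rfloor>" by linarith+
  thus "x / 2 \<le> real (nat \<lfloor>x\<rfloor>)" "1 \<le> nat \<lfloor>x\<rfloor>" using f by linarith+
qed

text \<open>Consecutive exact radii have ratio z; rounding down costs a factor 2. After division by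
  8 the ratio is at least z / 16, and since z is at least 32 the integer division costs another
  factor 2. This gives at least (z / 32)^2 = z^2 / 1024 children.\<close>

lemma radii:
  fixes N J :: nat and z :: real and r :: "nat \<Rightarrow> nat"
  assumes J: "J \<ge> 1" and z: "z = real N powr (1 / real J)" "z \<ge> 32"
    and r_def: "r = (\<lambda>k. nat \<lfloor>real N powr (1 - real k / real J)\<rfloor>)"
  shows "k \<le> J \<Longrightarrow> r k \<ge> 1" "r J = 1" "real (r 1) * z \<le> real N"
    and "k < J \<Longrightarrow> r k \<ge> 8 * r (Suc k)"
    and "k < J \<Longrightarrow> z\<^sup>2 / 1024 \<le> real ((r k div (8 * r (Suc k)))\<^sup>2)"
    and "k < J \<Longrightarrow> ln (real N) / real J - ln 2 \<le> ln (real (r k)) - ln (real (r (Suc k)))"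
proof -
  have N: "real N \<ge> 1" using z by (cases N) auto
  define P where "P = (\<lambda>k. real N powr (1 - real k / real J))"
  have r: "r k = nat \<lfloor>P k\<rfloor>" for k by (simp add: r_def P_def)
  have P1: "P k \<ge> 1" if "k \<le> J" for k
    unfolding P_def using N J that by (intro ge_one_powr_ge_zero) auto
  have PS: "P k = z * P (Suc k)" for k
    using J N by (simp add: P_def z powr_add[symmetric] add_divide_distrib)
  note fl = nat_floor_ge_half[OF P1]
  show r1: "r k \<ge> 1" if "k \<le> J" for k using fl(3)[OF that] by (simp add: r)
  show "r J = 1" using J N by (simp add: r_def)
  have "real (r 1) * z \<le> P 1 * z" using fl(2)[OF J] z by (intro mult_right_mono) (auto simp: r)
  also have "\<dots> = P 0" using PS[of 0] by simp
  also have "\<dots> = real N" using N by (simp add: P_def)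
  finally show "real (r 1) * z \<le> real N" .
  have ratio: "z / 2 * real (r (Suc k)) \<le> real (r k)" if "k < J" for k
  proof -
    have "z / 2 * real (r (Suc k)) \<le> z / 2 * P (Suc k)" using fl(2)[of "Suc k"] that z by (intro mult_left_mono) (auto simp: r)
    also have "\<dots> = P k / 2" by (simp add: PS[of k])
    also have "\<dots> \<le> real (r k)" using fl(1)[of k] that by (simp add: r)
    finally show ?thesis .
  qed
  show "r k \<ge> 8 * r (Suc k)" if "k < J" for k
  proof -
    have "8 * real (r (Suc k)) \<le> z / 2 * real (r (Suc k))" using z by (intro mult_right_mono) auto
    hence "real (8 * r (Suc k)) \<le> real (r k)" using ratio[OF that] by simp
    thus ?thesis by (simp only: of_nat_le_iff)
  qed
  show "z\<^sup>2 / 1024 \<le> real ((r k div (8 * r (Suc k)))\<^sup>2)" if k: "k < J" for k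
  proof -
    have p: "real (r (Suc k)) > 0" using r1[of "Suc k"] k by simp
    have "z / 16 \<le> real (r k) / real (8 * r (Suc k))"
      using ratio[OF k] p by (simp add: pos_le_divide_eq)
    moreover have "real (r k) / real (8 * r (Suc k)) - real (r k div (8 * r (Suc k))) \<le> 1"
    proof -
      have "r k < (r k div (8 * r (Suc k)) + 1) * (8 * r (Suc k))"
        using div_less_iff_less_mult[of "8 * r (Suc k)" "r k" "r k div (8 * r (Suc k)) + 1"] p by simp
      hence "real (r k) < real ((r k div (8 * r (Suc k)) + 1) * (8 * r (Suc k)))" by (simp only: of_nat_less_iff)
      hence "real (r k) / real (8 * r (Suc k)) < real (r k div (8 * r (Suc k)) + 1)"
        using p by (simp only: of_nat_mult) (simp add: pos_divide_less_eq)
      thus ?thesis by simp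
    qed
    ultimately have "z / 32 \<le> real (r k div (8 * r (Suc k)))" using z by linarith
    hence "(z / 32)\<^sup>2 \<le> (real (r k div (8 * r (Suc k))))\<^sup>2" using z by (intro power_mono) auto
    thus ?thesis by (simp add: power_divide)
  qed
  show "ln (real N) / real J - ln 2 \<le> ln (real (r k)) - ln (real (r (Suc k)))" if k: "k < J" for k
  proof -
    have p: "real (r (Suc k)) > 0" using r1[of "Suc k"] k by simp
    have "ln (z / 2 * real (r (Suc k))) \<le> ln (real (r k))"
    proof (subst ln_le_cancel_iff)
      have "z > 0" using z(2) by simp
      thus "0 < z / 2 * real (r (Suc k))" using p by simp
      show "0 < real (r k)" using r1[of k] k by simp
    qed (rule ratio[OF k])
    moreover have "ln (z / 2 * real (r (Suc k))) = ln z - ln 2 + ln (real (r (Suc k)))"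
      using p z(2) by (subst ln_mult_pos) (auto simp: ln_div)
    moreover have "ln z = ln (real N) / real J" using N by (simp add: z(1) ln_powr)
    ultimately show ?thesis by linarith
  qed
qed

section \<open>Choice of exponents and the lower bound\<close>

lemma eventually_real_nat: "(\<forall>\<^sub>F x in at_top. P x) \<Longrightarrow> \<forall>\<^sub>F N in sequentially. P (real N)"
  using filterlim_real_sequentially by (simp add: filterlim_iff)

lemma eventually_ln_nat: "(\<forall>\<^sub>F x in at_top. P x) \<Longrightarrow> \<forall>\<^sub>F N in sequentially. P (ln (real N))"
  using filterlim_compose[OF ln_at_top filterlim_real_sequentially] by (simp add: filterlim_iff)

text \<open>Three slightly enlarged heights share the losses: \<eta>1 - \<eta> pays for the errors
  along a path, \<eta>2 - \<eta>1 for using only J - 2 of the J generations and for lower order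
  terms in the Gaussian tail, and \<eta>2 - \<eta> lowers the exponent by at most \<delta> /
  4.\<close>

lemma few_thick_points_gff:
  fixes M :: "nat \<Rightarrow> 'a measure" and Phi :: "nat \<Rightarrow> pt \<Rightarrow> 'a \<Rightarrow> real" and l \<eta> \<delta> :: real
  assumes gff: "\<And>N. N \<ge> 1 \<Longrightarrow> is_GFF (M N) N (Phi N)"
    and l: "0 < l" "l < 1/2" and eta: "0 < \<eta>" "\<eta> < 1" and \<delta>: "\<delta> > 0"
  shows "\<exists>c>0. \<forall>\<^sub>F N in sequentially.
            measure (M N) {\<omega> \<in> space (M N).
               real (card (thick N l \<eta> (Phi N) \<omega>)) \<le> real N powr (2 * (1 - \<eta>\<^sup>2) - \<delta>)}
            \<le> exp (- c * (ln (real N))\<^sup>2)"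
proof -
  \<comment> \<open>The first bound keeps \<eta>2 below 1. With the second, \<eta>2^2 - \<eta>^2 = h
    (2 \<eta> + h) is at most 3 \<delta> / 32.\<close>
  define h where "h = min ((1 - \<eta>) / 2) (\<delta> / 32)"
  have h: "h > 0" "h \<le> (1 - \<eta>) / 2" "h \<le> \<delta> / 32"
  proof -
    show "h > 0" using eta \<delta> by (simp add: h_def)
    show "h \<le> (1 - \<eta>) / 2" unfolding h_def by (rule min.cobounded1)
    show "h \<le> \<delta> / 32" unfolding h_def by (rule min.cobounded2)
  qed
  define \<eta>1 \<eta>2 where "\<eta>1 = \<eta> + h / 2" and "\<eta>2 = \<eta> + h"
  have e12: "0 < \<eta>1" "\<eta> < \<eta>1" "\<eta>1 < \<eta>2" "\<eta>2 < 1" using h eta by (auto simp: \<eta>1_def \<eta>2_def)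
  have e2sq: "\<eta>2\<^sup>2 \<le> \<eta>\<^sup>2 + \<delta> / 8" "\<eta>2\<^sup>2 < 1"
  proof -
    have "\<eta>2\<^sup>2 = \<eta>\<^sup>2 + h * (2 * \<eta> + h)" by (simp add: \<eta>2_def power2_eq_square algebra_simps)
    also have "h * (2 * \<eta> + h) \<le> \<delta> / 32 * 3" using h eta by (intro mult_mono) auto
    finally show "\<eta>2\<^sup>2 \<le> \<eta>\<^sup>2 + \<delta> / 8" using \<delta> by simp
    show "\<eta>2\<^sup>2 < 1" using e12 eta h by (simp add: power_less_one_iff \<eta>2_def)
  qed
  \<comment> \<open>The three requirements: J - 2 is positive, the two generations without growth
    cost at most \<delta> / 4 in the exponent, and \<eta>1 J / (J - 2) stays below \<eta>2.\<close>
  obtain J :: nat where "real J > max 3 (max (16 / \<delta>) (2 / (\<eta>2 - \<eta>1)))" using reals_Archimedean2 by blast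
  hence J: "J \<ge> 3" "real J \<ge> 16 / \<delta>" "real J > 2 / (\<eta>2 - \<eta>1)" by auto
  have Jm2: "real (J - 2) = real J - 2" "real (J - 2) > 0" using J by (auto simp: of_nat_diff)
  define \<kappa> where "\<kappa> = (1/2 - l) / 2"
  have \<kappa>: "\<kappa> > 0" "\<kappa> \<le> 1" using l by (auto simp: \<kappa>_def)
  obtain CD where CD: "\<And>N x y. 2 / l \<le> real N \<Longrightarrow> x \<in> intr N \<Longrightarrow> y \<in> intr N \<Longrightarrow> y \<in> box_l N l \<Longrightarrow>
    \<bar>gr (intr N) x y - 2 / pi * (ln (real N) - lf (x - y))\<bar> \<le> CD"
    using green_box_estimate[OF l] by metis
  obtain CB where CB: "\<And>c R x y. R \<ge> 1 \<Longrightarrow> x \<in> Qb c R \<Longrightarrow> y \<in> Qb c R \<Longrightarrow> 4 * \<bar>fst y - fst c\<bar> \<le> int R \<Longrightarrow> 4 * \<bar>snd y - snd c\<bar> \<le> int R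
       \<Longrightarrow> \<bar>gr (Qb c R) x y - 2 / pi * (ln (real R) - lf (x - y))\<bar> \<le> CB"
    using green_Qb_estimate by metis
  define C where "C = max 0 (max CD CB)"
  have C: "C \<ge> 0" "CD \<le> C" "CB \<le> C" by (auto simp: C_def)
  define K1 where "K1 = ln (4 / \<kappa>)"
  have K1: "K1 \<ge> 0" unfolding K1_def using \<kappa> by (intro ln_ge_zero) (simp add: pos_le_divide_eq)
  define C4 where "C4 = K1 + 2 * C + 3"
  have C4: "C4 > 0" using K1 C by (simp add: C4_def)
  define G where "G = 2 * sqrt (2 / pi)"
  have G: "G > 0" "G\<^sup>2 = 8 / pi" by (auto simp: G_def power_mult_distrib)
  \<comment> \<open>J - 2 increments of size a L add up to the height of level \<eta>1.\<close>
  define a where "a = G * \<eta>1 / real (J - 2)"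
  define b where "b = 2 / pi / real J"
  define d where "d = 2 / pi * ln 2 + 2 * C"
  have ab: "a > 0" "b > 0" using G e12 J Jm2 by (auto simp: a_def b_def)
  \<comment> \<open>The J + 2 errors of size \<epsilon> L use up exactly the gap between levels
    \<eta>1 and \<eta>.\<close>
  define \<epsilon> where "\<epsilon> = G * (\<eta>1 - \<eta>) / (real J + 2)"
  have \<epsilon>: "\<epsilon> > 0" using G e12 by (simp add: \<epsilon>_def)
  define p1 :: real where "p1 = exp (- 1 / 2) / sqrt (2 * pi)"
  have p1: "p1 > 0" by (simp add: p1_def)
  define X where "X = 2 * (1 - \<eta>\<^sup>2) - \<delta>"
  \<comment> \<open>Growth exponent of one generation: N^(2 / J) children up to a constant, each
    passing with probability at least N^(-2 \<eta>2^2 / J).\<close>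
  define u where "u = 2 * (1 - \<eta>2\<^sup>2) / real J"
  define Yx where "Yx = u * real (J - 2)"
  have u: "u > 0" using e2sq J by (simp add: u_def)
  have Y0: "Yx > 0" using u Jm2 by (simp add: Yx_def)
  have XY: "X < Yx"
  proof -
    have "4 / real J \<le> \<delta> / 4" using J \<delta> by (simp add: field_simps)
    moreover have "Yx = 2 * (1 - \<eta>2\<^sup>2) - (1 - \<eta>2\<^sup>2) * (4 / real J)"
      using J Jm2 by (simp add: Yx_def u_def field_simps)
    moreover have "(1 - \<eta>2\<^sup>2) * (4 / real J) \<le> 1 * (4 / real J)" using e2sq by (intro mult_right_mono) auto
    ultimately show ?thesis using e2sq(1) \<delta> unfolding X_def by simp
  qed
  \<comment> \<open>1 / 1024 is the constant in the number of children, and 2048 = 2 * 1024 comes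
    from the factor p B / 2 per generation.\<close>
  define c5 where "c5 = p1 / 8 * (1 / 1024) / 2048 ^ (J - 2)"
  have c5: "c5 > 0" using p1 by (simp add: c5_def)
  \<comment> \<open>With G^2 = 8 / pi and b = 2 / (pi J) the cost is 2 (\<eta>1 J / (J - 2))^2 / J;
    here the normalisation of the height by 2 sqrt (2 / pi) meets the variance of an
    increment.\<close>
  have limit: "a\<^sup>2 / (2 * b) < 2 * \<eta>2\<^sup>2 / real J"
  proof -
    have "a\<^sup>2 / (2 * b) = 2 * (\<eta>1 * real J / real (J - 2))\<^sup>2 / real J"
    proof -
      have "a\<^sup>2 = 8 / pi * \<eta>1\<^sup>2 / (real (J - 2))\<^sup>2" by (simp add: a_def power_divide power_mult_distrib G)
      moreover have "real J \<noteq> 0" using J by simp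
      ultimately show ?thesis
        unfolding b_def power_divide power_mult_distrib by (simp add: power2_eq_square)
    qed
    moreover have "\<eta>1 * real J / real (J - 2) < \<eta>2"
    proof -
      have "2 < real J * (\<eta>2 - \<eta>1)" using J(3) e12 by (simp add: pos_divide_less_eq)
      hence "\<eta>1 * real J < \<eta>2 * (real J - 2)" using e12 by (simp add: algebra_simps)
      thus ?thesis using Jm2 by (simp add: pos_divide_less_eq)
    qed
    hence "(\<eta>1 * real J / real (J - 2))\<^sup>2 < \<eta>2\<^sup>2" using e12 by (intro power_strict_mono) auto
    ultimately show ?thesis using J by (simp add: divide_strict_right_mono)
  qed
  define c1 c2 where "c1 = p1 / (32 * C4) * \<epsilon>\<^sup>2" and "c2 = \<epsilon>\<^sup>2 / (2 * (8 * C + 1))"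
  \<comment> \<open>Half of the available rate; the other half absorbs the factor 1 + (J + 1)
    N^2.\<close>
  define c where "c = min c1 c2 / 2"
  have c: "c > 0" "2 * c \<le> c1" "2 * c \<le> c2" using p1 C4 \<epsilon> C by (auto simp: c_def c1_def c2_def)
  have ev1: "\<forall>\<^sub>F N in sequentially. max 32 (2 / \<kappa>) \<le> real N powr (1 / real J)"
  proof (rule eventually_real_nat)
    have "0 < 1 / real J" using J by simp
    hence "filterlim (\<lambda>N::real. N powr (1 / real J)) at_top at_top" by real_asymp
    thus "\<forall>\<^sub>F N in at_top. max 32 (2 / \<kappa>) \<le> N powr (1 / real J)" by (simp only: filterlim_at_top)
  qed
  have ev2: "\<forall>\<^sub>F N in sequentially. max (2 / \<kappa>) (2 / l) \<le> real N"
    by (rule eventually_real_nat[OF eventually_ge_at_top])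
  have ev3: "\<forall>\<^sub>F N in sequentially. 0 < b * ln (real N) - d"
  proof (rule eventually_ln_nat)
    show "\<forall>\<^sub>F L in at_top. 0 < b * L - d" using ab by real_asymp
  qed
  have ev4: "\<forall>\<^sub>F N in sequentially. ((a * ln (real N) / sqrt (b * ln (real N) - d) + 1)\<^sup>2 / 2 + ln (sqrt (2 * pi))) / ln (real N) < 2 * \<eta>2\<^sup>2 / real J"
    by (rule eventually_ln_nat[OF order_tendstoD(2)[OF tail_exponent_limit[OF ab] limit]])
  \<comment> \<open>Since p B is at least N^u / 1024, this makes it at least 4, above the required
    2.\<close>
  have ev5: "\<forall>\<^sub>F N in sequentially. 4096 \<le> real N powr u"
  proof (rule eventually_real_nat)
    have "filterlim (\<lambda>N::real. N powr u) at_top at_top" using u by real_asymp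
    thus "\<forall>\<^sub>F N in at_top. 4096 \<le> N powr u" by (simp only: filterlim_at_top)
  qed
  have ev6: "\<forall>\<^sub>F N in sequentially. real N powr X + 1 \<le> c5 * real N powr Yx"
    by (rule eventually_real_nat[OF eventually_powr_plus_one_le[OF XY Y0 c5]])
  have "2 * C4 * (\<kappa> / 4) > 0" "1 / real J > 0" using C4 \<kappa> J by auto
  hence ev7: "\<forall>\<^sub>F N in sequentially. (\<epsilon>\<^sup>2 * (ln (real N))\<^sup>2) / (2 * C4 * (\<kappa> / 4) * real N powr (1 / real J)) \<le> 1"
    by (intro eventually_real_nat eventually_ln_square_le_powr)
  have ev8: "\<forall>\<^sub>F N in sequentially. exp (- 2 * c * (ln (real N))\<^sup>2) * (1 + (real J + 1) * exp (2 * ln (real N))) \<le> exp (- c * (ln (real N))\<^sup>2)"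
    by (rule eventually_ln_nat[OF eventually_exp_square_dominates[OF c(1)]])
  have "\<forall>\<^sub>F N in sequentially.
            measure (M N) {\<omega> \<in> space (M N). real (card (thick N l \<eta> (Phi N) \<omega>)) \<le> real N powr X}
            \<le> exp (- c * (ln (real N))\<^sup>2)"
    using ev1 ev2 ev3 ev4 ev5 ev6 ev7 ev8
  proof eventually_elim
    case (elim N)
    define z where "z = real N powr (1 / real J)"
    define L where "L = ln (real N)"
    have z: "z \<ge> 32" "z \<ge> 2 / \<kappa>" using elim(1) by (auto simp: z_def)
    have N: "real N \<ge> 2 / \<kappa>" "real N \<ge> 2 / l" using elim(2) by auto
    have "2 / l > 2" using l by (simp add: pos_less_divide_eq)
    hence N2: "real N > 2" using N by linarith
    hence L: "L > 0" "real N = exp L" "N \<ge> 1" by (auto simp: L_def)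
    define r where "r = (\<lambda>k. nat \<lfloor>real N powr (1 - real k / real J)\<rfloor>)"
    have J1: "J \<ge> 1" using J by simp
    note rad = radii[OF J1 z_def z(1) r_def]
    have r1: "real (r 1) > 0" using rad(1)[of 1] J1 by simp
    \<comment> \<open>The number of boxes of width 2 r(1) that fit into a row of length \<kappa> N,
      before rounding; it is of order at least N^(1 / J).\<close>
    define y where "y = \<kappa> * real N / (2 * real (r 1))"
    have yz: "y \<ge> \<kappa> * z / 2"
    proof -
      have "\<kappa> * (real (r 1) * z) \<le> \<kappa> * real N" using rad(3) \<kappa> by (intro mult_left_mono) auto
      thus ?thesis using r1 by (simp add: y_def pos_le_divide_eq mult_ac)
    qed
    have kz: "\<kappa> * z \<ge> 2" using z(2) \<kappa> by (simp add: pos_divide_le_eq mult.commute)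
    have y1: "y \<ge> 1" using yz kz by simp
    define n where "n = nat \<lfloor>y\<rfloor>"
    note fn = nat_floor_ge_half[OF y1, folded n_def]
    have nr: "2 * real (r 1) * real n \<le> \<kappa> * real N"
    proof -
      have "2 * real (r 1) * real n \<le> 2 * real (r 1) * y" using fn(2) r1 by (intro mult_left_mono) auto
      thus ?thesis using r1 by (simp add: y_def)
    qed
    have rk: "real (r 1) \<le> \<kappa> * real N / 2"
    proof -
      have "real (r 1) * 2 \<le> real (r 1) * (\<kappa> * z)" using kz by (intro mult_left_mono) auto
      also have "\<dots> = \<kappa> * (real (r 1) * z)" by simp
      also have "\<dots> \<le> \<kappa> * real N" using rad(3) \<kappa> by (intro mult_left_mono) auto
      finally show ?thesis by simp
    qed
    interpret gff_tree "M N" N "Phi N" l C K1 "(int (N div 2), int (N div 2))" r n J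
    proof
      show "is_GFF (M N) N (Phi N)" by (rule gff[OF L(3)])
      show "J \<ge> 2" using J by simp
      show "n \<ge> 1" by (rule fn(3))
      show "\<bar>gr (intr N) x y - 2 / pi * (ln (real N) - lf (x - y))\<bar> \<le> C" if "x \<in> intr N" "y \<in> intr N" "y \<in> box_l N l" for x y
        using CD[OF N(2) that] C(2) by linarith
      show "\<bar>gr (Qb c R) x y - 2 / pi * (ln (real R) - lf (x - y))\<bar> \<le> C"
        if "R \<ge> 1" "x \<in> Qb c R" "y \<in> Qb c R" "4 * \<bar>fst y - fst c\<bar> \<le> int R" "4 * \<bar>snd y - snd c\<bar> \<le> int R" for c R x y
        using CB[OF that] C(3) by linarith
      show "Qb ((int (N div 2), int (N div 2)) + (2 * int (r 1) * int i, 0)) (r 1) \<subseteq> box_l N l \<inter> intr N" if "i \<in> {1..n}" for i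
        by (rule root_boxes_in_bulk[OF l \<kappa>_def nr rk N that])
      have "ln (real N) \<le> ln (4 / \<kappa> * (real (r 1) * real n))"
      proof (subst ln_le_cancel_iff)
        have "\<kappa> * real N / (4 * real (r 1)) \<le> real n" using fn(1) by (simp add: y_def)
        thus "real N \<le> 4 / \<kappa> * (real (r 1) * real n)" using r1 \<kappa> by (simp add: field_simps)
      qed (use N2 \<kappa> r1 fn(3) in auto)
      also have "\<dots> = K1 + (ln (real (r 1)) + ln (real n))"
      proof -
        have "ln (s * (t * w)) = ln s + (ln t + ln w)" if "s > 0" "t > 0" "w > 0" for s t w :: real
          using that by (simp add: ln_mult_pos)
        moreover have "4 / \<kappa> > 0" "real n > 0" using \<kappa> fn(3) by auto
        ultimately show ?thesis unfolding K1_def using r1 by blast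
      qed
      finally show "ln (real N) \<le> ln (real (r 1)) + ln (real n) + K1" by simp
    qed (use rad K1 C in auto)
    define p where "p = exp (- (a * L / sqrt (b * L - d) + 1)\<^sup>2 / 2) / sqrt (2 * pi)"
    define B where "B = z\<^sup>2 / 1024"
    have sq: "sqrt (2 * pi) > 0" by simp
    have p_ge: "p \<ge> real N powr (- 2 * \<eta>2\<^sup>2 / real J)"
    proof -
      have "(a * L / sqrt (b * L - d) + 1)\<^sup>2 / 2 + ln (sqrt (2 * pi)) \<le> 2 * \<eta>2\<^sup>2 / real J * L"
        using elim(4) L(1) unfolding L_def[symmetric] by (simp add: pos_divide_less_eq)
      hence "exp (- (2 * \<eta>2\<^sup>2 / real J * L)) \<le> exp (- (a * L / sqrt (b * L - d) + 1)\<^sup>2 / 2 - ln (sqrt (2 * pi)))" by simp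
      also have "\<dots> = p" unfolding p_def by (simp add: exp_diff)
      finally show ?thesis using N2 by (simp add: powr_def L_def)
    qed
    have pB: "p * B \<ge> real N powr u / 1024"
    proof -
      have "z\<^sup>2 = real N powr (2 / real J)" using N2 by (simp add: z_def powr_power)
      hence "real N powr u / 1024 = real N powr (- 2 * \<eta>2\<^sup>2 / real J) * B"
        using J by (simp add: B_def u_def powr_add[symmetric] diff_divide_distrib right_diff_distrib)
      also have "\<dots> \<le> p * B" using p_ge by (intro mult_right_mono) (auto simp: B_def)
      finally show ?thesis .
    qed
    \<comment> \<open>For an integer count, being at most N^X is the same as being smaller than this
      m.\<close>
    define m where "m = nat \<lfloor>real N powr X\<rfloor> + 1"
    have "prob {\<omega> \<in> space (M N). real (card (thick N l \<eta> (Phi N) \<omega>)) \<le> real N powr X}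
       \<le> exp (- (p1 / (32 * (K1 + 2 * C + 3))) * (\<epsilon> * L)\<^sup>2) + (real J + 1) * (real N)\<^sup>2 * exp (- (\<epsilon> * L)\<^sup>2 / (2 * (8 * C + 1)))"
    proof (rule few_thick_points[where t = "a * L" and W = "b * L - d" and B = B and p = p and m = m and T = "G * \<eta> * L"])
      show "B \<le> real ((r k div (8 * r (Suc k)))\<^sup>2)" if "1 \<le> k" "k < J" for k
        unfolding B_def using rad(5)[OF that(2)] .
      show "b * L - d > 0" using elim(3) by (simp add: L_def)
      show "b * L - d \<le> 2 / pi * (ln (real (r k)) - ln (real (r (Suc k)))) - 2 * C" if "1 \<le> k" "k < J" for k
      proof -
        have "2 / pi * (L / real J - ln 2) \<le> 2 / pi * (ln (real (r k)) - ln (real (r (Suc k))))"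
          using rad(6)[OF that(2)] by (intro mult_left_mono) (auto simp: L_def)
        moreover have "b * L - d = 2 / pi * (L / real J - ln 2) - 2 * C"
          by (simp add: b_def d_def right_diff_distrib)
        ultimately show ?thesis by linarith
      qed
      show "a * L \<ge> 0" using ab L by simp
      show "2 \<le> p * B" using pB elim(5) by simp
      show "real m \<le> p1 / 8 * B * (p * B / 2) ^ (J - 2)"
      proof -
        have "real m \<le> real N powr X + 1" unfolding m_def by simp
        also have "\<dots> \<le> c5 * real N powr Yx" by (rule elim(6))
        also have "real N powr Yx = (real N powr u) ^ (J - 2)" using N2 by (simp add: Yx_def powr_power mult.commute)
        also have "c5 * (real N powr u) ^ (J - 2) = p1 / 8 * (1 / 1024) * (real N powr u / 2048) ^ (J - 2)"
          by (simp add: c5_def power_divide)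
        also have "\<dots> \<le> p1 / 8 * B * (p * B / 2) ^ (J - 2)"
        proof (rule mult_mono)
          have "1 \<le> z\<^sup>2" using z(1) by (intro one_le_power) auto
          hence B: "1 / 1024 \<le> B" "0 \<le> B" by (auto simp: B_def)
          show "p1 / 8 * (1 / 1024) \<le> p1 / 8 * B" using B(1) p1 by (intro mult_left_mono) auto
          show "(real N powr u / 2048) ^ (J - 2) \<le> (p * B / 2) ^ (J - 2)"
            using pB by (intro power_mono) auto
          show "0 \<le> p1 / 8 * B" using p1 B(2) by simp
          show "0 \<le> (real N powr u / 2048) ^ (J - 2)" by simp
        qed
        finally show ?thesis .
      qed
      show "\<epsilon> * L \<ge> 0" using \<epsilon> L by simp
      have cancel: "s * (t / s * w) = t * w" if "s \<noteq> 0" for s t w :: real using that by simp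
      have q: "real (J - 2) \<noteq> 0" "real J + 2 \<noteq> 0" using Jm2(2) by linarith+
      have e1: "real (J - 2) * (a * L) = G * \<eta>1 * L" unfolding a_def by (rule cancel[OF q(1)])
      have e2: "(real J + 2) * (\<epsilon> * L) = G * (\<eta>1 - \<eta>) * L" unfolding \<epsilon>_def by (rule cancel[OF q(2)])
      show "G * \<eta> * L \<le> real (J - 2) * (a * L) - (real J + 2) * (\<epsilon> * L)"
        unfolding e1 e2 by (simp add: algebra_simps)
      show "(\<epsilon> * L)\<^sup>2 / (2 * (K1 + 2 * C + 3) * real n) \<le> 1"
      proof -
        have "\<kappa> / 4 * z \<le> real n" using fn(1) yz by simp
        moreover have "\<kappa> / 4 * z > 0" using \<kappa> z by simp
        ultimately have "(\<epsilon> * L)\<^sup>2 / (2 * C4 * real n) \<le> (\<epsilon> * L)\<^sup>2 / (2 * C4 * (\<kappa> / 4 * z))"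
          using C4 \<kappa>(1) z(1) fn(3) by (intro divide_left_mono mult_left_mono mult_pos_pos) auto
        also have "\<dots> \<le> 1" using elim(7) by (simp add: L_def z_def power_mult_distrib mult.assoc)
        finally show ?thesis by (simp add: C4_def)
      qed
      fix \<omega> assume "\<omega> \<in> {\<omega> \<in> space (M N). real (card (thick N l \<eta> (Phi N) \<omega>)) \<le> real N powr X}"
      hence w: "\<omega> \<in> space (M N)" "real (card (thick N l \<eta> (Phi N) \<omega>)) \<le> real N powr X" by auto
      have "int (card (thick N l \<eta> (Phi N) \<omega>)) \<le> \<lfloor>real N powr X\<rfloor>" using w(2) by (simp add: le_floor_iff)
      hence "card (thick N l \<eta> (Phi N) \<omega>) < m" unfolding m_def by linarith
      moreover have "thick N l \<eta> (Phi N) \<omega> = {x \<in> box_l N l. G * \<eta> * L \<le> Phi N x \<omega>}"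
        by (simp add: thick_def G_def L_def)
      ultimately show "\<omega> \<in> space (M N) \<and> card {x \<in> box_l N l. G * \<eta> * L \<le> Phi N x \<omega>} < m" using w(1) by simp
    qed (simp_all add: p_def p1_def)
    also have "- (p1 / (32 * (K1 + 2 * C + 3))) * (\<epsilon> * L)\<^sup>2 = - (c1 * L\<^sup>2)"
      by (simp add: c1_def C4_def power_mult_distrib)
    also have "- (\<epsilon> * L)\<^sup>2 / (2 * (8 * C + 1)) = - (c2 * L\<^sup>2)"
      by (simp add: c2_def power_mult_distrib)
    also have "(real N)\<^sup>2 = exp (2 * L)" by (subst L(2)) (rule exp_double[symmetric])
    also have "exp (- (c1 * L\<^sup>2)) + (real J + 1) * exp (2 * L) * exp (- (c2 * L\<^sup>2))
      \<le> exp (- 2 * c * L\<^sup>2) + (real J + 1) * exp (2 * L) * exp (- 2 * c * L\<^sup>2)"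
    proof -
      have "2 * c * L\<^sup>2 \<le> c1 * L\<^sup>2" "2 * c * L\<^sup>2 \<le> c2 * L\<^sup>2" using c by (auto intro: mult_right_mono)
      thus ?thesis by (intro add_mono mult_left_mono) auto
    qed
    also have "\<dots> = exp (- 2 * c * L\<^sup>2) * (1 + (real J + 1) * exp (2 * L))" by (simp add: algebra_simps)
    also have "\<dots> \<le> exp (- c * L\<^sup>2)" using elim(8) by (simp add: L_def)
    finally show ?case by (simp add: L_def)
  qed
  thus ?thesis using c(1) unfolding X_def by blast
qed

section \<open>First moment upper bound\<close>

lemma finite_box_l [simp]: "finite (box_l N l)" and card_box_l: "card (box_l N l) \<le> N\<^sup>2"
proof -
  have b: "finite (box N)" "card (box N) = N\<^sup>2" by (auto simp: box_def power2_eq_square)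
  have s: "box_l N l \<subseteq> box N" by (auto simp: box_l_def)
  show "finite (box_l N l)" using finite_subset[OF s b(1)] .
  show "card (box_l N l) \<le> N\<^sup>2" using card_mono[OF b(1) s] b(2) by simp
qed

context gff_field
begin

lemma card_thick_eq_sum:
  "real (card (thick N l \<eta> Phi \<omega>)) = (\<Sum>x\<in>box_l N l. if 2 * sqrt (2 / pi) * \<eta> * ln (real N) \<le> Phi x \<omega> then 1 else 0)"
  unfolding thick_def by (simp add: sum.inter_filter[symmetric])

lemma measurable_card_thick [measurable]: "(\<lambda>\<omega>. real (card (thick N l \<eta> Phi \<omega>))) \<in> borel_measurable M"
  unfolding card_thick_eq_sum by measurable

text \<open>Markov's inequality for the number of high points. Only the one-point tails enter, so
  correlations do not matter here.\<close>

lemma many_thick_points: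
  assumes W: "W > 0" "\<And>x. x \<in> box_l N l \<Longrightarrow> x \<in> intr N \<and> gr (intr N) x x \<le> W" and K: "K > 0"
    and \<eta>: "\<eta> \<ge> 0" and N: "N \<ge> 1"
  defines "T \<equiv> 2 * sqrt (2 / pi) * \<eta> * ln (real N)"
  shows "prob {\<omega> \<in> space M. K < real (card (thick N l \<eta> Phi \<omega>))} \<le> (real N)\<^sup>2 * exp (- T\<^sup>2 / (2 * W)) / K"
proof -
  have T: "T \<ge> 0" using \<eta> N by (simp add: T_def)
  have bound: "real (card (thick N l \<eta> Phi \<omega>)) \<le> (real N)\<^sup>2" for \<omega>
  proof -
    have "card (thick N l \<eta> Phi \<omega>) \<le> card (box_l N l)" by (intro card_mono) (auto simp: thick_def)
    also have "\<dots> \<le> N\<^sup>2" by (rule card_box_l)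
    finally show ?thesis by (simp flip: of_nat_power)
  qed
  have int: "integrable M (\<lambda>\<omega>. real (card (thick N l \<eta> Phi \<omega>)))"
    using bound by (intro integrable_bounded[where B = "(real N)\<^sup>2"]) auto
  have "K * prob {\<omega> \<in> space M. K < real (card (thick N l \<eta> Phi \<omega>))}
      = expectation (\<lambda>\<omega>. K * indicator {\<omega> \<in> space M. K < real (card (thick N l \<eta> Phi \<omega>))} \<omega>)"
    by simp
  also have "\<dots> \<le> expectation (\<lambda>\<omega>. real (card (thick N l \<eta> Phi \<omega>)))"
    using K by (intro integral_mono int integrable_mult_right integrable_bounded[where B = 1]) (auto simp: indicator_def)
  also have "\<dots> = expectation (\<lambda>\<omega>. \<Sum>x\<in>box_l N l. indicator {\<omega> \<in> space M. T \<le> Phi x \<omega>} \<omega>)"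
    unfolding card_thick_eq_sum by (intro Bochner_Integration.integral_cong refl sum.cong) (auto simp: T_def indicator_def)
  also have "\<dots> = (\<Sum>x\<in>box_l N l. prob {\<omega> \<in> space M. T \<le> Phi x \<omega>})"
  proof (subst Bochner_Integration.integral_sum)
    show "integrable M (indicator {\<omega> \<in> space M. T \<le> Phi x \<omega>} :: 'a \<Rightarrow> real)" for x
      by (intro integrable_bounded[where B = 1]) (auto simp: indicator_def)
  qed simp
  also have "\<dots> \<le> (\<Sum>x\<in>box_l N l. exp (- T\<^sup>2 / (2 * W)))"
  proof (intro sum_mono)
    fix x assume x: "x \<in> box_l N l"
    have "V (gr (intr N) x) = gr (intr N) x x" by (intro En_gr_gr_subset) auto
    hence "prob {\<omega> \<in> space M. T \<le> Y (gr (intr N) x) \<omega>} \<le> exp (- T\<^sup>2 / (2 * W))"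
      using W(1) W(2)[OF x] T by (intro Y_tail gr_supp) auto
    thus "prob {\<omega> \<in> space M. T \<le> Phi x \<omega>} \<le> exp (- T\<^sup>2 / (2 * W))"
      using W(2)[OF x] by (simp add: Y_gr)
  qed
  also have "\<dots> = real (card (box_l N l)) * exp (- T\<^sup>2 / (2 * W))" by simp
  also have "\<dots> \<le> (real N)\<^sup>2 * exp (- T\<^sup>2 / (2 * W))"
    using card_box_l[of N l] by (intro mult_right_mono) (auto simp flip: of_nat_power)
  finally show ?thesis using K by (simp add: pos_le_divide_eq mult.commute)
qed

end

text \<open>The variance in the bulk is (2 / pi) ln N + O(1). The bounded error changes the
  one-point probability N^(-2 \<eta>^2) only by a constant factor, and Markov's inequality leaves
  N^(- \<epsilon>).\<close>

lemma many_thick_points_gff: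
  fixes M :: "nat \<Rightarrow> 'a measure" and Phi :: "nat \<Rightarrow> pt \<Rightarrow> 'a \<Rightarrow> real" and l \<eta> \<epsilon> :: real
  assumes gff: "\<And>N. N \<ge> 1 \<Longrightarrow> is_GFF (M N) N (Phi N)"
    and l: "0 < l" "l < 1/2" and eta: "0 < \<eta>"
  shows "\<exists>C. \<forall>\<^sub>F N in sequentially.
            measure (M N) {\<omega> \<in> space (M N). real N powr (2 * (1 - \<eta>\<^sup>2) + \<epsilon>) < real (card (thick N l \<eta> (Phi N) \<omega>))}
            \<le> C * real N powr (- \<epsilon>)"
proof -
  obtain CD where CD: "\<And>N x y. 2 / l \<le> real N \<Longrightarrow> x \<in> intr N \<Longrightarrow> y \<in> intr N \<Longrightarrow> y \<in> box_l N l \<Longrightarrow>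
    \<bar>gr (intr N) x y - 2 / pi * (ln (real N) - lf (x - y))\<bar> \<le> CD"
    using green_box_estimate[OF l] by metis
  define C where "C = max 0 CD"
  \<comment> \<open>Chosen so that the terms linear in L cancel in (2 \<eta>^2 L - K0) * 2 W,
    leaving T^2 minus a nonnegative constant.\<close>
  define K0 where "K0 = \<eta>\<^sup>2 * pi * C"
  have C: "C \<ge> 0" "CD \<le> C" by (auto simp: C_def)
  have "\<forall>\<^sub>F N in sequentially. 2 / l \<le> real N" by (rule eventually_real_nat[OF eventually_ge_at_top])
  hence "\<forall>\<^sub>F N in sequentially.
            measure (M N) {\<omega> \<in> space (M N). real N powr (2 * (1 - \<eta>\<^sup>2) + \<epsilon>) < real (card (thick N l \<eta> (Phi N) \<omega>))}
            \<le> exp K0 * real N powr (- \<epsilon>)"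
  proof eventually_elim
    case (elim N)
    have "2 / l > 2" using l by (simp add: pos_less_divide_eq)
    hence N2: "real N > 2" using elim by linarith
    define L where "L = ln (real N)"
    have L: "L > 0" "real N = exp L" "N \<ge> 1" using N2 by (auto simp: L_def)
    have lN: "l * real N > 1" using elim l by (simp add: pos_divide_le_eq mult.commute)
    interpret gff_field "M N" N "Phi N" by unfold_locales (rule gff[OF L(3)])
    define W where "W = 2 / pi * L + C"
    have W: "W > 0" using L C by (simp add: W_def add_pos_nonneg)
    define T where "T = 2 * sqrt (2 / pi) * \<eta> * ln (real N)"
    have "prob {\<omega> \<in> space (M N). real N powr (2 * (1 - \<eta>\<^sup>2) + \<epsilon>) < real (card (thick N l \<eta> (Phi N) \<omega>))}
       \<le> (real N)\<^sup>2 * exp (- T\<^sup>2 / (2 * W)) / real N powr (2 * (1 - \<eta>\<^sup>2) + \<epsilon>)"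
      unfolding T_def
    proof (rule many_thick_points[OF W])
      fix x assume x: "x \<in> box_l N l"
      have xi: "x \<in> intr N" by (rule box_l_subset_intr[OF x lN L(3)])
      have "\<bar>gr (intr N) x x - 2 / pi * L\<bar> \<le> CD" using CD[OF elim xi xi x] by (simp add: L_def)
      thus "x \<in> intr N \<and> gr (intr N) x x \<le> W" using xi C(2) by (simp add: W_def abs_le_iff)
    qed (use eta L N2 in auto)
    also have "\<dots> = exp (2 * L - T\<^sup>2 / (2 * W) - (2 * (1 - \<eta>\<^sup>2) + \<epsilon>) * L)"
    proof -
      have "(real N)\<^sup>2 = exp (2 * L)" by (subst L(2)) (rule exp_double[symmetric])
      moreover have "real N powr (2 * (1 - \<eta>\<^sup>2) + \<epsilon>) = exp ((2 * (1 - \<eta>\<^sup>2) + \<epsilon>) * L)"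
        using N2 by (simp add: powr_def L_def)
      moreover have "exp x * exp (- t / w) / exp y = exp (x - t / w - y)" for x y t w :: real
        by (simp add: exp_diff exp_minus divide_inverse)
      ultimately show ?thesis by (simp only:)
    qed
    also have "\<dots> \<le> exp (K0 - \<epsilon> * L)"
    proof -
      have T2: "T\<^sup>2 = 8 / pi * \<eta>\<^sup>2 * L\<^sup>2" by (simp add: T_def L_def power_mult_distrib)
      have "(2 * \<eta>\<^sup>2 * L - K0) * (2 * W) \<le> T\<^sup>2"
      proof -
        have "(2 * \<eta>\<^sup>2 * L - K0) * (2 * W) = 8 / pi * \<eta>\<^sup>2 * L\<^sup>2 - 2 * (\<eta>\<^sup>2 * pi * C\<^sup>2)"
          by (simp add: W_def K0_def field_simps power2_eq_square)
        moreover have "\<eta>\<^sup>2 * pi * C\<^sup>2 \<ge> 0" by simp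
        ultimately show ?thesis using T2 by linarith
      qed
      hence "2 * \<eta>\<^sup>2 * L - K0 \<le> T\<^sup>2 / (2 * W)" using W by (simp add: pos_le_divide_eq)
      thus ?thesis by (simp add: algebra_simps)
    qed
    also have "\<dots> = exp K0 * real N powr (- \<epsilon>)"
      using N2 by (simp add: powr_def L_def exp_diff exp_minus divide_inverse)
    finally show ?case .
  qed
  thus ?thesis by blast
qed

theorem theorem1p3:
  fixes M :: "nat \<Rightarrow> 'a measure" and Phi :: "nat \<Rightarrow> pt \<Rightarrow> 'a \<Rightarrow> real"
    and l \<eta> :: real
  assumes gff: "\<And>N. N \<ge> 1 \<Longrightarrow> is_GFF (M N) N (Phi N)"
    and l: "0 < l" "l < 1/2"
    and eta: "0 < \<eta>" "\<eta> < 1"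
  shows "(\<forall>\<epsilon>>0. ((\<lambda>N. measure (M N)
            {\<omega> \<in> space (M N).
               \<bar>ln (real (card (thick N l \<eta> (Phi N) \<omega>))) / ln (real N) - 2 * (1 - \<eta>\<^sup>2)\<bar> > \<epsilon>})
          \<longlongrightarrow> 0) sequentially)
    \<and> (\<forall>\<delta>>0. \<exists>c>0. \<forall>\<^sub>F N in sequentially.
            measure (M N) {\<omega> \<in> space (M N).
               real (card (thick N l \<eta> (Phi N) \<omega>)) \<le> real N powr (2 * (1 - \<eta>\<^sup>2) - \<delta>)}
            \<le> exp (- c * (ln (real N))\<^sup>2))"
proof (intro conjI allI impI)
  fix \<delta> :: real assume "\<delta> > 0"
  with few_thick_points_gff[of M Phi, OF gff l eta] show "\<exists>c>0. \<forall>\<^sub>F N in sequentially.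
            measure (M N) {\<omega> \<in> space (M N).
               real (card (thick N l \<eta> (Phi N) \<omega>)) \<le> real N powr (2 * (1 - \<eta>\<^sup>2) - \<delta>)}
            \<le> exp (- c * (ln (real N))\<^sup>2)" by blast
next
  fix \<epsilon> :: real assume \<epsilon>: "\<epsilon> > 0"
  let ?\<mu> = "2 * (1 - \<eta>\<^sup>2)"
  have \<mu>: "?\<mu> > 0" using eta by (simp add: power_less_one_iff)
  obtain c where c: "c > 0" "\<forall>\<^sub>F N in sequentially.
      measure (M N) {\<omega> \<in> space (M N). real (card (thick N l \<eta> (Phi N) \<omega>)) \<le> real N powr (?\<mu> - \<epsilon>)} \<le> exp (- c * (ln (real N))\<^sup>2)"
    using few_thick_points_gff[of M Phi, OF gff l eta \<epsilon>] by blast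
  obtain C where C: "\<forall>\<^sub>F N in sequentially.
      measure (M N) {\<omega> \<in> space (M N). real N powr (?\<mu> + \<epsilon>) < real (card (thick N l \<eta> (Phi N) \<omega>))} \<le> C * real N powr (- \<epsilon>)"
    using many_thick_points_gff[of M Phi l \<eta> \<epsilon>, OF gff l eta(1)] by blast
  have lim: "(\<lambda>N. C * real N powr (- \<epsilon>) + exp (- c * (ln (real N))\<^sup>2)) \<longlonglongrightarrow> C * 0 + 0"
  proof (intro tendsto_add tendsto_mult tendsto_const)
    have "((\<lambda>x::real. x powr (- \<epsilon>)) \<longlongrightarrow> 0) at_top" "((\<lambda>x::real. exp (- c * (ln x)\<^sup>2)) \<longlongrightarrow> 0) at_top"
      using \<epsilon> c(1) by (real_asymp, real_asymp)
    thus "(\<lambda>N. real N powr (- \<epsilon>)) \<longlonglongrightarrow> 0" "(\<lambda>N. exp (- c * (ln (real N))\<^sup>2)) \<longlonglongrightarrow> 0"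
      using filterlim_real_sequentially by (auto intro: filterlim_compose)
  qed
  show "(\<lambda>N. measure (M N) {\<omega> \<in> space (M N).
      \<bar>ln (real (card (thick N l \<eta> (Phi N) \<omega>))) / ln (real N) - ?\<mu>\<bar> > \<epsilon>}) \<longlonglongrightarrow> 0"
  proof (rule tendsto_sandwich[OF _ _ tendsto_const])
    show "\<forall>\<^sub>F N in sequentially. 0 \<le> measure (M N) {\<omega> \<in> space (M N).
      \<bar>ln (real (card (thick N l \<eta> (Phi N) \<omega>))) / ln (real N) - ?\<mu>\<bar> > \<epsilon>}" by simp
    show "(\<lambda>N. C * real N powr (- \<epsilon>) + exp (- c * (ln (real N))\<^sup>2)) \<longlonglongrightarrow> 0" using lim by simp
    show "\<forall>\<^sub>F N in sequentially. measure (M N) {\<omega> \<in> space (M N).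
      \<bar>ln (real (card (thick N l \<eta> (Phi N) \<omega>))) / ln (real N) - ?\<mu>\<bar> > \<epsilon>}
      \<le> C * real N powr (- \<epsilon>) + exp (- c * (ln (real N))\<^sup>2)"
      using c(2) C eventually_gt_at_top[of 1]
    proof eventually_elim
      case (elim N)
      interpret gff_field "M N" N "Phi N" by unfold_locales (rule gff, use elim in simp)
      let ?H = "\<lambda>\<omega>. real (card (thick N l \<eta> (Phi N) \<omega>))"
      let ?lo = "{\<omega> \<in> space (M N). ?H \<omega> \<le> real N powr (?\<mu> - \<epsilon>)}"
      let ?hi = "{\<omega> \<in> space (M N). real N powr (?\<mu> + \<epsilon>) < ?H \<omega>}"
      have lnN: "ln (real N) > 0" using elim by simp
      \<comment> \<open>A deviation of the exponent by more than \<epsilon> puts the count above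
        N^(\<mu> + \<epsilon>), excluded by the first moment, or at most N^(\<mu> - \<epsilon>),
        excluded by the lower bound with \<delta> = \<epsilon>.\<close>
      have "{\<omega> \<in> space (M N). \<bar>ln (?H \<omega>) / ln (real N) - ?\<mu>\<bar> > \<epsilon>} \<subseteq> ?hi \<union> ?lo"
      proof
        fix \<omega> assume "\<omega> \<in> {\<omega> \<in> space (M N). \<bar>ln (?H \<omega>) / ln (real N) - ?\<mu>\<bar> > \<epsilon>}"
        hence w: "\<omega> \<in> space (M N)" "ln (?H \<omega>) / ln (real N) > ?\<mu> + \<epsilon> \<or> ln (?H \<omega>) / ln (real N) < ?\<mu> - \<epsilon>" by auto
        show "\<omega> \<in> ?hi \<union> ?lo"
        \<comment> \<open>An empty set of high points belongs to \<open>?lo\<close> outright,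
          whatever value \<open>ln 0\<close> has.\<close>
        proof (cases "?H \<omega> = 0")
          case True
          thus ?thesis using w(1) by simp
        next
          case False
          hence H: "?H \<omega> > 0" by simp
          from w(2) show ?thesis
          proof
            assume "ln (?H \<omega>) / ln (real N) > ?\<mu> + \<epsilon>"
            hence "(?\<mu> + \<epsilon>) * ln (real N) < ln (?H \<omega>)" using lnN by (simp add: pos_less_divide_eq)
            hence "exp ((?\<mu> + \<epsilon>) * ln (real N)) < ?H \<omega>" using H by (metis exp_less_cancel_iff exp_ln)
            thus ?thesis using w(1) elim by (simp add: powr_def)
          next
            assume "ln (?H \<omega>) / ln (real N) < ?\<mu> - \<epsilon>"
            hence "ln (?H \<omega>) < (?\<mu> - \<epsilon>) * ln (real N)" using lnN by (simp add: pos_divide_less_eq)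
            hence "?H \<omega> < exp ((?\<mu> - \<epsilon>) * ln (real N))" using H by (metis exp_less_cancel_iff exp_ln)
            thus ?thesis using w(1) elim by (simp add: powr_def)
          qed
        qed
      qed
      hence "prob {\<omega> \<in> space (M N). \<bar>ln (?H \<omega>) / ln (real N) - ?\<mu>\<bar> > \<epsilon>} \<le> prob (?hi \<union> ?lo)"
        by (intro finite_measure_mono) auto
      also have "\<dots> \<le> prob ?hi + prob ?lo" by (intro measure_Un_le) auto
      also have "\<dots> \<le> C * real N powr (- \<epsilon>) + exp (- c * (ln (real N))\<^sup>2)" using elim by simp
      finally show ?case .
    qed
  qed
qed

end
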